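(* In the setting of the optimal investment problem with vintage capital described in the context, suppose that $$\lambda+\mu>\frac{1}{\mu}\,[(h_0^* )']\,[R']\,|\alpha|_V^2,\qquad\text{or}\qquad \lambda+\mu>\frac{\bar s}{\sqrt2}\,[(h_0^* )']\,[R']\,|\alpha|_V^2 .$$ Then there exists a unique equilibrium point for the problem, i.e. a unique $x\in D(A)$ such that $Ax+B(h_0^* )'(-B^*\Psi'(x))=0$.
   Context: Spaces and operators. Let $\bar s\in(0,+\infty]$ (finite when the second inequality is used), $\mu>0$, $\lambda>0$, $H=L^2(0,\bar s)$, $U=\mathbb R\times H$. $A_0f=-f'-\mu f$ with $D(A_0)=\{f\in H^1(0,\bar s): f(0)=0\}$, the generator of a strongly continuous semigroup on $H$. Its adjoint is $A_0^*f=f'-\mu f$ on $V:=D(A_0^* )=\{f\in H^1(0,\bar s): f(\bar s)=0\}$, endowed with $(v|w)_V=(v|w)_H+(A_0^*v|A_0^*w)_H$. $V'$ is the dual of $V$, with $V\subset H\equiv H'\subset V'$ and duality pairing $\langle\cdot,\cdot\rangle$. The semigroup extends to a strongly continuous semigroup $e^{tA}$ on $V'$ with generator $A$, $D(A)=H$, extending $A_0$. $B\in L(U,V')$ is $B(u_0,u_1)=u_1+u_0\delta_0$, with $\delta_0$ the Dirac delta at $0$; its adjoint is $B^*:V\to U$. Notation. $[f]$ denotes the Lipschitz constant of a map $f$ between Banach spaces. $\mathcal B_r(X)$ is the set of $f:X\to\mathbb R$ with $\sup_x|f(x)|/(1+|x|_X^r)<\infty$. $\Sigma_0(X)$ is the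 set of convex $w\in\mathcal B_2(X)$ that are $C^1$ (Fréchet) with $[w']<\infty$. Derivatives of functions on $V'$ are $V$-valued, those of functions on $U$ are $U$-valued. $h_0^*$ is the convex conjugate of $h_0$. Data. $\alpha\in V$ is positive, $R:\mathbb R\to\mathbb R$ is concave and $C^1$ with Lipschitz derivative, $g_0(x)=-R(\langle\alpha,x\rangle)$ for $x\in V'$, and $h_0(u)=c_0(u_0)+\int_0^{\bar s}c_1(s,u_1(s))\,ds$ for $u=(u_0,u_1)\in U$, with $c_0$ and $c_1(s,\cdot)$ convex, possibly taking the value $+\infty$. It is assumed that: $g_0\in\Sigma_0(V')$; $h_0$ is convex, lower semicontinuous, with $\partial h_0$ injective; $h_0^*(0)=0$ and $h_0^*\in\Sigma_0(U)$; there are $a>0$, $b\in\mathbb R$, $p\ge2$ with $h_0(u)\ge a|u|_U^p+b$ for all $u\in U$; and either $p>2$, or $g_0\in\mathcal B_1(V')$. Value function. For $x\in V'$ and $u\in L^p_\lambda(0,+\infty;U)=\{u:\ \tau\mapsto u(\tau)e^{-\lambda\tau/p}\in L^p(0,+\infty;U)\}$, let $y(\tau)=e^{\tau A}x+\int_0^\tau e^{(\tau-\sigma)A}Bu(\sigma)\,d\sigma$ and $$\Psi(x)=\inf_{u\in L^p_\lambda(0,+\infty;U)}\int_0^{+\infty}e^{-\lambda\tau}[g_0(y(\tau))+h_0(u(\tau))]\,d\tau .$$ Under these assumptions $\Psi\in\Sigma_0(V')$ (known), and $\Psi'$ is its Fréchet derivative. *)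

theory Defs
  imports "HOL-Analysis.Analysis"
begin

section \<open>Convex analysis for extended-real-valued functions\<close>

text \<open>Integral with values in the extended reals of an integrand that may take the value
  \<open>+\<infinity>\<close>; since \<open>\<infinity> - \<infinity> = \<infinity>\<close> in type \<^typ>\<open>ereal\<close>, it is \<open>+\<infinity>\<close> as soon as the positive
  part is not integrable.\<close>

definition ext_integral :: "'a measure \<Rightarrow> ('a \<Rightarrow> ereal) \<Rightarrow> ereal" where
  "ext_integral M f =
     enn2ereal (\<integral>\<^sup>+ x. e2ennreal (f x) \<partial>M) - enn2ereal (\<integral>\<^sup>+ x. e2ennreal (- f x) \<partial>M)"

definition ereal_convex :: "('a::real_vector \<Rightarrow> ereal) \<Rightarrow> bool" where
  "ereal_convex f \<longleftrightarrow>
     (\<forall>x y t. 0 < t \<longrightarrow> t < 1 \<longrightarrow>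
        f ((1 - t) *\<^sub>R x + t *\<^sub>R y) \<le> ereal (1 - t) * f x + ereal t * f y)"

definition lower_semicont :: "('a::topological_space \<Rightarrow> ereal) \<Rightarrow> bool" where
  "lower_semicont f \<longleftrightarrow> (\<forall>x. \<forall>r<f x. eventually (\<lambda>y. r < f y) (nhds x))"

definition subdiff :: "('a::real_inner \<Rightarrow> ereal) \<Rightarrow> 'a \<Rightarrow> 'a set" where
  "subdiff f u = {z. \<bar>f u\<bar> \<noteq> \<infinity> \<and> (\<forall>w. f u + ereal (z \<bullet> (w - u)) \<le> f w)}"

definition subdiff_injective :: "('a::real_inner \<Rightarrow> ereal) \<Rightarrow> bool" where
  "subdiff_injective f \<longleftrightarrow> (\<forall>u w. subdiff f u \<inter> subdiff f w \<noteq> {} \<longrightarrow> u = w)"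

definition conjugate :: "('a::real_inner \<Rightarrow> ereal) \<Rightarrow> 'a \<Rightarrow> ereal" where
  "conjugate f z = (SUP u. ereal (z \<bullet> u) - f u)"

section \<open>Function classes and Lipschitz constants\<close>

definition lip_const :: "('a::metric_space \<Rightarrow> 'b::metric_space) \<Rightarrow> real" where
  "lip_const f = Inf {L. L-lipschitz_on UNIV f}"

definition growth_class :: "nat \<Rightarrow> ('a::real_normed_vector \<Rightarrow> real) set" where
  "growth_class r = {f. bdd_above (range (\<lambda>x. \<bar>f x\<bar> / (1 + norm x ^ r)))}"

text \<open>The derivative takes its values in the dual space here. For a Hilbert space, or for the dual
  \<open>V'\<close> of a Hilbert space \<open>V\<close>, it is identified below with its Riesz representative, respectively
  with an element of \<open>V\<close>; these identifications are isometric.\<close>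

definition Sigma0 :: "('a::real_normed_vector \<Rightarrow> real) set" where
  "Sigma0 = {w. convex_on UNIV w \<and> w \<in> growth_class 2 \<and>
     (\<exists>w' :: 'a \<Rightarrow> 'a \<Rightarrow>\<^sub>L real.
        (\<forall>x. (w has_derivative blinfun_apply (w' x)) (at x)) \<and>
        continuous_on UNIV w' \<and> (\<exists>L. L-lipschitz_on UNIV w'))}"

definition grad :: "('a::real_inner \<Rightarrow> real) \<Rightarrow> 'a \<Rightarrow> 'a" where
  "grad f z = (THE d. GDERIV f z :> d)"

section \<open>The spaces \<open>H = L\<^sup>2(0, sbar)\<close> and \<open>V = D(A\<^sub>0\<^sup>*)\<close>\<close>

text \<open>Neither \<open>L\<^sup>2(0, sbar)\<close> nor \<open>V\<close> can be a type constructor, because of the real parameter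
  \<open>sbar\<close>. Hence \<open>H\<close> and \<open>V\<close> are types of Hilbert spaces which are linked to the function spaces by
  isometric isomorphisms: \<open>rH f\<close> is a representative of the class \<open>f \<in> H\<close>, and \<open>j\<close> is the inclusion
  of \<open>V\<close> in \<open>H\<close>. Any infinite-dimensional separable Hilbert space type can be taken
  for both, whatever \<open>sbar\<close> is.\<close>

definition ages :: "ereal \<Rightarrow> real set" where
  "ages sbar = {s. 0 < s \<and> ereal s < sbar}"

definition square_integrable :: "ereal \<Rightarrow> (real \<Rightarrow> real) \<Rightarrow> bool" where
  "square_integrable sbar f \<longleftrightarrow>
     f \<in> borel_measurable (lebesgue_on (ages sbar)) \<and>
     integrable (lebesgue_on (ages sbar)) (\<lambda>s. (f s)\<^sup>2)"

definition is_L2 :: "ereal \<Rightarrow> ('h::real_inner \<Rightarrow> real \<Rightarrow> real) \<Rightarrow> bool" where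
  "is_L2 sbar rH \<longleftrightarrow>
     (\<forall>f. square_integrable sbar (rH f)) \<and>
     (\<forall>f g. AE s in lebesgue_on (ages sbar). rH (f + g) s = rH f s + rH g s) \<and>
     (\<forall>c f. AE s in lebesgue_on (ages sbar). rH (c *\<^sub>R f) s = c * rH f s) \<and>
     (\<forall>f g. f \<bullet> g = (LINT s|lebesgue_on (ages sbar). rH f s * rH g s)) \<and>
     (\<forall>\<phi>. square_integrable sbar \<phi> \<longrightarrow>
        (\<exists>f. AE s in lebesgue_on (ages sbar). rH f s = \<phi> s))"

text \<open>\<open>\<phi>\<close> is the absolutely continuous representative on \<open>[0, sbar)\<close> of an element of
  \<open>H\<^sup>1(0, sbar)\<close>, and \<open>\<psi>\<close> is its weak derivative.\<close>

definition H1_rep :: "ereal \<Rightarrow> (real \<Rightarrow> real) \<Rightarrow> (real \<Rightarrow> real) \<Rightarrow> bool" where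
  "H1_rep sbar \<phi> \<psi> \<longleftrightarrow>
     square_integrable sbar \<phi> \<and> square_integrable sbar \<psi> \<and>
     (\<forall>a b. 0 \<le> a \<longrightarrow> a \<le> b \<longrightarrow> ereal b < sbar \<longrightarrow>
        \<phi> b - \<phi> a = (LINT s|lebesgue_on {a..b}. \<psi> s))"

text \<open>\<open>f \<in> H\<close> has the representative \<open>\<phi>\<close> in \<open>H\<^sup>1(0, sbar)\<close> with derivative \<open>\<psi>\<close>, and
  \<open>\<phi>(sbar) = 0\<close>. The boundary value is a left limit in \<^typ>\<open>ereal\<close>, which covers \<open>sbar = \<infinity>\<close>.\<close>

definition D_rep ::
  "ereal \<Rightarrow> ('h \<Rightarrow> real \<Rightarrow> real) \<Rightarrow> 'h \<Rightarrow> (real \<Rightarrow> real) \<Rightarrow> (real \<Rightarrow> real) \<Rightarrow> bool" where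
  "D_rep sbar rH f \<phi> \<psi> \<longleftrightarrow>
     (AE s in lebesgue_on (ages sbar). rH f s = \<phi> s) \<and> H1_rep sbar \<phi> \<psi> \<and>
     ((\<lambda>e. \<phi> (real_of_ereal e)) \<longlongrightarrow> 0) (at_left sbar)"

definition dom_A0star :: "ereal \<Rightarrow> ('h \<Rightarrow> real \<Rightarrow> real) \<Rightarrow> 'h set" where
  "dom_A0star sbar rH = {f. \<exists>\<phi> \<psi>. D_rep sbar rH f \<phi> \<psi>}"

definition A0star :: "ereal \<Rightarrow> real \<Rightarrow> ('h \<Rightarrow> real \<Rightarrow> real) \<Rightarrow> 'h \<Rightarrow> 'h" where
  "A0star sbar \<mu> rH f =
     (THE h. \<exists>\<phi> \<psi>. D_rep sbar rH f \<phi> \<psi> \<and>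
        (AE s in lebesgue_on (ages sbar). rH h s = \<psi> s - \<mu> * \<phi> s))"

definition trace0 :: "ereal \<Rightarrow> ('h \<Rightarrow> real \<Rightarrow> real) \<Rightarrow> 'h \<Rightarrow> real" where
  "trace0 sbar rH f = (THE c. \<exists>\<phi> \<psi>. D_rep sbar rH f \<phi> \<psi> \<and> c = \<phi> 0)"

definition is_V ::
  "ereal \<Rightarrow> real \<Rightarrow> ('h::real_inner \<Rightarrow> real \<Rightarrow> real) \<Rightarrow> ('v::real_inner \<Rightarrow> 'h) \<Rightarrow> bool" where
  "is_V sbar \<mu> rH j \<longleftrightarrow>
     linear j \<and> inj j \<and> range j = dom_A0star sbar rH \<and>
     (\<forall>v w. v \<bullet> w = j v \<bullet> j w + A0star sbar \<mu> rH (j v) \<bullet> A0star sbar \<mu> rH (j w))"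

section \<open>Operators on the dual space \<open>V'\<close>\<close>

text \<open>\<open>V'\<close> is the type of bounded linear functionals on \<open>V\<close>, so that the duality pairing of
  \<open>x \<in> V'\<close> and \<open>v \<in> V\<close> is \<open>blinfun_apply x v\<close>.\<close>

definition emb_H :: "('v::real_normed_vector \<Rightarrow> 'h::real_inner) \<Rightarrow> 'h \<Rightarrow> 'v \<Rightarrow>\<^sub>L real" where
  "emb_H j f = Blinfun (\<lambda>v. f \<bullet> j v)"

definition dom_A :: "('v::real_normed_vector \<Rightarrow> 'h::real_inner) \<Rightarrow> ('v \<Rightarrow>\<^sub>L real) set" where
  "dom_A j = range (emb_H j)"

text \<open>The extension of \<open>A\<^sub>0\<close> to \<open>D(A) = H\<close>, with values in \<open>V'\<close>, is the transpose of
  \<open>A\<^sub>0\<^sup>* : V \<rightarrow> H\<close>.\<close>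

definition op_A ::
  "ereal \<Rightarrow> real \<Rightarrow> ('h::real_inner \<Rightarrow> real \<Rightarrow> real) \<Rightarrow> ('v::real_normed_vector \<Rightarrow> 'h) \<Rightarrow>
   ('v \<Rightarrow>\<^sub>L real) \<Rightarrow> 'v \<Rightarrow>\<^sub>L real" where
  "op_A sbar \<mu> rH j x = Blinfun (\<lambda>v. inv (emb_H j) x \<bullet> A0star sbar \<mu> rH (j v))"

definition delta0 ::
  "ereal \<Rightarrow> ('h \<Rightarrow> real \<Rightarrow> real) \<Rightarrow> ('v::real_normed_vector \<Rightarrow> 'h) \<Rightarrow> 'v \<Rightarrow>\<^sub>L real" where
  "delta0 sbar rH j = Blinfun (\<lambda>v. trace0 sbar rH (j v))"

definition op_B ::
  "ereal \<Rightarrow> ('h::real_inner \<Rightarrow> real \<Rightarrow> real) \<Rightarrow> ('v::real_normed_vector \<Rightarrow> 'h) \<Rightarrow>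
   real \<times> 'h \<Rightarrow> 'v \<Rightarrow>\<^sub>L real" where
  "op_B sbar rH j u = emb_H j (snd u) + fst u *\<^sub>R delta0 sbar rH j"

definition op_Bstar ::
  "ereal \<Rightarrow> ('h::real_inner \<Rightarrow> real \<Rightarrow> real) \<Rightarrow> ('v::real_normed_vector \<Rightarrow> 'h) \<Rightarrow>
   'v \<Rightarrow> real \<times> 'h" where
  "op_Bstar sbar rH j v = (THE z. \<forall>u. blinfun_apply (op_B sbar rH j u) v = u \<bullet> z)"

definition C0_semigroup :: "(real \<Rightarrow> 'a::real_normed_vector \<Rightarrow>\<^sub>L 'a) \<Rightarrow> bool" where
  "C0_semigroup T \<longleftrightarrow>
     T 0 = id_blinfun \<and> (\<forall>s\<ge>0. \<forall>t\<ge>0. T (s + t) = T s o\<^sub>L T t) \<and>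
     (\<forall>x. continuous_on {0..} (\<lambda>t. blinfun_apply (T t) x))"

definition is_generator ::
  "(real \<Rightarrow> 'a::real_normed_vector \<Rightarrow>\<^sub>L 'a) \<Rightarrow> 'a set \<Rightarrow> ('a \<Rightarrow> 'a) \<Rightarrow> bool" where
  "is_generator T D G \<longleftrightarrow>
     (\<forall>x z. ((\<lambda>t. (blinfun_apply (T t) x - x) /\<^sub>R t) \<longlongrightarrow> z) (at_right 0) \<longleftrightarrow>
        x \<in> D \<and> z = G x)"

section \<open>The control problem\<close>

definition profit_g0 :: "(real \<Rightarrow> real) \<Rightarrow> 'v::real_normed_vector \<Rightarrow> ('v \<Rightarrow>\<^sub>L real) \<Rightarrow> real" where
  "profit_g0 R \<alpha> x = - R (blinfun_apply x \<alpha>)"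

definition cost_h0 ::
  "ereal \<Rightarrow> ('h \<Rightarrow> real \<Rightarrow> real) \<Rightarrow> (real \<Rightarrow> ereal) \<Rightarrow> (real \<Rightarrow> real \<Rightarrow> ereal) \<Rightarrow>
   real \<times> 'h \<Rightarrow> ereal" where
  "cost_h0 sbar rH c0 c1 u =
     c0 (fst u) + ext_integral (lebesgue_on (ages sbar)) (\<lambda>s. c1 s (rH (snd u) s))"

definition Lp_controls :: "real \<Rightarrow> real \<Rightarrow> (real \<Rightarrow> 'u::real_normed_vector) set" where
  "Lp_controls p lam =
     {u. u \<in> borel_measurable (lebesgue_on {0<..}) \<and>
         integrable (lebesgue_on {0<..})
           (\<lambda>\<tau>. norm (exp (- lam * \<tau> / p) *\<^sub>R u \<tau>) powr p)}"

text \<open>The \<open>V'\<close>-valued convolution integral is evaluated against the elements of \<open>V\<close>, which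
  determines the same element of \<open>V'\<close> as the Bochner integral; the Bochner integral of the library
  needs a second countable value type, and no such instance exists for spaces of bounded linear
  functionals.\<close>

definition trajectory ::
  "(real \<Rightarrow> ('v::real_normed_vector \<Rightarrow>\<^sub>L real) \<Rightarrow>\<^sub>L ('v \<Rightarrow>\<^sub>L real)) \<Rightarrow> ('u \<Rightarrow> 'v \<Rightarrow>\<^sub>L real) \<Rightarrow>
   ('v \<Rightarrow>\<^sub>L real) \<Rightarrow> (real \<Rightarrow> 'u) \<Rightarrow> real \<Rightarrow> 'v \<Rightarrow>\<^sub>L real" where
  "trajectory T B x u \<tau> =
     blinfun_apply (T \<tau>) x +
     Blinfun (\<lambda>v. LINT \<sigma>|lebesgue_on {0..\<tau>}.
        blinfun_apply (blinfun_apply (T (\<tau> - \<sigma>)) (B (u \<sigma>))) v)"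

definition total_cost ::
  "(real \<Rightarrow> ('v::real_normed_vector \<Rightarrow>\<^sub>L real) \<Rightarrow>\<^sub>L ('v \<Rightarrow>\<^sub>L real)) \<Rightarrow> ('u \<Rightarrow> 'v \<Rightarrow>\<^sub>L real) \<Rightarrow>
   (('v \<Rightarrow>\<^sub>L real) \<Rightarrow> real) \<Rightarrow> ('u \<Rightarrow> ereal) \<Rightarrow> real \<Rightarrow>
   ('v \<Rightarrow>\<^sub>L real) \<Rightarrow> (real \<Rightarrow> 'u) \<Rightarrow> ereal" where
  "total_cost T B g0 h0 lam x u =
     ext_integral (lebesgue_on {0<..})
       (\<lambda>\<tau>. ereal (exp (- lam * \<tau>)) * (ereal (g0 (trajectory T B x u \<tau>)) + h0 (u \<tau>)))"

text \<open>Under the assumptions of the problem the infimum is finite.\<close>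

definition value_fun ::
  "(real \<Rightarrow> ('v::real_normed_vector \<Rightarrow>\<^sub>L real) \<Rightarrow>\<^sub>L ('v \<Rightarrow>\<^sub>L real)) \<Rightarrow>
   ('u::real_normed_vector \<Rightarrow> 'v \<Rightarrow>\<^sub>L real) \<Rightarrow>
   (('v \<Rightarrow>\<^sub>L real) \<Rightarrow> real) \<Rightarrow> ('u \<Rightarrow> ereal) \<Rightarrow> real \<Rightarrow> real \<Rightarrow> ('v \<Rightarrow>\<^sub>L real) \<Rightarrow> real" where
  "value_fun T B g0 h0 p lam x =
     real_of_ereal (INF u\<in>Lp_controls p lam. total_cost T B g0 h0 lam x u)"

text \<open>\<open>q \<in> V\<close> is the Frechet derivative \<open>\<Psi>'(x)\<close> of a function on \<open>V'\<close>.\<close>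

definition has_V_derivative ::
  "(('v::real_normed_vector \<Rightarrow>\<^sub>L real) \<Rightarrow> real) \<Rightarrow> 'v \<Rightarrow> ('v \<Rightarrow>\<^sub>L real) \<Rightarrow> bool" where
  "has_V_derivative \<Psi> q x \<longleftrightarrow> (\<Psi> has_derivative (\<lambda>z. blinfun_apply z q)) (at x)"

text \<open>Differentiability of \<open>\<Psi>\<close> at \<open>x\<close> is part of the equilibrium equation, so that \<open>\<Psi>'(x)\<close> never
  denotes an unspecified value; it holds at every \<open>x\<close> when \<open>\<Psi> \<in> Sigma0\<close>. The conjugate is
  real-valued under the assumptions of the problem.\<close>

definition is_equilibrium ::
  "ereal \<Rightarrow> real \<Rightarrow> ('h::real_inner \<Rightarrow> real \<Rightarrow> real) \<Rightarrow> ('v::real_normed_vector \<Rightarrow> 'h) \<Rightarrow>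
   (real \<times> 'h \<Rightarrow> ereal) \<Rightarrow> (('v \<Rightarrow>\<^sub>L real) \<Rightarrow> real) \<Rightarrow> ('v \<Rightarrow>\<^sub>L real) \<Rightarrow> bool" where
  "is_equilibrium sbar \<mu> rH j h0 \<Psi> x \<longleftrightarrow>
     x \<in> dom_A j \<and>
     (\<exists>q. has_V_derivative \<Psi> q x \<and>
        op_A sbar \<mu> rH j x +
        op_B sbar rH j
          (grad (\<lambda>z. real_of_ereal (conjugate h0 z)) (- op_Bstar sbar rH j q)) = 0)"

end

theory Submission
  imports Defs
begin

text \<open>Write \<open>q = \<Psi>'(x)\<close> and \<open>u = (h\<^sub>0\<^sup>*)'(-B\<^sup>*q)\<close>. If \<open>A x + B u = 0\<close>, the constant control \<open>u\<close>
  keeps the state at \<open>x\<close>, and \<open>x\<close> is an equilibrium iff \<open>q\<close> is the costate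
  \<open>-R'(\<rho>) \<pi>\<close>, where \<open>\<rho> = \<langle>\<alpha>, x\<rangle>\<close> and \<open>\<pi> = (\<lambda> - A\<^sub>0\<^sup>*)\<^sup>-\<^sup>1\<alpha>\<close>. If \<open>q\<close> is the costate,
  convexity shows that \<open>u\<close> is optimal at \<open>x\<close> and bounds \<open>\<Psi>\<close> below by an affine function with slope
  \<open>q\<close>, and above by this function plus a multiple of \<open>|z - x|\<^sup>2\<close>; so \<open>q = \<Psi>'(x)\<close>. Conversely, given
  \<open>q = \<Psi>'(x)\<close>, a dynamic programming argument over a short time, with the strong convexity of
  \<open>h\<^sub>0\<close> (dual to the Lipschitz continuity of \<open>(h\<^sub>0\<^sup>*)'\<close>), shows that the cost of \<open>u\<close> is \<open>\<Psi>(x)\<close>, and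
  comparing the slopes at \<open>x\<close> gives the costate.

  The equilibrium equation thus becomes the scalar fixed point equation
  \<open>\<rho> = ((h\<^sub>0\<^sup>*)'(R'(\<rho>) B\<^sup>*\<pi>) | B\<^sup>*\<eta>)\<close> with \<open>\<eta> = (-A\<^sub>0\<^sup>*)\<^sup>-\<^sup>1\<alpha>\<close>. Its right-hand side is nonincreasing:
  \<open>R'\<close> is, \<open>B\<^sup>*\<pi>\<close> and \<open>B\<^sup>*\<eta>\<close> are nonnegative because \<open>\<alpha>\<close> is, and as the cost is separable in age,
  \<open>(h\<^sub>0\<^sup>*)'\<close> is monotone for the pointwise order along the ray spanned by \<open>B\<^sup>*\<pi>\<close>.\<close>

section \<open>Hilbert space preliminaries\<close>

text \<open>The semigroup is known only through its generator. Everything rests on the energy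
  identity (A_0^* v | v) = -v(0)^2/2 - \<mu> |v|^2: it bounds the resolvents of A_0^*, duality turns
  these bounds into |T(t)| \<le> e^(-\<mu> t), and this decay makes the Laplace transforms at
  \<lambda> and at 0 converge, which produce \<pi> and \<eta>. Here \<pi> measures how a deviation
  of the control changes the discounted integral of the pairing with \<alpha>, whereas \<eta> turns
  the stationary equation into a formula for \<rho>. In the converse direction only nearly optimal
  controls are at hand, and their distance from u is not bounded beforehand. Over a short time t the
  errors are small multiples of this distance, so the quadratic gain of the strongly convex cost
  absorbs them up to o(t). Existence is settled before uniqueness because the bounds at the
  constructed equilibrium make the value finite at every state, and the converse argument applied to
  any other equilibrium uses this finiteness.\<close>

lemma nonneg_quadratic_imp_zero:
  fixes a b :: real
  assumes "\<And>s. 0 \<le> s * a + s\<^sup>2 * b"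
  shows "a = 0"
proof (rule ccontr)
  assume "a \<noteq> 0"
  define s where "s = - a / (2 * (\<bar>b\<bar> + 1))"
  have "s * a + s\<^sup>2 * b \<le> s * a + s\<^sup>2 * (\<bar>b\<bar> + 1)"
    by (intro add_left_mono mult_left_mono) auto
  also have "\<dots> = - a\<^sup>2 / (4 * (\<bar>b\<bar> + 1))"
    by (simp add: s_def field_simps power2_eq_square add_nonneg_eq_0_iff)
  also have "\<dots> < 0" using \<open>a \<noteq> 0\<close> by (simp add: divide_neg_pos)
  finally show False using assms[of s] by simp
qed

text \<open>The representing vector minimises \<open>J\<close>. The parallelogram law makes a
  minimising sequence Cauchy, and the first variation of \<open>J\<close> at the minimum, which must
  vanish, is the claimed equation.\<close>

theorem Riesz_representation:
  fixes F :: "'a::{real_inner,complete_space} \<Rightarrow>\<^sub>L real"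
  obtains w where "\<And>v. blinfun_apply F v = v \<bullet> w"
proof -
  define J where "J v = (norm v)\<^sup>2 / 2 - blinfun_apply F v" for v
  have J_lower: "- (norm F)\<^sup>2 / 2 \<le> J v" for v
  proof -
    have "blinfun_apply F v \<le> norm F * norm v"
      using norm_blinfun[of F v] by simp
    moreover have "0 \<le> (norm v - norm F)\<^sup>2" by simp
    ultimately show ?thesis by (simp add: J_def power2_diff field_simps)
  qed
  define d where "d = Inf (range J)"
  have bdd: "bdd_below (range J)" using J_lower by (auto simp: bdd_below_def)
  have d_le: "d \<le> J v" for v unfolding d_def by (rule cInf_lower[OF _ bdd]) simp
  have parallelogram: "(norm (v - w))\<^sup>2 / 4 = J v + J w - 2 * J ((v + w) /\<^sub>R 2)" for v w
    by (simp add: J_def power2_norm_eq_inner inner_diff inner_add blinfun.scaleR_right blinfun.add_right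
        inner_commute field_simps)
  have "\<exists>v. J v < d + 1 / real (Suc n)" for n
    using cInf_lessD[of "range J" "d + 1 / real (Suc n)"] by (auto simp: d_def)
  then obtain X where X: "\<And>n. J (X n) < d + 1 / real (Suc n)" by metis
  \<comment> \<open>Both values exceed \<open>d\<close> by less than 1 / (k + 1) and the value at
    the midpoint is not below \<open>d\<close>; the parallelogram identity, multiplied by 4, gives 8
    / (k + 1).\<close>
  have close: "(norm (X m - X n))\<^sup>2 \<le> 8 / real (Suc k)" if "k \<le> m" "k \<le> n" for m n k
  proof -
    have "1 / real (Suc m) \<le> 1 / real (Suc k)" "1 / real (Suc n) \<le> 1 / real (Suc k)"
      using that by (auto simp: field_simps)
    then show ?thesis
      using parallelogram[of "X m" "X n"] X[of m] X[of n] d_le[of "(X m + X n) /\<^sub>R 2"] by simp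
  qed
  have "Cauchy X"
  proof (rule CauchyI)
    fix e :: real assume "0 < e"
    obtain k where k: "8 / e\<^sup>2 < real k" using reals_Archimedean2 by blast
    have "8 / real (Suc k) < e\<^sup>2"
    proof -
      have "8 / e\<^sup>2 < real (Suc k)" using k by simp
      then show ?thesis using \<open>0 < e\<close> by (simp add: field_simps)
    qed
    then have "(norm (X m - X n))\<^sup>2 < e\<^sup>2" if "k \<le> m" "k \<le> n" for m n
      using close[OF that] by simp
    then have "\<forall>m\<ge>k. \<forall>n\<ge>k. norm (X m - X n) < e"
      using \<open>0 < e\<close> power2_less_imp_less[of _ e] by auto
    then show "\<exists>M. \<forall>m\<ge>M. \<forall>n\<ge>M. norm (X m - X n) < e" by blast
  qed
  then obtain w where w: "X \<longlonglongrightarrow> w" using Cauchy_convergent_iff convergent_def by blast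
  have "(\<lambda>n. J (X n)) \<longlonglongrightarrow> J w"
    unfolding J_def by (intro tendsto_intros w) auto
  moreover have "(\<lambda>n. d + 1 / real (Suc n)) \<longlonglongrightarrow> d + 0"
    by (intro tendsto_intros LIMSEQ_Suc[OF lim_1_over_n])
  ultimately have "J w \<le> d"
    using X by (intro LIMSEQ_le[of "\<lambda>n. J (X n)"]) (auto intro: less_imp_le)
  have "blinfun_apply F v = v \<bullet> w" for v
  proof -
    have "0 \<le> s * (v \<bullet> w - blinfun_apply F v) + s\<^sup>2 * ((norm v)\<^sup>2 / 2)" for s
    proof -
      have "J w \<le> J (w + s *\<^sub>R v)" using \<open>J w \<le> d\<close> d_le order_trans by blast
      moreover have "(norm (w + s *\<^sub>R v))\<^sup>2 = (norm w)\<^sup>2 + 2 * s * (v \<bullet> w) + s\<^sup>2 * (norm v)\<^sup>2"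
        unfolding power2_norm_eq_inner
        by (simp add: inner_add inner_commute power2_eq_square[of s] algebra_simps)
      ultimately show ?thesis
        by (simp add: J_def blinfun.scaleR_right blinfun.add_right algebra_simps)
    qed
    from nonneg_quadratic_imp_zero[OF this] show ?thesis by simp
  qed
  then show ?thesis by (rule that)
qed

text \<open>The closed sets \<open>C n\<close> exhaust the space, so by Baire's theorem one of them
  contains a ball; by linearity a bound on a ball around any centre is a bound on the norms.\<close>

theorem uniform_boundedness:
  fixes T :: "'i \<Rightarrow> 'a::banach \<Rightarrow>\<^sub>L 'b::real_normed_vector"
  assumes "\<And>x. \<exists>C. \<forall>i\<in>I. norm (blinfun_apply (T i) x) \<le> C"
  obtains M where "\<And>i. i \<in> I \<Longrightarrow> norm (T i) \<le> M"
proof -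
  define C where "C n = {x. \<forall>i\<in>I. norm (blinfun_apply (T i) x) \<le> real n}" for n
  have closed: "closed (C n)" for n
  proof -
    have "C n = (\<Inter>i\<in>I. {x. norm (blinfun_apply (T i) x) \<le> real n})" by (auto simp: C_def)
    then show ?thesis
      by (auto intro!: closed_INT closed_Collect_le continuous_intros)
  qed
  have UN: "(\<Union>n. C n) = UNIV"
  proof -
    have "\<exists>n. x \<in> C n" for x
    proof -
      obtain c where c: "\<forall>i\<in>I. norm (blinfun_apply (T i) x) \<le> c" using assms by blast
      obtain n where "c \<le> real n" using real_arch_simple by blast
      then have "x \<in> C n" using c by (auto simp: C_def intro: order_trans)
      then show ?thesis by blast
    qed
    then show ?thesis by blast
  qed
  have "\<exists>n. interior (C n) \<noteq> {}"
  proof (rule ccontr)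
    assume "\<nexists>n. interior (C n) \<noteq> {}"
    then have "euclidean interior_of \<Union>(range C) = {}"
      using Met_TC.metric_Baire_category_alt[of "range C"] closed complete_UNIV
      by (auto simp: mcomplete_iff_complete)
    then show False by (simp add: UN)
  qed
  then obtain n x r where r: "r > 0" "cball x r \<subseteq> C n"
    by (metis all_not_in_conv mem_interior_cball)
  have "norm (T i) \<le> 2 * real n / r" if i: "i \<in> I" for i
  proof (rule norm_blinfun_bound)
    show "0 \<le> 2 * real n / r" using r by simp
    fix h
    show "norm (blinfun_apply (T i) h) \<le> 2 * real n / r * norm h"
    proof (cases "h = 0")
      case False
      \<comment> \<open>Scaled to lead from the centre to the sphere; writing y = (x + y) - x costs
        the factor 2.\<close>
      define y where "y = (r / norm h) *\<^sub>R h"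
      have "norm y = r" using False r by (simp add: y_def)
      then have "x + y \<in> C n" "x \<in> C n" using r by (auto simp: subset_iff dist_norm)
      then have "norm (blinfun_apply (T i) (x + y)) \<le> real n" "norm (blinfun_apply (T i) x) \<le> real n"
        using i by (auto simp: C_def)
      then have "norm (blinfun_apply (T i) y) \<le> 2 * real n"
        using norm_triangle_ineq4[of "blinfun_apply (T i) (x + y)" "blinfun_apply (T i) x"]
        by (simp add: blinfun.add_right)
      moreover have "norm (blinfun_apply (T i) y) = r / norm h * norm (blinfun_apply (T i) h)"
        using r by (simp add: y_def blinfun.scaleR_right)
      ultimately show ?thesis using False r by (simp add: field_simps)
    qed simp
  qed
  then show ?thesis by (rule that)
qed

text \<open>The mean value inequality is applied to f minus its linear part at z, whose derivative
  is at most L |w - z| on the segment. This gives the constant L in place of the sharp L / 2, which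
  is enough.\<close>

lemma Taylor_lipschitz_derivative:
  fixes f :: "'a::real_normed_vector \<Rightarrow> real"
  assumes f: "\<And>x. (f has_derivative blinfun_apply (f' x)) (at x)"
    and L: "L-lipschitz_on UNIV f'"
  shows "\<bar>f w - f z - blinfun_apply (f' z) (w - z)\<bar> \<le> L * (norm (w - z))\<^sup>2"
proof -
  define h where "h y = f y - blinfun_apply (f' z) y" for y
  have h: "(h has_derivative blinfun_apply (f' y - f' z)) (at y within S)" for y S
    unfolding h_def
    by (auto intro!: derivative_eq_intros has_derivative_at_withinI[OF f] simp: blinfun.diff_left)
  have L0: "0 \<le> L" using L lipschitz_on_nonneg by blast
  have "norm (h w - h z) \<le> L * norm (w - z) * norm (w - z)"
  proof (rule differentiable_bound[of "closed_segment z w" h "\<lambda>y. blinfun_apply (f' y - f' z)"])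
    fix y assume y: "y \<in> closed_segment z w"
    have "onorm (blinfun_apply (f' y - f' z)) = norm (f' y - f' z)" by (simp add: norm_blinfun.rep_eq)
    also have "\<dots> \<le> L * norm (y - z)" using L by (auto simp: lipschitz_on_def dist_norm)
    also have "\<dots> \<le> L * norm (w - z)"
      using segment_bound(1)[OF y] L0 by (intro mult_left_mono) (auto simp: norm_minus_commute)
    finally show "onorm (blinfun_apply (f' y - f' z)) \<le> L * norm (w - z)" .
  qed (auto intro: h)
  then show ?thesis
    by (simp add: h_def blinfun.diff_right power2_eq_square algebra_simps)
qed

lemma GDERIV_unique:
  fixes f :: "'a::real_inner \<Rightarrow> real"
  assumes "GDERIV f z :> d" "GDERIV f z :> e"
  shows "d = e"
proof -
  have "(\<lambda>h. h \<bullet> d) = (\<lambda>h. h \<bullet> e)"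
    using assms has_derivative_unique unfolding gderiv_def by blast
  then have "(d - e) \<bullet> (d - e) = 0" by (metis inner_diff_right right_minus_eq)
  then show ?thesis by simp
qed

lemma grad_eq: "GDERIV f z :> d \<Longrightarrow> grad f z = d"
  unfolding grad_def by (rule the_equality) (auto intro: GDERIV_unique)

section \<open>Strongly continuous semigroups\<close>

lemma absolutely_integrable_iff_lebesgue_on:
  fixes f :: "real \<Rightarrow> real"
  assumes "S \<in> sets lebesgue"
  shows "f absolutely_integrable_on S \<longleftrightarrow> integrable (lebesgue_on S) f"
  using assms by (simp add: set_integrable_def integrable_restrict_space)

lemma integral_lebesgue_on_eq:
  fixes f :: "real \<Rightarrow> real"
  assumes "S \<in> sets lebesgue" "f absolutely_integrable_on S"
  shows "(LINT x|lebesgue_on S. f x) = integral S f"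
  using assms has_integral_integral_lebesgue_on[of S f]
  by (simp add: absolutely_integrable_iff_lebesgue_on integral_unique)

text \<open>The classical theorem on [0, b] is passed to the limit: integrability gives the
  convergence of the integrals and \<open>lim\<close> removes the boundary term at infinity. The
  point 0, by which the open and the closed half line differ, is a null set.\<close>

lemma FTC_Ioi:
  fixes F f :: "real \<Rightarrow> real"
  assumes F: "\<And>t. 0 \<le> t \<Longrightarrow> (F has_real_derivative f t) (at t within {0..})"
    and f: "integrable (lebesgue_on {0<..}) f" and lim: "(F \<longlongrightarrow> 0) at_top"
  shows "(LINT t|lebesgue_on {0<..}. f t) = - F 0"
proof -
  have f': "f absolutely_integrable_on {0<..}"
    using f by (simp add: absolutely_integrable_iff_lebesgue_on)
  have spike: "negligible {x \<in> {0..} - {0<..}. f x \<noteq> 0}" "negligible {x \<in> {0<..} - {0..}. f x \<noteq> 0}"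
    by (rule negligible_subset[of "{0}"]; auto)+
  have set_int0: "set_integrable lebesgue {0..} f"
    using f' absolutely_integrable_spike_set_eq[OF spike] by blast
  have "(LINT t|lebesgue_on {0<..}. f t) = integral {0<..} f"
    using f' by (intro integral_lebesgue_on_eq) auto
  also have "\<dots> = integral {0..} f" using spike by (intro integral_spike_set) auto
  also have "\<dots> = set_lebesgue_integral lebesgue {0..} f"
    by (rule set_lebesgue_integral_eq_integral(2)[OF set_int0, symmetric])
  finally have "(LINT t|lebesgue_on {0<..}. f t) = set_lebesgue_integral lebesgue {0..} f" .
  moreover have 1: "((\<lambda>b. set_lebesgue_integral lebesgue {0..b} f) \<longlongrightarrow> set_lebesgue_integral lebesgue {0..} f) at_top"
    using set_int0 by (intro tendsto_set_lebesgue_integral_at_top) auto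
  moreover have 2: "((\<lambda>b. set_lebesgue_integral lebesgue {0..b} f) \<longlongrightarrow> 0 - F 0) at_top"
  proof (rule Lim_transform_eventually)
    show "((\<lambda>b. F b - F 0) \<longlongrightarrow> 0 - F 0) at_top" by (intro tendsto_intros lim)
    show "\<forall>\<^sub>F b in at_top. F b - F 0 = set_lebesgue_integral lebesgue {0..b} f"
      using eventually_ge_at_top[of 0]
    proof eventually_elim
      case (elim b)
      have "(f has_integral F b - F 0) {0..b}"
      proof (rule fundamental_theorem_of_calculus[OF elim])
        fix t assume "t \<in> {0..b}"
        then show "(F has_vector_derivative f t) (at t within {0..b})"
          using F[of t] has_real_derivative_iff_has_vector_derivative
          by (auto intro: has_vector_derivative_within_subset)
      qed
      moreover have "set_integrable lebesgue {0..b} f"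
        using set_int0 by (rule set_integrable_subset) auto
      ultimately show ?case
        using set_lebesgue_integral_eq_integral(2)[of "{0..b}" f] by (simp add: has_integral_iff)
    qed
  qed
  ultimately show ?thesis using tendsto_unique[OF trivial_limit_at_top_linorder 1 2] by simp
qed

lemma integrable_exp_Ioi:
  fixes c :: real
  assumes "0 < c"
  shows "integrable (lebesgue_on {0<..}) (\<lambda>t. exp (- c * t))"
    "(LINT t|lebesgue_on {0<..}. exp (- c * t)) = 1 / c"
proof -
  have "(\<lambda>t. exp (- c * t)) absolutely_integrable_on {0..}"
    using integrable_on_exp_minus_to_infinity[OF assms, of 0]
    by (intro nonnegative_absolutely_integrable_1) auto
  then have "set_integrable lebesgue {0<..} (\<lambda>t. exp (- c * t))"
    by (rule set_integrable_subset) auto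
  then show *: "integrable (lebesgue_on {0<..}) (\<lambda>t. exp (- c * t))"
    by (simp add: set_integrable_def integrable_restrict_space)
  have "((\<lambda>t. - exp (- c * t) / c) has_real_derivative exp (- c * t)) (at t within {0..})" for t
    using assms by (auto intro!: derivative_eq_intros)
  moreover have "((\<lambda>t. - exp (- c * t) / c) \<longlongrightarrow> 0) at_top"
  proof -
    have "filterlim (\<lambda>t. - (c * t)) at_bot at_top"
      using filterlim_tendsto_pos_mult_at_top[OF tendsto_const assms filterlim_ident]
      by (simp add: filterlim_uminus_at_bot)
    then have "((\<lambda>t. exp (- (c * t))) \<longlongrightarrow> 0) at_top"
      by (rule filterlim_compose[OF exp_at_bot])
    then have "((\<lambda>t. - exp (- (c * t)) / c) \<longlongrightarrow> - 0 / c) at_top"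
      using assms by (intro tendsto_intros) auto
    then show ?thesis by simp
  qed
  ultimately show "(LINT t|lebesgue_on {0<..}. exp (- c * t)) = 1 / c"
    using FTC_Ioi[of "\<lambda>t. - exp (- c * t) / c", OF _ *] by simp
qed

lemma integrable_exp_bound:
  fixes f :: "real \<Rightarrow> real"
  assumes f: "continuous_on {0..} f" and "0 < c" and bound: "\<And>t. 0 \<le> t \<Longrightarrow> \<bar>f t\<bar> \<le> K * exp (- c * t)"
  shows "integrable (lebesgue_on {0<..}) f" "\<bar>LINT t|lebesgue_on {0<..}. f t\<bar> \<le> K / c"
proof -
  have int: "integrable (lebesgue_on {0<..}) (\<lambda>t. K * exp (- c * t))"
    using integrable_exp_Ioi[OF \<open>0 < c\<close>] by (intro integrable_mult_right)
  have meas: "f \<in> borel_measurable (lebesgue_on {0<..})"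
    by (rule continuous_imp_measurable_on_sets_lebesgue) (auto intro: continuous_on_subset[OF f])
  show 1: "integrable (lebesgue_on {0<..}) f"
    by (rule Bochner_Integration.integrable_bound[OF int meas])
      (auto intro!: AE_I2 order_trans[OF bound] abs_ge_self)
  have "\<bar>LINT t|lebesgue_on {0<..}. f t\<bar> \<le> (LINT t|lebesgue_on {0<..}. \<bar>f t\<bar>)"
    by (rule integral_abs_bound)
  also have "\<dots> \<le> (LINT t|lebesgue_on {0<..}. K * exp (- c * t))"
    by (rule integral_mono) (use 1 int bound in auto)
  also have "\<dots> = K / c" using integrable_exp_Ioi[OF \<open>0 < c\<close>] by simp
  finally show "\<bar>LINT t|lebesgue_on {0<..}. f t\<bar> \<le> K / c" .
qed

text \<open>This is an implicit Euler step: z(s) equals z(t) - (t - s) z'(t) up to a small error,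
  and the latter is not shorter than z(t). Continuity of z' makes the error at most a prescribed
  multiple of t - s, and such errors add up to at most e on [0, b].\<close>

lemma backward_dissipative_imp_decreasing:
  fixes z :: "real \<Rightarrow> 'a::banach"
  assumes z: "\<And>t. 0 \<le> t \<Longrightarrow> (z has_vector_derivative z' t) (at t within {0..})"
    and z': "continuous_on {0..} z'" and "0 < d"
    and diss: "\<And>h t. 0 < h \<Longrightarrow> h < d \<Longrightarrow> 0 \<le> t \<Longrightarrow> norm (z t) \<le> norm (z t - h *\<^sub>R z' t)"
    and "0 \<le> b"
  shows "norm (z b) \<le> norm (z 0)"
proof (rule field_le_epsilon)
  fix e :: real assume "0 < e"
  define \<epsilon> where "\<epsilon> = e / (b + 1)"
  have \<epsilon>: "0 < \<epsilon>" using \<open>0 < e\<close> \<open>0 \<le> b\<close> by (simp add: \<epsilon>_def)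
  have "0 \<le> s \<and> t \<le> b \<longrightarrow> norm (z t) \<le> norm (z s) + \<epsilon> * (t - s)" if "s = 0" "t = b" for s t
    using \<open>0 \<le> b\<close> unfolding that
  \<comment> \<open>\<open>Bolzano\<close> extends a property that passes to unions of adjacent
    intervals, and that holds on all short intervals around each point, to the whole
    interval.\<close>
  proof (rule Bolzano[of 0 b "\<lambda>s t. 0 \<le> s \<and> t \<le> b \<longrightarrow> norm (z t) \<le> norm (z s) + \<epsilon> * (t - s)"], goal_cases)
    case (1 a b c)
    then show ?case by (auto simp: algebra_simps)
  next
    case (2 x)
    have "continuous (at x within {0..}) z'" using z' 2 by (auto simp: continuous_on_eq_continuous_within)
    then obtain \<delta> where \<delta>: "\<delta> > 0" "\<And>y. 0 \<le> y \<Longrightarrow> dist y x < \<delta> \<Longrightarrow> dist (z' y) (z' x) < \<epsilon> / 2"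
      using \<epsilon> unfolding continuous_within_eps_delta by (metis atLeast_iff half_gt_zero)
    show ?case
    proof (intro exI[of _ "min \<delta> d"] conjI allI impI; (elim conjE)?)
      show "0 < min \<delta> d" using \<delta> \<open>0 < d\<close> by simp
      fix s t assume *: "s \<le> x" "x \<le> t" "t - s < min \<delta> d" "0 \<le> s" "t \<le> b"
      show "norm (z t) \<le> norm (z s) + \<epsilon> * (t - s)"
      proof (cases "s = t")
        case False
        then have h: "0 < t - s" "t - s < d" "0 \<le> t" using * by auto
        \<comment> \<open>Subtracting the line with the slope at t leaves a function whose
          derivative is at most \<epsilon> on [s, t], since all slopes there are within \<epsilon> /
          2 of the slope at x.\<close>
        have "norm ((z t - t *\<^sub>R z' t) - (z s - s *\<^sub>R z' t)) \<le> \<epsilon> * norm (t - s)"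
        proof (rule differentiable_bound[where S="{s..t}" and f'="\<lambda>r h. h *\<^sub>R (z' r - z' t)"])
          fix r assume r: "r \<in> {s..t}"
          have "((\<lambda>r. z r - r *\<^sub>R z' t) has_vector_derivative z' r - z' t) (at r within {s..t})"
            using r * by (auto intro!: derivative_eq_intros has_vector_derivative_within_subset[OF z])
          then show "((\<lambda>r. z r - r *\<^sub>R z' t) has_derivative (\<lambda>h. h *\<^sub>R (z' r - z' t))) (at r within {s..t})"
            by (simp add: has_vector_derivative_def)
          have "norm (z' r - z' t) \<le> dist (z' r) (z' x) + dist (z' t) (z' x)"
            by (metis dist_norm dist_triangle2)
          also have "\<dots> \<le> \<epsilon> / 2 + \<epsilon> / 2"
            using r * \<delta>(2)[of r] \<delta>(2)[of t] by (intro add_mono less_imp_le) (auto simp: dist_norm)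
          finally have "norm (z' r - z' t) \<le> \<epsilon>" by simp
          then show "onorm (\<lambda>h::real. h *\<^sub>R (z' r - z' t)) \<le> \<epsilon>"
            by (simp add: onorm_scaleR_left[OF bounded_linear_ident] onorm_id)
        qed (use * in auto)
        moreover have "norm (z t - (t - s) *\<^sub>R z' t) \<le>
            norm (z s) + norm ((z t - t *\<^sub>R z' t) - (z s - s *\<^sub>R z' t))"
          by (rule order_trans[OF _ norm_triangle_ineq]) (simp add: algebra_simps)
        ultimately show ?thesis using diss[OF h] h by simp
      qed simp
    qed
  qed
  then have "norm (z b) \<le> norm (z 0) + \<epsilon> * b" using \<open>0 \<le> b\<close> by auto
  also have "\<epsilon> * b \<le> e" using \<open>0 < e\<close> \<open>0 \<le> b\<close> by (simp add: \<epsilon>_def field_simps)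
  finally show "norm (z b) \<le> norm (z 0) + e" by simp
qed

section \<open>Growth, joint continuity and orbit integrals of a strongly continuous
  semigroup\<close>

locale c0_semigroup =
  fixes T :: "real \<Rightarrow> 'a::banach \<Rightarrow>\<^sub>L 'a"
  assumes C0: "C0_semigroup T"
begin

lemma T_0 [simp]: "blinfun_apply (T 0) x = x"
  using C0 by (simp add: C0_semigroup_def)

lemma T_add: "0 \<le> s \<Longrightarrow> 0 \<le> t \<Longrightarrow> blinfun_apply (T (s + t)) x = blinfun_apply (T s) (blinfun_apply (T t) x)"
  using C0 by (simp add: C0_semigroup_def)

lemma T_continuous: "continuous_on {0..} (\<lambda>t. blinfun_apply (T t) x)"
  using C0 by (simp add: C0_semigroup_def)

lemma bounded_on_interval:
  obtains M where "1 \<le> M" "\<And>t. 0 \<le> t \<Longrightarrow> t \<le> b \<Longrightarrow> norm (T t) \<le> M"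
proof -
  have "\<exists>C. \<forall>t\<in>{0..b}. norm (blinfun_apply (T t) x) \<le> C" for x
  proof -
    have "compact ((\<lambda>t. blinfun_apply (T t) x) ` {0..b})"
      by (intro compact_continuous_image continuous_on_subset[OF T_continuous]) auto
    then show ?thesis using compact_imp_bounded bounded_iff by (metis imageI)
  qed
  from uniform_boundedness[OF this] obtain M where "\<And>t. t \<in> {0..b} \<Longrightarrow> norm (T t) \<le> M" by blast
  then show ?thesis by (intro that[of "max 1 M"]) (auto simp: le_max_iff_disj)
qed

text \<open>The bound \<open>M\<close> on [0, 1] is iterated with one factor per unit of time; the
  rate ln \<open>M\<close> is nonnegative because \<open>M\<close> is at least 1.\<close>

lemma exponential_growth:
  obtains M \<omega> where "1 \<le> M" "0 \<le> \<omega>" "\<And>t. 0 \<le> t \<Longrightarrow> norm (T t) \<le> M * exp (\<omega> * t)"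
proof -
  obtain M where M: "1 \<le> M" "\<And>t. 0 \<le> t \<Longrightarrow> t \<le> 1 \<Longrightarrow> norm (T t) \<le> M"
    by (rule bounded_on_interval[of 1]) auto
  have power: "\<forall>t. 0 \<le> t \<longrightarrow> t \<le> real n + 1 \<longrightarrow> norm (T t) \<le> M ^ Suc n" for n
  proof (induction n)
    case (Suc n)
    show ?case
    proof (intro allI impI)
      fix t :: real assume t: "0 \<le> t" "t \<le> real (Suc n) + 1"
      show "norm (T t) \<le> M ^ Suc (Suc n)"
      proof (cases "t \<le> 1")
        case True
        then have "norm (T t) \<le> M ^ 1" using M t by simp
        also have "\<dots> \<le> M ^ Suc (Suc n)" using M by (intro power_increasing) auto
        finally show ?thesis .
      next
        case False
        then have "T t = T 1 o\<^sub>L T (t - 1)"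
          using C0 unfolding C0_semigroup_def
          by (metis add.commute diff_add_cancel diff_ge_0_iff_ge linorder_not_le nless_le zero_less_one)
        then have "norm (T t) \<le> norm (T 1) * norm (T (t - 1))" by (simp add: norm_blinfun_compose)
        also have "\<dots> \<le> M * M ^ Suc n"
          using M False t Suc by (intro mult_mono) auto
        finally show ?thesis by simp
      qed
    qed
  qed (use M in auto)
  have "norm (T t) \<le> M * exp (ln M * t)" if "0 \<le> t" for t
  proof -
    define n where "n = nat \<lfloor>t\<rfloor>"
    have n: "real n \<le> t" "t \<le> real n + 1" using that by (auto simp: n_def)
    have "norm (T t) \<le> M ^ Suc n" using power n that by blast
    also have "\<dots> = M * exp (ln M * real n)" using M by (simp add: mult.commute[of "ln M"] exp_of_nat_mult)
    also have "\<dots> \<le> M * exp (ln M * t)" using M n by (auto intro!: mult_left_mono)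
    finally show ?thesis .
  qed
  then show ?thesis using that[of M "ln M"] M by simp
qed

text \<open>Strong continuity at a fixed x is combined with local boundedness, applied to y - x.
  Joint continuity is what later makes the convolution kernel measurable.\<close>

lemma T_jointly_continuous: "continuous_on ({0..} \<times> UNIV) (\<lambda>p. blinfun_apply (T (fst p)) (snd p))"
  unfolding continuous_on_def
proof
  fix q :: "real \<times> 'a" assume "q \<in> {0..} \<times> UNIV"
  then obtain t x where q: "q = (t, x)" and t: "t \<in> {0..}" by (cases q) auto
  obtain M where M: "1 \<le> M" "\<And>s. 0 \<le> s \<Longrightarrow> s \<le> t + 1 \<Longrightarrow> norm (T s) \<le> M"
    by (rule bounded_on_interval[of "t + 1"]) auto
  let ?F = "at (t, x) within {0..} \<times> UNIV"
  have fst: "(fst \<longlongrightarrow> t) ?F" using tendsto_fst[OF tendsto_ident_at, of "(t, x)"] by simp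
  have snd: "(snd \<longlongrightarrow> x) ?F" using tendsto_snd[OF tendsto_ident_at, of "(t, x)"] by simp
  have "((\<lambda>p. blinfun_apply (T (fst p)) x) \<longlongrightarrow> blinfun_apply (T t) x) ?F"
  proof -
    have "continuous_on ({0..} \<times> UNIV) (\<lambda>p. blinfun_apply (T (fst p)) x)"
      by (rule continuous_on_compose2[OF T_continuous]) (auto intro!: continuous_intros)
    then show ?thesis using t by (auto simp: continuous_on_def)
  qed
  moreover have "((\<lambda>p. blinfun_apply (T (fst p)) (snd p - x)) \<longlongrightarrow> 0) ?F"
  proof (rule Lim_null_comparison)
    have "\<forall>\<^sub>F p in ?F. fst p < t + 1" using fst by (rule order_tendstoD) simp
    moreover have "\<forall>\<^sub>F p in ?F. p \<in> {0..} \<times> UNIV" by (simp add: eventually_at_filter)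
    ultimately show "\<forall>\<^sub>F p in ?F. norm (blinfun_apply (T (fst p)) (snd p - x)) \<le> M * norm (snd p - x)"
    proof eventually_elim
      case (elim p)
      then have "norm (T (fst p)) \<le> M" using M(2)[of "fst p"] by auto
      then show ?case using norm_blinfun[of "T (fst p)" "snd p - x"]
        by (meson mult_right_mono norm_ge_zero order_trans)
    qed
    have "((\<lambda>p. M * norm (snd p - x)) \<longlongrightarrow> M * norm (x - x)) ?F" by (intro tendsto_intros snd)
    then show "((\<lambda>p. M * norm (snd p - x)) \<longlongrightarrow> 0) ?F" by simp
  qed
  ultimately have "((\<lambda>p. blinfun_apply (T (fst p)) x + blinfun_apply (T (fst p)) (snd p - x))
      \<longlongrightarrow> blinfun_apply (T t) x + 0) ?F" by (rule tendsto_add)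
  then show "((\<lambda>p. blinfun_apply (T (fst p)) (snd p)) \<longlongrightarrow> blinfun_apply (T (fst q)) (snd q)) (at q within {0..} \<times> UNIV)"
    by (simp add: blinfun.diff_right q)
qed

text \<open>The state reached from 0 at time \<open>t\<close> under the constant input
  \<open>x\<close>.\<close>

definition orbit_integral :: "real \<Rightarrow> 'a \<Rightarrow> 'a" where
  "orbit_integral t x = integral {0..t} (\<lambda>s. blinfun_apply (T s) x)"

lemma orbit_integrable: "0 \<le> a \<Longrightarrow> (\<lambda>s. blinfun_apply (T s) x) integrable_on {a..b}"
  by (intro integrable_continuous_real continuous_on_subset[OF T_continuous]) auto

lemma orbit_integral_derivative:
  assumes "0 \<le> t"
  shows "((\<lambda>t. orbit_integral t x) has_vector_derivative blinfun_apply (T t) x) (at t within {0..})"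
proof -
  have "((\<lambda>t. orbit_integral t x) has_vector_derivative blinfun_apply (T t) x) (at t within {0..t+1})"
    unfolding orbit_integral_def using assms
    by (intro integral_has_vector_derivative continuous_on_subset[OF T_continuous]) auto
  moreover have "at t within {0..t+1} = at t within {0..}"
    by (rule at_within_nhd[of _ "{..<t+1}"]) (use assms in auto)
  ultimately show ?thesis by simp
qed

lemma orbit_integral_right_quotient:
  assumes "0 \<le> t"
  shows "((\<lambda>h. (orbit_integral (t + h) x - orbit_integral t x) /\<^sub>R h) \<longlongrightarrow> blinfun_apply (T t) x) (at_right 0)"
proof -
  let ?r = "\<lambda>y. (1 / norm (y - t)) *\<^sub>R (orbit_integral y x - (orbit_integral t x + (y - t) *\<^sub>R blinfun_apply (T t) x))"
  have "(?r \<longlongrightarrow> 0) (at t within {0..})"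
    using orbit_integral_derivative[OF assms, of x]
    unfolding has_vector_derivative_def has_derivative_within by blast
  moreover have "filterlim (\<lambda>h. t + h) (at t within {0..}) (at_right 0)"
    unfolding filterlim_at
  proof
    show "\<forall>\<^sub>F h in at_right 0. t + h \<in> {0..} \<and> t + h \<noteq> t"
      using eventually_at_right_less[of "0::real"] by eventually_elim (use assms in auto)
    have "((\<lambda>h. t + h) \<longlongrightarrow> t + 0) (at_right 0)" by (intro tendsto_intros)
    then show "((\<lambda>h. t + h) \<longlongrightarrow> t) (at_right 0)" by simp
  qed
  ultimately have "((\<lambda>h. ?r (t + h)) \<longlongrightarrow> 0) (at_right 0)"
    by (rule filterlim_compose)
  moreover have "\<forall>\<^sub>F h in at_right 0. ?r (t + h) =
      (orbit_integral (t + h) x - orbit_integral t x) /\<^sub>R h - blinfun_apply (T t) x"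
    using eventually_at_right_less[of "0::real"]
    by eventually_elim (simp add: scaleR_diff_right scaleR_add_right inverse_eq_divide)
  ultimately have "((\<lambda>h. (orbit_integral (t + h) x - orbit_integral t x) /\<^sub>R h - blinfun_apply (T t) x) \<longlongrightarrow> 0) (at_right 0)"
    by (rule Lim_transform_eventually)
  then show ?thesis by (simp add: Lim_null[symmetric])
qed

text \<open>Both left-hand sides are the integral of the orbit over [h, t + h]; in particular,
  integrating an orbit commutes with the semigroup.\<close>

lemma T_orbit_integral:
  assumes "0 \<le> t" "0 \<le> h"
  shows "blinfun_apply (T h) (orbit_integral t x) = orbit_integral (t + h) x - orbit_integral h x"
    and "orbit_integral t (blinfun_apply (T h) x) = orbit_integral (t + h) x - orbit_integral h x"
proof -
  have "((\<lambda>s. blinfun_apply (T s) x) has_integral integral {h..t+h} (\<lambda>s. blinfun_apply (T s) x)) {h..t+h}"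
    using orbit_integrable[OF assms(2)] by (rule integrable_integral)
  from has_integral_affinity[OF this[folded cbox_interval], of 1 h]
  have *: "((\<lambda>s. blinfun_apply (T (s + h)) x) has_integral integral {h..t+h} (\<lambda>s. blinfun_apply (T s) x)) {0..t}"
    by (simp add: cbox_interval)
  have eq: "integral {h..t+h} (\<lambda>s. blinfun_apply (T s) x) = orbit_integral (t + h) x - orbit_integral h x"
    unfolding orbit_integral_def
    using Henstock_Kurzweil_Integration.integral_combine[of 0 h "t + h" "\<lambda>s. blinfun_apply (T s) x"] assms
      orbit_integrable[of 0] by (simp add: algebra_simps)
  have "blinfun_apply (T h) (orbit_integral t x) = integral {0..t} (\<lambda>s. blinfun_apply (T (s + h)) x)"
    unfolding orbit_integral_def
    unfolding integral_blinfun_apply[OF orbit_integrable[OF order_refl], symmetric]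
    by (rule integral_cong) (use assms T_add[of h] in \<open>simp add: add.commute\<close>)
  then show "blinfun_apply (T h) (orbit_integral t x) = orbit_integral (t + h) x - orbit_integral h x"
    using * eq by (simp add: integral_unique)
  have "orbit_integral t (blinfun_apply (T h) x) = integral {0..t} (\<lambda>s. blinfun_apply (T (s + h)) x)"
    unfolding orbit_integral_def
    by (rule integral_cong) (use assms in \<open>auto simp: T_add\<close>)
  then show "orbit_integral t (blinfun_apply (T h) x) = orbit_integral (t + h) x - orbit_integral h x"
    using * eq by (simp add: integral_unique)
qed

text \<open>The quotient is the difference of the right difference quotients of the orbit integral
  at t and at 0. Hence every orbit integral lies in the domain of the generator, whatever x
  is.\<close>

lemma orbit_integral_generator_quotient:
  assumes "0 \<le> t"
  shows "((\<lambda>h. (blinfun_apply (T h) (orbit_integral t x) - orbit_integral t x) /\<^sub>R h)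
      \<longlongrightarrow> blinfun_apply (T t) x - x) (at_right 0)"
proof -
  have "((\<lambda>h. (orbit_integral (t + h) x - orbit_integral t x) /\<^sub>R h
      - (orbit_integral (0 + h) x - orbit_integral 0 x) /\<^sub>R h) \<longlongrightarrow> blinfun_apply (T t) x - blinfun_apply (T 0) x) (at_right 0)"
    by (intro tendsto_diff orbit_integral_right_quotient assms order_refl)
  moreover have "\<forall>\<^sub>F h in at_right 0. (orbit_integral (t + h) x - orbit_integral t x) /\<^sub>R h
      - (orbit_integral (0 + h) x - orbit_integral 0 x) /\<^sub>R h =
      (blinfun_apply (T h) (orbit_integral t x) - orbit_integral t x) /\<^sub>R h"
    using eventually_at_right_less[of "0::real"]
  proof eventually_elim
    case (elim h)
    have "orbit_integral 0 x = 0" by (simp add: orbit_integral_def)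
    then have "blinfun_apply (T h) (orbit_integral t x) - orbit_integral t x =
        (orbit_integral (t + h) x - orbit_integral t x) - (orbit_integral (0 + h) x - orbit_integral 0 x)"
      using T_orbit_integral(1)[OF assms, of h x] elim by simp
    then show ?case by (simp only: scaleR_diff_right)
  qed
  ultimately show ?thesis by (auto intro: Lim_transform_eventually)
qed

end

section \<open>The generator, its domain and exponential decay\<close>

locale c0_generator = c0_semigroup T for T :: "real \<Rightarrow> 'a::banach \<Rightarrow>\<^sub>L 'a" +
  fixes D :: "'a set" and G :: "'a \<Rightarrow> 'a"
  assumes gen: "is_generator T D G"
begin

lemma generator_quotient:
  "x \<in> D \<Longrightarrow> ((\<lambda>h. (blinfun_apply (T h) x - x) /\<^sub>R h) \<longlongrightarrow> G x) (at_right 0)"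
  using gen unfolding is_generator_def by blast

lemma generatorI:
  assumes "((\<lambda>h. (blinfun_apply (T h) x - x) /\<^sub>R h) \<longlongrightarrow> z) (at_right 0)"
  shows "x \<in> D" "G x = z"
proof -
  from gen assms have "x \<in> D \<and> z = G x" unfolding is_generator_def by blast
  then show "x \<in> D" "G x = z" by auto
qed

lemma T_domain:
  assumes "x \<in> D" "0 \<le> t"
  shows "blinfun_apply (T t) x \<in> D" "G (blinfun_apply (T t) x) = blinfun_apply (T t) (G x)"
proof -
  have "((\<lambda>h. blinfun_apply (T t) ((blinfun_apply (T h) x - x) /\<^sub>R h)) \<longlongrightarrow> blinfun_apply (T t) (G x)) (at_right 0)"
    by (intro tendsto_intros generator_quotient assms)
  moreover have "\<forall>\<^sub>F h in at_right 0. blinfun_apply (T t) ((blinfun_apply (T h) x - x) /\<^sub>R h) =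
      (blinfun_apply (T h) (blinfun_apply (T t) x) - blinfun_apply (T t) x) /\<^sub>R h"
    using eventually_at_right_less[of "0::real"]
  proof eventually_elim
    case (elim h)
    then show ?case using T_add[of t h x] T_add[of h t x] assms
      by (simp add: blinfun.scaleR_right blinfun.diff_right add.commute)
  qed
  ultimately have "((\<lambda>h. (blinfun_apply (T h) (blinfun_apply (T t) x) - blinfun_apply (T t) x) /\<^sub>R h)
      \<longlongrightarrow> blinfun_apply (T t) (G x)) (at_right 0)"
    by (rule Lim_transform_eventually)
  from generatorI[OF this] show "blinfun_apply (T t) x \<in> D" "G (blinfun_apply (T t) x) = blinfun_apply (T t) (G x)"
    by auto
qed

text \<open>Orbit integration is bounded and commutes with the semigroup. Applied to the difference
  quotients of x it yields, on the one hand, the limit on the left; on the other hand these are the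
  difference quotients of \<open>orbit_integral t x\<close>, whose limit is known.\<close>

lemma orbit_integral_generator:
  assumes x: "x \<in> D" and t: "0 \<le> t"
  shows "orbit_integral t (G x) = blinfun_apply (T t) x - x"
proof -
  obtain M where M: "1 \<le> M" "\<And>s. 0 \<le> s \<Longrightarrow> s \<le> t \<Longrightarrow> norm (T s) \<le> M"
    by (rule bounded_on_interval[of t]) auto
  let ?q = "\<lambda>h. (blinfun_apply (T h) x - x) /\<^sub>R h"
  have orbit_diff: "orbit_integral t (y - z) = orbit_integral t y - orbit_integral t z" for y z
    unfolding orbit_integral_def
    by (simp add: blinfun.diff_right Henstock_Kurzweil_Integration.integral_diff orbit_integrable)
  have orbit_scale: "orbit_integral t (c *\<^sub>R y) = c *\<^sub>R orbit_integral t y" for c y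
    unfolding orbit_integral_def by (simp add: blinfun.scaleR_right)
  have orbit_norm: "norm (orbit_integral t y) \<le> M * norm y * t" for y
  proof -
    have "norm (integral (cbox 0 t) (\<lambda>s. blinfun_apply (T s) y)) \<le> M * norm y * measure lborel (cbox 0 t)"
    proof (rule integrable_bound)
      show "0 \<le> M * norm y" using M by simp
      show "(\<lambda>s. blinfun_apply (T s) y) integrable_on cbox 0 t" by (simp add: orbit_integrable)
      fix s assume "s \<in> cbox 0 t"
      then have "norm (T s) \<le> M" using M by auto
      then show "norm (blinfun_apply (T s) y) \<le> M * norm y"
        using norm_blinfun by (meson mult_right_mono norm_ge_zero order_trans)
    qed
    then show ?thesis using t by (simp add: orbit_integral_def)
  qed
  have "((\<lambda>h. orbit_integral t (?q h) - orbit_integral t (G x)) \<longlongrightarrow> 0) (at_right 0)"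
  proof (rule Lim_null_comparison)
    show "\<forall>\<^sub>F h in at_right 0. norm (orbit_integral t (?q h) - orbit_integral t (G x)) \<le> M * norm (?q h - G x) * t"
      by (intro always_eventually allI) (metis orbit_diff orbit_norm)
    have "((\<lambda>h. M * norm (?q h - G x) * t) \<longlongrightarrow> M * norm (G x - G x) * t) (at_right 0)"
      by (intro tendsto_intros generator_quotient x)
    then show "((\<lambda>h. M * norm (?q h - G x) * t) \<longlongrightarrow> 0) (at_right 0)" by simp
  qed
  then have "((\<lambda>h. orbit_integral t (?q h)) \<longlongrightarrow> orbit_integral t (G x)) (at_right 0)"
    by (simp add: Lim_null[symmetric])
  moreover have "\<forall>\<^sub>F h in at_right 0. orbit_integral t (?q h) =
      (blinfun_apply (T h) (orbit_integral t x) - orbit_integral t x) /\<^sub>R h"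
    using eventually_at_right_less[of "0::real"]
  proof eventually_elim
    case (elim h)
    then show ?case using T_orbit_integral[OF t, of h x] by (simp only: orbit_scale orbit_diff)
  qed
  ultimately have "((\<lambda>h. (blinfun_apply (T h) (orbit_integral t x) - orbit_integral t x) /\<^sub>R h)
      \<longlongrightarrow> orbit_integral t (G x)) (at_right 0)"
    by (rule Lim_transform_eventually)
  then show ?thesis
    using orbit_integral_generator_quotient[OF t, of x] tendsto_unique[OF trivial_limit_at_right_real] by blast
qed

lemma T_has_vector_derivative:
  assumes "x \<in> D" "0 \<le> t"
  shows "((\<lambda>t. blinfun_apply (T t) x) has_vector_derivative blinfun_apply (T t) (G x)) (at t within {0..})"
proof -
  have "((\<lambda>t. x + orbit_integral t (G x)) has_vector_derivative 0 + blinfun_apply (T t) (G x)) (at t within {0..})"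
    by (intro has_vector_derivative_add has_vector_derivative_const orbit_integral_derivative assms)
  then show ?thesis
    by (rule has_vector_derivative_transform[rotated 2, THEN has_vector_derivative_eq_rhs])
      (use assms in \<open>auto simp: orbit_integral_generator\<close>)
qed

text \<open>Averages of an orbit over [0, h] lie in the domain and tend to the starting point of the
  orbit.\<close>

lemma domain_dense: "closure D = UNIV"
proof -
  have "x \<in> closure D" for x
  proof (rule Lim_in_closed_set)
    have "((\<lambda>h. (orbit_integral (0 + h) x - orbit_integral 0 x) /\<^sub>R h) \<longlongrightarrow> blinfun_apply (T 0) x) (at_right 0)"
      by (rule orbit_integral_right_quotient) simp
    then show "((\<lambda>h. orbit_integral h x /\<^sub>R h) \<longlongrightarrow> x) (at_right 0)"
      by (simp add: orbit_integral_def)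
    show "\<forall>\<^sub>F h in at_right 0. orbit_integral h x /\<^sub>R h \<in> closure D"
      using eventually_at_right_less[of "0::real"]
    proof eventually_elim
      case (elim h)
      have "((\<lambda>r. (1 / h) *\<^sub>R ((blinfun_apply (T r) (orbit_integral h x) - orbit_integral h x) /\<^sub>R r))
          \<longlongrightarrow> (1 / h) *\<^sub>R (blinfun_apply (T h) x - x)) (at_right 0)"
        using elim by (intro tendsto_intros orbit_integral_generator_quotient) auto
      then have "((\<lambda>r. (blinfun_apply (T r) (orbit_integral h x /\<^sub>R h) - orbit_integral h x /\<^sub>R h) /\<^sub>R r)
          \<longlongrightarrow> (1 / h) *\<^sub>R (blinfun_apply (T h) x - x)) (at_right 0)"
        by (simp add: blinfun.scaleR_right scaleR_diff_right inverse_eq_divide mult.commute)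
      from generatorI(1)[OF this] show ?case using closure_subset by blast
    qed
  qed auto
  then show ?thesis by auto
qed

text \<open>With \<kappa> = 1 / h - \<mu>, the hypothesis says that z(s) = e^(\<mu> s) T(s) x
  satisfies the implicit Euler inequality with step h; large \<kappa> correspond to small steps.
  Density of the domain extends the bound to all x.\<close>

theorem exponential_decay:
  assumes diss: "\<And>\<kappa> x. \<kappa>0 < \<kappa> \<Longrightarrow> x \<in> D \<Longrightarrow> (\<kappa> + \<mu>) * norm x \<le> norm (\<kappa> *\<^sub>R x - G x)"
    and t: "0 \<le> t"
  shows "norm (T t) \<le> exp (- \<mu> * t)"
proof -
  have decay_D: "norm (blinfun_apply (T t) x) \<le> exp (- \<mu> * t) * norm x" if x: "x \<in> D" for x
  proof -
    define z where "z s = exp (\<mu> * s) *\<^sub>R blinfun_apply (T s) x" for s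
    define z' where "z' s = exp (\<mu> * s) *\<^sub>R (\<mu> *\<^sub>R blinfun_apply (T s) x + blinfun_apply (T s) (G x))" for s
    \<comment> \<open>A step below \<open>d\<close> makes 1 / h - \<mu> larger than
      \<open>\<kappa>0\<close>.\<close>
    define d where "d = 1 / (\<bar>\<kappa>0\<bar> + \<bar>\<mu>\<bar> + 1)"
    have "norm (z t) \<le> norm (z 0)"
    proof (rule backward_dissipative_imp_decreasing[where z'=z' and d=d])
      fix s :: real assume s: "0 \<le> s"
      show "(z has_vector_derivative z' s) (at s within {0..})"
        unfolding z_def z'_def
        by (auto intro!: derivative_eq_intros T_has_vector_derivative[OF x s] simp: algebra_simps)
      fix h :: real assume h: "0 < h" "h < d"
      define \<kappa> where "\<kappa> = 1 / h - \<mu>"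
      have "\<bar>\<kappa>0\<bar> + \<bar>\<mu>\<bar> + 1 < 1 / h" using h by (simp add: d_def field_simps)
      then have "\<kappa>0 < \<kappa>" by (simp add: \<kappa>_def)
      from diss[OF this T_domain(1)[OF x s]]
      have "1 / h * norm (blinfun_apply (T s) x) \<le> norm (\<kappa> *\<^sub>R blinfun_apply (T s) x - blinfun_apply (T s) (G x))"
        by (simp add: \<kappa>_def T_domain(2)[OF x s])
      then have "norm (blinfun_apply (T s) x) \<le> h * norm (\<kappa> *\<^sub>R blinfun_apply (T s) x - blinfun_apply (T s) (G x))"
        using h by (simp add: field_simps)
      also have "\<dots> = norm (h *\<^sub>R (\<kappa> *\<^sub>R blinfun_apply (T s) x - blinfun_apply (T s) (G x)))"
        using h by simp
      also have "h *\<^sub>R (\<kappa> *\<^sub>R blinfun_apply (T s) x - blinfun_apply (T s) (G x)) =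
          blinfun_apply (T s) x - h *\<^sub>R (\<mu> *\<^sub>R blinfun_apply (T s) x + blinfun_apply (T s) (G x))"
      proof -
        have "h * \<kappa> = 1 - h * \<mu>" using h by (simp add: \<kappa>_def field_simps)
        then show ?thesis by (simp add: scaleR_diff_right scaleR_add_right scaleR_diff_left)
      qed
      finally have "exp (\<mu> * s) * norm (blinfun_apply (T s) x) \<le> exp (\<mu> * s) *
          norm (blinfun_apply (T s) x - h *\<^sub>R (\<mu> *\<^sub>R blinfun_apply (T s) x + blinfun_apply (T s) (G x)))"
        by (intro mult_left_mono) auto
      also have "\<dots> = norm (exp (\<mu> * s) *\<^sub>R
          (blinfun_apply (T s) x - h *\<^sub>R (\<mu> *\<^sub>R blinfun_apply (T s) x + blinfun_apply (T s) (G x))))"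
        by simp
      also have "exp (\<mu> * s) *\<^sub>R
          (blinfun_apply (T s) x - h *\<^sub>R (\<mu> *\<^sub>R blinfun_apply (T s) x + blinfun_apply (T s) (G x))) = z s - h *\<^sub>R z' s"
        unfolding z_def z'_def scaleR_diff_right by (simp only: scaleR_left_commute)
      finally show "norm (z s) \<le> norm (z s - h *\<^sub>R z' s)" by (simp add: z_def)
    qed (auto simp: z'_def d_def t intro!: continuous_intros T_continuous)
    then have "exp (\<mu> * t) * norm (blinfun_apply (T t) x) \<le> norm x" by (simp add: z_def)
    then show ?thesis by (simp add: exp_minus field_simps)
  qed
  show ?thesis
  proof (rule norm_blinfun_bound)
    fix x
    have "closed {x. norm (blinfun_apply (T t) x) \<le> exp (- \<mu> * t) * norm x}"
      by (intro closed_Collect_le continuous_intros)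
    then have "closure D \<subseteq> {x. norm (blinfun_apply (T t) x) \<le> exp (- \<mu> * t) * norm x}"
      using decay_D by (intro closure_minimal) auto
    then show "norm (blinfun_apply (T t) x) \<le> exp (- \<mu> * t) * norm x" by (auto simp: domain_dense)
  qed simp
qed

end

section \<open>Functions with square integrable weak derivative\<close>

text \<open>Off a null set f is the limit of its averages over shrinking intervals, all of which
  vanish. Intervals with rational endpoints reduce the exceptional sets to countably many.\<close>

lemma ae_eq_0_if_interval_integrals_eq_0:
  fixes f :: "real \<Rightarrow> real"
  assumes f: "\<And>a b. a \<in> S \<Longrightarrow> b \<in> S \<Longrightarrow> a \<le> b \<Longrightarrow> f integrable_on {a..b} \<and> integral {a..b} f = 0"
    and S: "open S" "is_interval S"
  shows "AE x in lebesgue_on S. f x = 0"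
proof -
  have local: "\<exists>N. negligible N \<and> (\<forall>x\<in>{a<..<b}. x \<notin> N \<longrightarrow> f x = 0)" if ab: "a \<in> S" "b \<in> S" "a \<le> b" for a b
  proof -
    define g where "g x = (if x \<in> {a..b} then f x else 0)" for x
    have "g integrable_on UNIV" unfolding g_def using f[OF ab] by (simp only: integrable_restrict_UNIV)
    then have "g integrable_on cbox c d" for c d by (rule integrable_on_subcbox) simp
    \<comment> \<open>Lebesgue's differentiation theorem, with averages taken to the right of the
      point.\<close>
    from integrable_ccontinuous_explicit[OF this] obtain N where N: "negligible N"
      "\<And>x e. x \<notin> N \<Longrightarrow> 0 < e \<Longrightarrow>
        \<exists>d>0. \<forall>h. 0 < h \<and> h < d \<longrightarrow> norm (integral (cbox x (x + h *\<^sub>R One)) g /\<^sub>R h ^ DIM(real) - g x) < e"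
      by blast
    have "f x = 0" if x: "x \<in> {a<..<b}" "x \<notin> N" for x
    proof (rule ccontr)
      assume "f x \<noteq> 0"
      then have "0 < norm (g x)" using x by (simp add: g_def)
      from N(2)[OF x(2) this] obtain d where d: "d > 0"
        "\<And>h. 0 < h \<Longrightarrow> h < d \<Longrightarrow> norm (integral {x..x+h} g /\<^sub>R h - g x) < norm (g x)" by auto
      define h where "h = min (d / 2) (b - x)"
      have h: "0 < h" "h < d" "x + h \<le> b" using d x by (auto simp: h_def)
      have "integral {x..x+h} g = integral {x..x+h} f"
        by (rule integral_cong) (use h x in \<open>auto simp: g_def\<close>)
      also have "\<dots> = 0"
      proof -
        have "x \<in> S" "x + h \<in> S"
          using mem_is_intervalI[OF S(2) ab(1,2)] x h by (auto intro: mem_is_interval_1_I[OF S(2) ab(1,2)])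
        then show ?thesis using f h by simp
      qed
      finally show False using d(2)[OF h(1,2)] by simp
    qed
    then show ?thesis using N(1) by blast
  qed
  define I where "I = {p \<in> \<rat> \<times> \<rat>. fst p \<in> S \<and> snd p \<in> S \<and> fst p \<le> snd p}"
  have "countable I" unfolding I_def
    by (rule countable_subset[of _ "\<rat> \<times> \<rat>"]) (auto simp: countable_rat)
  have "\<forall>p\<in>I. \<exists>N. negligible N \<and> (\<forall>x\<in>{fst p<..<snd p}. x \<notin> N \<longrightarrow> f x = 0)"
    using local by (auto simp: I_def)
  then obtain N where N: "\<And>p. p \<in> I \<Longrightarrow> negligible (N p)"
    "\<And>p x. p \<in> I \<Longrightarrow> x \<in> {fst p<..<snd p} \<Longrightarrow> x \<notin> N p \<Longrightarrow> f x = 0" by metis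
  have "negligible (\<Union>p\<in>I. N p)"
    using \<open>countable I\<close> N(1) by (intro negligible_countable_Union) auto
  moreover have "f x = 0" if x: "x \<in> S" "x \<notin> (\<Union>p\<in>I. N p)" for x
  proof -
    obtain e where e: "e > 0" "ball x e \<subseteq> S" using S(1) x(1) open_contains_ball by blast
    obtain a where a: "a \<in> \<rat>" "x - e < a" "a < x" using Rats_dense_in_real[of "x - e" x] e by auto
    obtain b where b: "b \<in> \<rat>" "x < b" "b < x + e" using Rats_dense_in_real[of x "x + e"] e by auto
    have "a \<in> S" "b \<in> S" using a b e by (auto simp: subset_iff dist_real_def)
    then have "(a, b) \<in> I" using a b by (auto simp: I_def)
    then show ?thesis using N(2)[of "(a, b)" x] x a b by auto
  qed
  ultimately have "AE x in lebesgue. x \<in> S \<longrightarrow> f x = 0"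
    by (intro AE_I'[of "\<Union>p\<in>I. N p"]) (auto simp: negligible_iff_null_sets)
  then show ?thesis using S(1) by (simp add: AE_restrict_space_iff)
qed

text \<open>The chain rule for an absolutely continuous function, without pointwise derivatives: the
  increment of the square is \<phi> t + \<phi> s times the integral of \<psi>, and on a short
  interval \<phi> t + \<phi> s differs from 2 \<phi> r by at most \<epsilon>. The resulting error,
  \<epsilon> times the integral of |\<psi>|, is additive over intervals.\<close>

lemma square_of_indefinite_integral:
  fixes \<phi> \<psi> :: "real \<Rightarrow> real"
  assumes \<psi>: "\<psi> absolutely_integrable_on {a..b}" and "a \<le> b"
    and \<phi>: "\<And>s t. a \<le> s \<Longrightarrow> s \<le> t \<Longrightarrow> t \<le> b \<Longrightarrow> \<phi> t - \<phi> s = integral {s..t} \<psi>"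
  shows "continuous_on {a..b} \<phi>" "(\<phi> b)\<^sup>2 - (\<phi> a)\<^sup>2 = 2 * integral {a..b} (\<lambda>r. \<phi> r * \<psi> r)"
proof -
  have \<psi>_int: "\<psi> integrable_on {a..b}" using \<psi> by (rule set_lebesgue_integral_eq_integral(1))
  have "continuous_on {a..b} (\<lambda>t. \<phi> a + integral {a..t} \<psi>)"
    by (intro continuous_intros indefinite_integral_continuous_1 \<psi>_int)
  then show cont: "continuous_on {a..b} \<phi>"
  proof (rule continuous_on_eq)
    fix t assume "t \<in> {a..b}"
    then show "\<phi> a + integral {a..t} \<psi> = \<phi> t" using \<phi>[of a t] by simp
  qed
  have "bounded (\<phi> ` {a..b})"
    by (intro compact_imp_bounded compact_continuous_image cont compact_Icc)
  then have \<phi>\<psi>: "(\<lambda>r. \<phi> r * \<psi> r) absolutely_integrable_on {a..b}"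
    by (intro absolutely_integrable_bounded_measurable_product_real \<psi>
        continuous_imp_measurable_on_sets_lebesgue cont) auto
  define K where "K = integral {a..b} (\<lambda>r. \<bar>\<psi> r\<bar>)"
  have abs_int: "(\<lambda>r. \<bar>\<psi> r\<bar>) integrable_on {a..b}"
    using \<psi> by (simp add: absolutely_integrable_on_def)
  have \<phi>\<psi>_int: "(\<lambda>r. \<phi> r * \<psi> r) integrable_on {a..b}" using \<phi>\<psi> by (rule set_lebesgue_integral_eq_integral(1))
  have sub: "(f::real \<Rightarrow> real) integrable_on {s..t}" if "f integrable_on {a..b}" "a \<le> s" "t \<le> b" for f s t
    using that by (intro integrable_on_subinterval[OF that(1)]) auto
  have "\<bar>(\<phi> b)\<^sup>2 - (\<phi> a)\<^sup>2 - 2 * integral {a..b} (\<lambda>r. \<phi> r * \<psi> r)\<bar> \<le> \<epsilon> * K" if "0 < \<epsilon>" for \<epsilon>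
  proof -
    let ?P = "\<lambda>s t. a \<le> s \<and> s \<le> t \<and> t \<le> b \<longrightarrow>
      \<bar>(\<phi> t)\<^sup>2 - (\<phi> s)\<^sup>2 - 2 * integral {s..t} (\<lambda>r. \<phi> r * \<psi> r)\<bar> \<le> \<epsilon> * integral {s..t} (\<lambda>r. \<bar>\<psi> r\<bar>)"
    have "?P a b" using \<open>a \<le> b\<close>
    proof (rule Bolzano[of a b ?P], goal_cases)
      case (1 r s t)
      show ?case
      proof
        assume *: "a \<le> r \<and> r \<le> t \<and> t \<le> b"
        have c: "integral {r..s} f + integral {s..t} f = integral {r..t} f" if "f integrable_on {a..b}" for f :: "real \<Rightarrow> real"
          using * 1 by (intro Henstock_Kurzweil_Integration.integral_combine sub[OF that]) auto
        show "\<bar>(\<phi> t)\<^sup>2 - (\<phi> r)\<^sup>2 - 2 * integral {r..t} (\<lambda>r. \<phi> r * \<psi> r)\<bar> \<le> \<epsilon> * integral {r..t} (\<lambda>r. \<bar>\<psi> r\<bar>)"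
          (is "\<bar>?L\<bar> \<le> _")
        proof -
          let ?X = "\<lambda>s t. (\<phi> t)\<^sup>2 - (\<phi> s)\<^sup>2 - 2 * integral {s..t} (\<lambda>r. \<phi> r * \<psi> r)"
          have "?L = ?X r s + ?X s t" using c[OF \<phi>\<psi>_int] by simp
          then have "\<bar>?L\<bar> \<le> \<bar>?X r s\<bar> + \<bar>?X s t\<bar>" by linarith
          also have "\<dots> \<le> \<epsilon> * integral {r..s} (\<lambda>r. \<bar>\<psi> r\<bar>) + \<epsilon> * integral {s..t} (\<lambda>r. \<bar>\<psi> r\<bar>)"
            using 1 * by (intro add_mono) auto
          also have "\<dots> = \<epsilon> * integral {r..t} (\<lambda>r. \<bar>\<psi> r\<bar>)"
            using c[OF abs_int] by (simp flip: distrib_left)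
          finally show ?thesis .
        qed
      qed
    next
      case (2 x)
      then have "continuous (at x within {a..b}) \<phi>" using cont by (auto simp: continuous_on_eq_continuous_within)
      then obtain \<delta> where \<delta>: "\<delta> > 0" "\<And>y. y \<in> {a..b} \<Longrightarrow> dist y x < \<delta> \<Longrightarrow> dist (\<phi> y) (\<phi> x) < \<epsilon> / 4"
        using \<open>0 < \<epsilon>\<close> unfolding continuous_within_eps_delta by (metis divide_pos_pos zero_less_numeral)
      show ?case
      proof (intro exI[of _ \<delta>] conjI allI impI; (elim conjE)?)
        show "0 < \<delta>" by fact
        fix s t assume *: "s \<le> x" "x \<le> t" "t - s < \<delta>" "a \<le> s" "s \<le> t" "t \<le> b"
        have osc: "\<bar>\<phi> t + \<phi> s - 2 * \<phi> r\<bar> \<le> \<epsilon>" if "r \<in> {s..t}" for r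
        proof -
          have "\<bar>\<phi> y - \<phi> x\<bar> < \<epsilon> / 4" if "y \<in> {s..t}" for y
            using \<delta>(2)[of y] that * by (auto simp: dist_real_def)
          then have "\<bar>\<phi> r - \<phi> x\<bar> < \<epsilon> / 4" "\<bar>\<phi> s - \<phi> x\<bar> < \<epsilon> / 4" "\<bar>\<phi> t - \<phi> x\<bar> < \<epsilon> / 4"
            using that * by auto
          then show ?thesis by linarith
        qed
        have "(\<phi> t)\<^sup>2 - (\<phi> s)\<^sup>2 = (\<phi> t + \<phi> s) * integral {s..t} \<psi>"
        proof -
          have "integral {s..t} \<psi> = \<phi> t - \<phi> s" using \<phi>[of s t] * by simp
          show ?thesis unfolding \<open>integral {s..t} \<psi> = \<phi> t - \<phi> s\<close>
            by (simp add: power2_eq_square algebra_simps)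
        qed
        also have "\<dots> = integral {s..t} (\<lambda>r. (\<phi> t + \<phi> s) * \<psi> r)" by simp
        finally have "(\<phi> t)\<^sup>2 - (\<phi> s)\<^sup>2 - 2 * integral {s..t} (\<lambda>r. \<phi> r * \<psi> r)
            = integral {s..t} (\<lambda>r. (\<phi> t + \<phi> s) * \<psi> r) - integral {s..t} (\<lambda>r. 2 * (\<phi> r * \<psi> r))"
          by simp
        also have "\<dots> = integral {s..t} (\<lambda>r. (\<phi> t + \<phi> s) * \<psi> r - 2 * (\<phi> r * \<psi> r))"
          using * by (intro Henstock_Kurzweil_Integration.integral_diff[symmetric] integrable_on_mult_right sub[OF \<psi>_int] sub[OF \<phi>\<psi>_int])
        also have "\<bar>\<dots>\<bar> \<le> integral {s..t} (\<lambda>r. \<epsilon> * \<bar>\<psi> r\<bar>)"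
          unfolding real_norm_def[symmetric]
        proof (rule integral_norm_bound_integral)
          show "(\<lambda>r. (\<phi> t + \<phi> s) * \<psi> r - 2 * (\<phi> r * \<psi> r)) integrable_on {s..t}"
            using * by (intro integrable_diff integrable_on_mult_right sub[OF \<psi>_int] sub[OF \<phi>\<psi>_int])
          show "(\<lambda>r. \<epsilon> * norm (\<psi> r)) integrable_on {s..t}"
            using * by (simp, intro integrable_on_mult_right sub[OF abs_int])
          fix r assume "r \<in> {s..t}"
          from mult_right_mono[OF osc[OF this], of "\<bar>\<psi> r\<bar>"]
          show "norm ((\<phi> t + \<phi> s) * \<psi> r - 2 * (\<phi> r * \<psi> r)) \<le> \<epsilon> * norm (\<psi> r)"
            by (simp add: abs_mult[symmetric] algebra_simps)
        qed
        finally show "\<bar>(\<phi> t)\<^sup>2 - (\<phi> s)\<^sup>2 - 2 * integral {s..t} (\<lambda>r. \<phi> r * \<psi> r)\<bar> \<le> \<epsilon> * integral {s..t} (\<lambda>r. \<bar>\<psi> r\<bar>)"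
          by simp
      qed
    qed
    then show ?thesis using \<open>a \<le> b\<close> by (simp add: K_def)
  qed
  note small = this
  have "\<bar>(\<phi> b)\<^sup>2 - (\<phi> a)\<^sup>2 - 2 * integral {a..b} (\<lambda>r. \<phi> r * \<psi> r)\<bar> \<le> 0"
  proof (rule field_le_epsilon)
    fix e :: real assume "0 < e"
    have "0 \<le> K" unfolding K_def using abs_int by (intro integral_nonneg) auto
    then have "e / (K + 1) * K \<le> e" using \<open>0 < e\<close> by (simp add: field_simps)
    then show "\<bar>(\<phi> b)\<^sup>2 - (\<phi> a)\<^sup>2 - 2 * integral {a..b} (\<lambda>r. \<phi> r * \<psi> r)\<bar> \<le> 0 + e"
      using small[of "e / (K + 1)"] \<open>0 < e\<close> \<open>0 \<le> K\<close> by simp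
  qed
  then show "(\<phi> b)\<^sup>2 - (\<phi> a)\<^sup>2 = 2 * integral {a..b} (\<lambda>r. \<phi> r * \<psi> r)" by simp
qed

section \<open>The age interval, square integrability and representatives in H^1\<close>

lemma ages_eq_einterval: "ages sbar = einterval 0 sbar"
  by (auto simp: ages_def einterval_iff)

lemma ages_lebesgue [simp, intro]: "ages sbar \<in> sets lebesgue"
  by (simp add: ages_eq_einterval)

lemma ages_Icc_subset: "a \<in> ages sbar \<Longrightarrow> b \<in> ages sbar \<Longrightarrow> {a..b} \<subseteq> ages sbar"
  by (auto simp: ages_def intro: le_less_trans[of _ "ereal b"])

lemma ages_open: "open (ages sbar)"
  by (simp add: ages_eq_einterval)

lemma ages_is_interval: "is_interval (ages sbar)"
  unfolding is_interval_1
proof (intro ballI allI impI; elim conjE)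
  fix a b x assume "a \<in> ages sbar" "b \<in> ages sbar" "a \<le> x" "x \<le> b"
  then show "x \<in> ages sbar" using ages_Icc_subset[of a sbar b] by auto
qed

lemma ages_Ioc_subset: "0 \<le> a \<Longrightarrow> ereal b < sbar \<Longrightarrow> {a<..b} \<subseteq> ages sbar"
  by (auto simp: ages_def intro: le_less_trans[of _ "ereal b"])

lemma ages_approximation:
  assumes "0 < sbar"
  obtains u l :: "nat \<Rightarrow> real" where "ages sbar = (\<Union>n. {l n..u n})" "incseq u" "decseq l"
    "\<And>n. l n \<in> ages sbar" "\<And>n. u n \<in> ages sbar" "\<And>n. l n < u n"
    "l \<longlonglongrightarrow> 0" "filterlim (\<lambda>n. ereal (u n)) (at_left sbar) sequentially"
proof (rule einterval_Icc_approximation[OF assms])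
  fix u l :: "nat \<Rightarrow> real"
  assume eq: "einterval 0 sbar = (\<Union>i. {l i..u i})" and mono: "incseq u" "decseq l"
    and lu: "\<And>i. l i < u i" and l: "\<And>i. 0 < ereal (l i)" and u: "\<And>i. ereal (u i) < sbar"
    and lim: "(\<lambda>i. ereal (l i)) \<longlonglongrightarrow> 0" "(\<lambda>i. ereal (u i)) \<longlonglongrightarrow> sbar"
  show thesis
  proof (rule that[of l u])
    show "ages sbar = (\<Union>n. {l n..u n})" by (simp only: ages_eq_einterval eq)
    show "l n \<in> ages sbar" "u n \<in> ages sbar" for n
    proof -
      have "ereal (l n) < ereal (u n)" using lu by simp
      then have "ereal (l n) < sbar" "0 < ereal (u n)"
        using u[of n] l[of n] less_trans by (blast, blast)
      then show "l n \<in> ages sbar" "u n \<in> ages sbar" using l[of n] u[of n] by (simp_all add: ages_def)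
    qed
    show "l \<longlonglongrightarrow> 0" using lim(1) by (simp add: zero_ereal_def)
    show "filterlim (\<lambda>n. ereal (u n)) (at_left sbar) sequentially"
      unfolding filterlim_at using u lim(2) by (simp add: less_imp_neq)
  qed (rule mono lu)+
qed

lemma square_integrable_mult:
  assumes "square_integrable sbar f" "square_integrable sbar g"
  shows "integrable (lebesgue_on (ages sbar)) (\<lambda>s. f s * g s)"
proof (rule Bochner_Integration.integrable_bound)
  show "integrable (lebesgue_on (ages sbar)) (\<lambda>s. (f s)\<^sup>2 + (g s)\<^sup>2)"
    using assms by (auto simp: square_integrable_def)
  show "(\<lambda>s. f s * g s) \<in> borel_measurable (lebesgue_on (ages sbar))"
    using assms by (auto simp: square_integrable_def)
  have "\<bar>x * y\<bar> \<le> x\<^sup>2 + y\<^sup>2" for x y :: real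
  proof -
    have "2 * (\<bar>x\<bar> * \<bar>y\<bar>) \<le> x\<^sup>2 + y\<^sup>2" using sum_squares_bound[of "\<bar>x\<bar>" "\<bar>y\<bar>"] by simp
    moreover have "0 \<le> \<bar>x\<bar> * \<bar>y\<bar>" by (intro mult_nonneg_nonneg abs_ge_zero)
    ultimately show ?thesis unfolding abs_mult by linarith
  qed
  then show "AE s in lebesgue_on (ages sbar). norm (f s * g s) \<le> norm ((f s)\<^sup>2 + (g s)\<^sup>2)"
    by (auto intro!: AE_I2)
qed

lemma square_integrable_add:
  assumes "square_integrable sbar f" "square_integrable sbar g"
  shows "square_integrable sbar (\<lambda>s. f s + g s)"
  using assms square_integrable_mult[OF assms]
  by (auto simp: square_integrable_def power2_sum mult.assoc intro!: Bochner_Integration.integrable_add)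

lemma square_integrable_scale:
  assumes "square_integrable sbar f"
  shows "square_integrable sbar (\<lambda>s. c * f s)"
  using assms by (auto simp: square_integrable_def power_mult_distrib)

lemma square_integrable_absolutely_integrable:
  assumes f: "square_integrable sbar f" and ab: "0 \<le> a" "ereal b < sbar"
  shows "f absolutely_integrable_on {a..b}"
proof -
  have sub: "{a<..<b} \<subseteq> ages sbar" using ages_Ioc_subset[OF ab] by auto
  have "integrable (lebesgue_on {a<..<b}) f"
  proof (rule Bochner_Integration.integrable_bound)
    have "(\<lambda>s. (f s)\<^sup>2) absolutely_integrable_on ages sbar"
      using f by (simp add: absolutely_integrable_iff_lebesgue_on square_integrable_def)
    then have "(\<lambda>s. (f s)\<^sup>2) absolutely_integrable_on {a<..<b}"
      by (rule set_integrable_subset) (use sub in auto)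
    then have "integrable (lebesgue_on {a<..<b}) (\<lambda>s. (f s)\<^sup>2)"
      by (simp add: absolutely_integrable_iff_lebesgue_on)
    moreover have "integrable (lebesgue_on {a<..<b}) (\<lambda>s. 1::real)"
    proof -
      have "(\<lambda>s. 1::real) absolutely_integrable_on {a..b}"
        by (intro absolutely_integrable_continuous_real continuous_intros)
      then have "(\<lambda>s. 1::real) absolutely_integrable_on {a<..<b}"
        by (rule set_integrable_subset) auto
      then show ?thesis by (subst (asm) absolutely_integrable_iff_lebesgue_on) auto
    qed
    ultimately show "integrable (lebesgue_on {a<..<b}) (\<lambda>s. (f s)\<^sup>2 + 1)" by simp
    show "f \<in> borel_measurable (lebesgue_on {a<..<b})"
      using f sub by (auto simp: square_integrable_def intro: measurable_restrict_mono)
    have "\<bar>x\<bar> \<le> x\<^sup>2 + 1" for x :: real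
      using sum_squares_bound[of "\<bar>x\<bar>" 1] abs_ge_zero[of x] by simp
    then show "AE s in lebesgue_on {a<..<b}. norm (f s) \<le> norm ((f s)\<^sup>2 + 1)"
      by (auto intro!: AE_I2)
  qed
  then show ?thesis
    by (simp add: absolutely_integrable_on_Icc_iff_Ioo absolutely_integrable_iff_lebesgue_on)
qed

lemma H1_rep_integral:
  assumes "H1_rep sbar \<phi> \<psi>" "0 \<le> a" "a \<le> b" "ereal b < sbar"
  shows "\<psi> absolutely_integrable_on {a..b}" "\<phi> b - \<phi> a = integral {a..b} \<psi>"
proof -
  show 1: "\<psi> absolutely_integrable_on {a..b}"
    using assms by (auto simp: H1_rep_def intro: square_integrable_absolutely_integrable)
  then show "\<phi> b - \<phi> a = integral {a..b} \<psi>"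
    using assms by (simp add: H1_rep_def integral_lebesgue_on_eq)
qed

lemma H1_rep_square:
  assumes H1: "H1_rep sbar \<phi> \<psi>" and ab: "0 \<le> a" "a \<le> b" "ereal b < sbar"
  shows "continuous_on {a..b} \<phi>" "(\<phi> b)\<^sup>2 - (\<phi> a)\<^sup>2 = 2 * integral {a..b} (\<lambda>r. \<phi> r * \<psi> r)"
proof -
  have "\<phi> t - \<phi> s = integral {s..t} \<psi>" if "a \<le> s" "s \<le> t" "t \<le> b" for s t
    using ab that by (intro H1_rep_integral(2)[OF H1]) (auto intro: le_less_trans[of _ "ereal b"])
  from square_of_indefinite_integral[OF H1_rep_integral(1)[OF H1 ab] ab(2) this]
  show "continuous_on {a..b} \<phi>" "(\<phi> b)\<^sup>2 - (\<phi> a)\<^sup>2 = 2 * integral {a..b} (\<lambda>r. \<phi> r * \<psi> r)" by blast+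
qed

lemma H1_rep_add:
  assumes "H1_rep sbar \<phi> \<psi>" "H1_rep sbar \<phi>' \<psi>'"
  shows "H1_rep sbar (\<lambda>s. \<phi> s + c * \<phi>' s) (\<lambda>s. \<psi> s + c * \<psi>' s)"
  unfolding H1_rep_def
proof (intro conjI allI impI)
  show "square_integrable sbar (\<lambda>s. \<phi> s + c * \<phi>' s)" "square_integrable sbar (\<lambda>s. \<psi> s + c * \<psi>' s)"
    using assms by (auto simp: H1_rep_def intro!: square_integrable_add square_integrable_scale)
  fix a b :: real assume ab: "0 \<le> a" "a \<le> b" "ereal b < sbar"
  have "integrable (lebesgue_on {a..b}) \<psi>" "integrable (lebesgue_on {a..b}) \<psi>'"
    using H1_rep_integral(1)[OF assms(1) ab] H1_rep_integral(1)[OF assms(2) ab]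
    by (auto simp: absolutely_integrable_iff_lebesgue_on)
  then have "(LINT s|lebesgue_on {a..b}. \<psi> s + c * \<psi>' s) = (\<phi> b - \<phi> a) + c * (\<phi>' b - \<phi>' a)"
    using assms ab by (simp add: H1_rep_def)
  then show "\<phi> b + c * \<phi>' b - (\<phi> a + c * \<phi>' a) = (LINT s|lebesgue_on {a..b}. \<psi> s + c * \<psi>' s)"
    by (simp add: algebra_simps)
qed

text \<open>The representative is continuous, so vanishing almost everywhere means vanishing on all
  of [0, sbar), the endpoint 0 included. This makes \<open>A0star\<close> and \<open>trace0\<close>
  independent of the representative.\<close>

lemma H1_rep_AE_zero:
  assumes H1: "H1_rep sbar \<phi> \<psi>" and "0 < sbar" and zero: "AE s in lebesgue_on (ages sbar). \<phi> s = 0"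
  shows "\<And>s. 0 \<le> s \<Longrightarrow> ereal s < sbar \<Longrightarrow> \<phi> s = 0" "AE s in lebesgue_on (ages sbar). \<psi> s = 0"
proof -
  show \<phi>: "\<phi> s = 0" if s: "0 \<le> s" "ereal s < sbar" for s
  proof (rule ccontr)
    assume "\<phi> s \<noteq> 0"
    \<comment> \<open>The neighbourhood is taken to the right of s because s = 0 is allowed.\<close>
    obtain b where b: "s < b" "ereal b < sbar" using ereal_dense2[OF s(2)] by auto
    have "continuous (at s within {s..b}) \<phi>"
      using H1_rep_square(1)[OF H1 s(1) _ b(2)] b(1) by (auto simp: continuous_on_eq_continuous_within)
    then obtain \<delta> where \<delta>: "\<delta> > 0" "\<And>y. y \<in> {s..b} \<Longrightarrow> dist y s < \<delta> \<Longrightarrow> dist (\<phi> y) (\<phi> s) < \<bar>\<phi> s\<bar>"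
      using \<open>\<phi> s \<noteq> 0\<close> unfolding continuous_within_eps_delta by (metis zero_less_abs_iff)
    define c where "c = min b (s + \<delta> / 2)"
    have c: "s < c" "c \<le> b" using \<delta> b by (auto simp: c_def)
    have nz: "\<phi> y \<noteq> 0" if "y \<in> {s<..c}" for y
      using \<delta>(2)[of y] that \<delta>(1) c by (auto simp: dist_real_def c_def)
    have "AE y in lebesgue. y \<in> ages sbar \<longrightarrow> \<phi> y = 0" using zero by (simp add: AE_restrict_space_iff)
    then have "AE y in lebesgue. y \<notin> {s<..c}"
    proof eventually_elim
      case (elim y)
      have "{s<..c} \<subseteq> ages sbar"
        using s c b by (intro ages_Ioc_subset) (auto intro: le_less_trans[of _ "ereal b"])
      then show ?case using elim nz by auto
    qed
    then have "{s<..c} \<in> null_sets lebesgue" by (simp add: AE_iff_null_sets)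
    then have "emeasure lborel {s<..c} = 0" by (auto simp: null_sets_def)
    then show False using c by simp
  qed
  show "AE s in lebesgue_on (ages sbar). \<psi> s = 0"
  proof (rule ae_eq_0_if_interval_integrals_eq_0)
    fix a b assume "a \<in> ages sbar" "b \<in> ages sbar" "a \<le> b"
    then show "\<psi> integrable_on {a..b} \<and> integral {a..b} \<psi> = 0"
      using H1_rep_integral[OF H1, of a b] \<phi>[of a] \<phi>[of b] set_lebesgue_integral_eq_integral(1)
      by (auto simp: ages_def le_less_trans)
  qed (rule ages_open ages_is_interval)+
qed

text \<open>The integrand is half the derivative of the square of \<phi>. The boundary condition
  removes the contribution of sbar and that of 0 remains; compact intervals are used because sbar
  may be infinite.\<close>

lemma D_rep_energy:
  assumes D: "D_rep sbar rH f \<phi> \<psi>" and "0 < sbar"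
  shows "(LINT s|lebesgue_on (ages sbar). \<psi> s * \<phi> s) = - (\<phi> 0)\<^sup>2 / 2"
proof -
  obtain u l :: "nat \<Rightarrow> real" where ul: "ages sbar = (\<Union>n. {l n..u n})" "incseq u" "decseq l"
    "\<And>n. l n \<in> ages sbar" "\<And>n. u n \<in> ages sbar" "\<And>n. l n < u n"
    "l \<longlonglongrightarrow> 0" "filterlim (\<lambda>n. ereal (u n)) (at_left sbar) sequentially"
    by (rule ages_approximation[OF \<open>0 < sbar\<close>]) blast
  have H1: "H1_rep sbar \<phi> \<psi>" using D by (simp add: D_rep_def)
  have int: "(\<lambda>s. \<phi> s * \<psi> s) absolutely_integrable_on ages sbar"
    using H1 by (simp add: absolutely_integrable_iff_lebesgue_on H1_rep_def square_integrable_mult)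
  have "incseq (\<lambda>n. {l n..u n})"
    using ul(2,3) by (auto simp: incseq_def decseq_def intro: order_trans)
  then have lim: "(\<lambda>n. LINT s:{l n..u n}|lebesgue. \<phi> s * \<psi> s) \<longlonglongrightarrow> (LINT s:ages sbar|lebesgue. \<phi> s * \<psi> s)"
    unfolding ul(1) by (intro set_integral_cont_up) (use int ul(1) in auto)
  have eq: "(LINT s:{l n..u n}|lebesgue. \<phi> s * \<psi> s) = ((\<phi> (u n))\<^sup>2 - (\<phi> (l n))\<^sup>2) / 2" for n
  proof -
    have "(\<lambda>s. \<phi> s * \<psi> s) absolutely_integrable_on {l n..u n}"
      using int by (rule set_integrable_subset) (use ages_Icc_subset ul in auto)
    then show ?thesis
      using H1_rep_square(2)[OF H1, of "l n" "u n"] ul(4)[of n] ul(5)[of n] ul(6)[of n]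
        set_lebesgue_integral_eq_integral(2) by (auto simp: ages_def)
  qed
  have lim2: "(\<lambda>n. ((\<phi> (u n))\<^sup>2 - (\<phi> (l n))\<^sup>2) / 2) \<longlonglongrightarrow> (0\<^sup>2 - (\<phi> 0)\<^sup>2) / 2"
  proof (intro tendsto_intros)
    have "((\<lambda>e. \<phi> (real_of_ereal e)) \<longlongrightarrow> 0) (at_left sbar)" using D by (simp add: D_rep_def)
    from filterlim_compose[OF this ul(8)] show "(\<lambda>n. \<phi> (u n)) \<longlonglongrightarrow> 0" by simp
    have cont: "continuous_on {0..u 0} \<phi>"
      using H1_rep_square(1)[OF H1] ul(5)[of 0] by (auto simp: ages_def)
    have ev: "eventually (\<lambda>n. l n \<in> {0..u 0}) sequentially"
    proof -
      have "eventually (\<lambda>n. l n < u 0) sequentially"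
        using ul(7) by (rule order_tendstoD) (use ul(5)[of 0] in \<open>auto simp: ages_def\<close>)
      then show ?thesis by eventually_elim (use ul(4) in \<open>auto simp: ages_def less_imp_le\<close>)
    qed
    show "(\<lambda>n. \<phi> (l n)) \<longlonglongrightarrow> \<phi> 0"
      by (rule continuous_on_tendsto_compose[OF cont ul(7) _ ev]) (use ul(5)[of 0] in \<open>simp add: ages_def\<close>)
  qed simp
  have "(LINT s:ages sbar|lebesgue. \<phi> s * \<psi> s) = - (\<phi> 0)\<^sup>2 / 2"
    using LIMSEQ_unique[OF lim[unfolded eq] lim2] by simp
  then show ?thesis
    by (simp add: set_lebesgue_integral_def integral_restrict_space mult.commute)
qed

text \<open>Where \<phi> is negative, its derivative is at most m \<phi> and hence not positive, so
  \<phi> cannot climb back to the boundary value 0 at sbar.\<close>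

lemma D_rep_nonneg:
  assumes D: "D_rep sbar rH f \<phi> \<psi>" and "0 < sbar"
    and \<psi>: "AE s in lebesgue_on (ages sbar). \<psi> s \<le> m * \<phi> s" and "0 \<le> m"
    and a: "0 \<le> a" "ereal a < sbar"
  shows "0 \<le> \<phi> a"
proof (rule ccontr)
  assume "\<not> 0 \<le> \<phi> a"
  have H1: "H1_rep sbar \<phi> \<psi>" using D by (simp add: D_rep_def)
  have le: "\<phi> b \<le> \<phi> a" if b: "a \<le> b" "ereal b < sbar" for b
  proof (rule ccontr)
    assume "\<not> \<phi> b \<le> \<phi> a"
    have cont: "continuous_on {a..b} \<phi>" using H1_rep_square(1)[OF H1 a(1) b] .
    \<comment> \<open>The last point \<open>c\<close> of this set lies before b. Slightly beyond
      \<open>c\<close> the function is still nonpositive and so cannot have increased, against the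
      maximality of \<open>c\<close>.\<close>
    define S where "S = {t \<in> {a..b}. \<phi> t \<le> \<phi> a}"
    have "closed S" unfolding S_def using cont by (intro continuous_on_closed_Collect_le) auto
    then have "compact ({a..b} \<inter> S)" by (intro compact_Int_closed) auto
    then have "compact S" by (simp add: S_def Int_def conj_commute cong: conj_cong)
    moreover have "S \<noteq> {}" using b by (auto simp: S_def)
    ultimately obtain c where c: "c \<in> S" "\<And>t. t \<in> S \<Longrightarrow> t \<le> c"
      using compact_attains_sup by metis
    have "c < b" using c(1) \<open>\<not> \<phi> b \<le> \<phi> a\<close> by (auto simp: S_def order_less_le)
    have "\<phi> c < 0" "a \<le> c" using c(1) \<open>\<not> 0 \<le> \<phi> a\<close> by (auto simp: S_def)
    have "continuous (at c within {a..b}) \<phi>" using cont c(1) by (auto simp: S_def continuous_on_eq_continuous_within)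
    then obtain \<delta> where \<delta>: "\<delta> > 0" "\<And>y. y \<in> {a..b} \<Longrightarrow> dist y c < \<delta> \<Longrightarrow> dist (\<phi> y) (\<phi> c) < - \<phi> c"
      using \<open>\<phi> c < 0\<close> unfolding continuous_within_eps_delta by (metis neg_0_less_iff_less)
    define d where "d = min b (c + \<delta> / 2)"
    have d: "c < d" "d \<le> b" "ereal d < sbar"
      using \<delta> \<open>c < b\<close> b by (auto simp: d_def intro: le_less_trans[of _ "ereal b"])
    have neg: "\<phi> y \<le> 0" if "y \<in> {c..d}" for y
      using \<delta>(2)[of y] that \<delta>(1) d \<open>a \<le> c\<close> by (auto simp: dist_real_def d_def)
    have "\<phi> d - \<phi> c = (LINT s|lebesgue_on {c..d}. \<psi> s)"
      using H1 a \<open>a \<le> c\<close> d by (auto simp: H1_rep_def)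
    also have "\<dots> \<le> 0"
    proof -
      have 1: "AE s in lebesgue. s \<in> ages sbar \<longrightarrow> \<psi> s \<le> m * \<phi> s" using \<psi> by (simp add: AE_restrict_space_iff)
      have 2: "AE s in lebesgue. s \<noteq> c" by (simp add: AE_completion AE_lborel_singleton)
      have "AE s in lebesgue. s \<in> {c..d} \<longrightarrow> \<psi> s \<le> 0"
        using 1 2
      proof eventually_elim
        case (elim s)
        show ?case
        proof
          assume s: "s \<in> {c..d}"
          then have "s \<in> ages sbar" using elim d a \<open>a \<le> c\<close> ages_Ioc_subset[of c d sbar] by auto
          then have "\<psi> s \<le> m * \<phi> s" using elim by simp
          also have "\<dots> \<le> 0" using neg[OF s] \<open>0 \<le> m\<close> by (simp add: mult_nonneg_nonpos)
          finally show "\<psi> s \<le> 0" .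
        qed
      qed
      then have "AE s in lebesgue_on {c..d}. 0 \<le> - \<psi> s" by (simp add: AE_restrict_space_iff)
      from integral_nonneg_AE[OF this] show ?thesis by simp
    qed
    finally have "d \<in> S" using c(1) d by (auto simp: S_def)
    then show False using c(2) d by force
  qed
  obtain u l :: "nat \<Rightarrow> real" where ul: "ages sbar = (\<Union>n. {l n..u n})" "incseq u" "decseq l"
    "\<And>n. l n \<in> ages sbar" "\<And>n. u n \<in> ages sbar" "\<And>n. l n < u n"
    "l \<longlonglongrightarrow> 0" "filterlim (\<lambda>n. ereal (u n)) (at_left sbar) sequentially"
    by (rule ages_approximation[OF \<open>0 < sbar\<close>]) blast
  have "((\<lambda>e. \<phi> (real_of_ereal e)) \<longlongrightarrow> 0) (at_left sbar)" using D by (simp add: D_rep_def)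
  from filterlim_compose[OF this ul(8)] have "(\<lambda>n. \<phi> (u n)) \<longlonglongrightarrow> 0" by simp
  moreover have "\<forall>\<^sub>F n in sequentially. \<phi> (u n) \<le> \<phi> a"
  proof -
    have "(\<lambda>n. ereal (u n)) \<longlonglongrightarrow> sbar" using ul(8) by (simp add: filterlim_at)
    then have "\<forall>\<^sub>F n in sequentially. ereal a < ereal (u n)" by (rule order_tendstoD) (rule a)
    then show ?thesis by eventually_elim (use le ul(5) in \<open>auto simp: ages_def\<close>)
  qed
  ultimately have "0 \<le> \<phi> a" by (intro tendsto_upperbound) auto
  with \<open>\<not> 0 \<le> \<phi> a\<close> show False by simp
qed

section \<open>The operators on the age spaces\<close>

lemma square_integrable_bounded_support:
  assumes f: "f \<in> borel_measurable lebesgue" and bound: "\<And>s. \<bar>f s\<bar> \<le> C" and supp: "\<And>s. s \<notin> {0..c} \<Longrightarrow> f s = 0"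
  shows "square_integrable sbar f"
proof -
  have "integrable lebesgue (\<lambda>s. (f s)\<^sup>2)"
  proof (rule Bochner_Integration.integrable_bound)
    show "integrable lebesgue (\<lambda>s. C\<^sup>2 * indicator {0..c} s :: real)"
      by (intro integrable_mult_right integrable_real_indicator) (auto simp: emeasure_lborel_Icc_eq)
    show "AE s in lebesgue. norm ((f s)\<^sup>2) \<le> norm (C\<^sup>2 * indicator {0..c} s)"
    proof (intro AE_I2)
      fix s
      have "(f s)\<^sup>2 \<le> C\<^sup>2" using power_mono[OF bound[of s] abs_ge_zero, of 2] by simp
      then show "norm ((f s)\<^sup>2) \<le> norm (C\<^sup>2 * indicator {0..c} s)"
        using supp[of s] by (auto simp: indicator_def)
    qed
  qed (use f in auto)
  then have "integrable lebesgue (\<lambda>s. indicator (ages sbar) s *\<^sub>R (f s)\<^sup>2)"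
    by (intro integrable_mult_indicator) auto
  then show ?thesis
    using f by (auto simp: square_integrable_def integrable_restrict_space intro: measurable_restrict_space1)
qed

section \<open>The spaces H and V, and A_0^* and the trace as operators on V\<close>

locale age_spaces =
  fixes sbar :: ereal and \<mu> :: real
    and rH :: "'h::real_inner \<Rightarrow> real \<Rightarrow> real" and j :: "'v::real_inner \<Rightarrow> 'h"
  assumes sbar_pos: "0 < sbar" and mu_pos: "0 < \<mu>"
    and H: "is_L2 sbar rH" and V: "is_V sbar \<mu> rH j"
begin

abbreviation "M \<equiv> lebesgue_on (ages sbar)"

lemma rH_square_integrable: "square_integrable sbar (rH f)"
  using H by (simp add: is_L2_def)

lemma inner_rH: "f \<bullet> g = (LINT s|M. rH f s * rH g s)"
  using H by (simp add: is_L2_def)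

lemma ex_rH: "square_integrable sbar \<phi> \<Longrightarrow> \<exists>f. AE s in M. rH f s = \<phi> s"
  using H by (simp add: is_L2_def)

lemma rH_combination: "AE s in M. rH (f + c *\<^sub>R g) s = rH f s + c * rH g s"
proof -
  have "AE s in M. rH (f + c *\<^sub>R g) s = rH f s + rH (c *\<^sub>R g) s" "AE s in M. rH (c *\<^sub>R g) s = c * rH g s"
    using H by (auto simp: is_L2_def)
  then show ?thesis by eventually_elim simp
qed

lemma rH_eqI:
  assumes "AE s in M. rH f s = rH g s"
  shows "f = g"
proof -
  have "AE s in M. rH (f + (-1) *\<^sub>R g) s = 0"
    using rH_combination[of f "-1" g] assms by eventually_elim simp
  then have "(f - g) \<bullet> (f - g) = 0"
    unfolding inner_rH by (intro integral_eq_zero_AE) (auto elim: eventually_mono)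
  then show ?thesis by simp
qed

lemma D_rep_combination:
  assumes "D_rep sbar rH f \<phi> \<psi>" "D_rep sbar rH g \<phi>' \<psi>'"
  shows "D_rep sbar rH (f + c *\<^sub>R g) (\<lambda>s. \<phi> s + c * \<phi>' s) (\<lambda>s. \<psi> s + c * \<psi>' s)"
proof -
  have "AE s in M. rH f s = \<phi> s" "AE s in M. rH g s = \<phi>' s" using assms by (auto simp: D_rep_def)
  with rH_combination[of f c g] have "AE s in M. rH (f + c *\<^sub>R g) s = \<phi> s + c * \<phi>' s"
    by eventually_elim simp
  moreover have "((\<lambda>e. \<phi> (real_of_ereal e) + c * \<phi>' (real_of_ereal e)) \<longlongrightarrow> 0 + c * 0) (at_left sbar)"
    using assms by (intro tendsto_intros) (auto simp: D_rep_def)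
  ultimately show ?thesis
    using assms by (simp add: D_rep_def H1_rep_add)
qed

lemma D_rep_unique:
  assumes "D_rep sbar rH f \<phi> \<psi>" "D_rep sbar rH f \<phi>' \<psi>'"
  shows "\<And>s. 0 \<le> s \<Longrightarrow> ereal s < sbar \<Longrightarrow> \<phi> s = \<phi>' s" "AE s in M. \<psi> s = \<psi>' s"
proof -
  have H1: "H1_rep sbar (\<lambda>s. \<phi> s + (-1) * \<phi>' s) (\<lambda>s. \<psi> s + (-1) * \<psi>' s)"
    using assms by (intro H1_rep_add) (auto simp: D_rep_def)
  have "AE s in M. rH f s = \<phi> s" "AE s in M. rH f s = \<phi>' s" using assms by (auto simp: D_rep_def)
  then have zero: "AE s in M. \<phi> s + (-1) * \<phi>' s = 0" by eventually_elim simp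
  show "\<phi> s = \<phi>' s" if "0 \<le> s" "ereal s < sbar" for s
    using H1_rep_AE_zero(1)[OF H1 sbar_pos zero that] by simp
  show "AE s in M. \<psi> s = \<psi>' s"
    using H1_rep_AE_zero(2)[OF H1 sbar_pos zero] by eventually_elim simp
qed

definition A0 :: "'v \<Rightarrow> 'h" where "A0 v = A0star sbar \<mu> rH (j v)"
definition tr :: "'v \<Rightarrow> real" where "tr v = trace0 sbar rH (j v)"

lemma j_linear: "linear j" and j_inj: "inj j"
  and range_j: "range j = dom_A0star sbar rH"
  and inner_V: "v \<bullet> w = j v \<bullet> j w + A0 v \<bullet> A0 w"
  using V by (auto simp: is_V_def A0_def)

lemma ex_D_rep: "\<exists>\<phi> \<psi>. D_rep sbar rH (j v) \<phi> \<psi>"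
proof -
  have "j v \<in> dom_A0star sbar rH" unfolding range_j[symmetric] by simp
  then show ?thesis by (simp add: dom_A0star_def)
qed

lemma A0_rep:
  assumes D: "D_rep sbar rH (j v) \<phi> \<psi>"
  shows "AE s in M. rH (A0 v) s = \<psi> s - \<mu> * \<phi> s"
proof -
  have "square_integrable sbar (\<lambda>s. \<psi> s + (- \<mu>) * \<phi> s)"
    using D by (intro square_integrable_add square_integrable_scale) (auto simp: D_rep_def H1_rep_def)
  then obtain h where h: "AE s in M. rH h s = \<psi> s - \<mu> * \<phi> s" using ex_rH by force
  have "A0 v = h"
    unfolding A0_def A0star_def
  proof (rule the_equality)
    show "\<exists>\<phi> \<psi>. D_rep sbar rH (j v) \<phi> \<psi> \<and> (AE s in M. rH h s = \<psi> s - \<mu> * \<phi> s)"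
      using D h by blast
    fix g assume "\<exists>\<phi> \<psi>. D_rep sbar rH (j v) \<phi> \<psi> \<and> (AE s in M. rH g s = \<psi> s - \<mu> * \<phi> s)"
    then obtain \<phi>' \<psi>' where D': "D_rep sbar rH (j v) \<phi>' \<psi>'" and g: "AE s in M. rH g s = \<psi>' s - \<mu> * \<phi>' s"
      by blast
    have "AE s in M. s \<in> ages sbar" using AE_space[of M] by simp
    then have "AE s in M. rH g s = rH h s"
      using g h D_rep_unique(2)[OF D D']
    proof eventually_elim
      case (elim s)
      then show ?case using D_rep_unique(1)[OF D D', of s] by (auto simp: ages_def)
    qed
    then show "g = h" by (rule rH_eqI)
  qed
  with h show ?thesis by simp
qed

lemma tr_rep:
  assumes D: "D_rep sbar rH (j v) \<phi> \<psi>"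
  shows "tr v = \<phi> 0"
  unfolding tr_def trace0_def
proof (rule the_equality)
  show "\<exists>\<phi>' \<psi>'. D_rep sbar rH (j v) \<phi>' \<psi>' \<and> \<phi> 0 = \<phi>' 0" using D by blast
  show "c = \<phi> 0" if "\<exists>\<phi> \<psi>. D_rep sbar rH (j v) \<phi> \<psi> \<and> c = \<phi> 0" for c
    using that D_rep_unique(1)[OF D, of _ _ 0] sbar_pos by (auto simp: zero_ereal_def)
qed

lemma j_combination: "j (v + c *\<^sub>R w) = j v + c *\<^sub>R j w"
  using j_linear by (simp add: linear_add linear_scale)

lemma combination_rep: "A0 (v + c *\<^sub>R w) = A0 v + c *\<^sub>R A0 w" "tr (v + c *\<^sub>R w) = tr v + c * tr w"
proof -
  obtain \<phi> \<psi> \<phi>' \<psi>' where D: "D_rep sbar rH (j v) \<phi> \<psi>" "D_rep sbar rH (j w) \<phi>' \<psi>'"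
    using ex_D_rep by metis
  from D_rep_combination[OF this, of c]
  have D': "D_rep sbar rH (j (v + c *\<^sub>R w)) (\<lambda>s. \<phi> s + c * \<phi>' s) (\<lambda>s. \<psi> s + c * \<psi>' s)"
    by (simp add: j_combination)
  show "tr (v + c *\<^sub>R w) = tr v + c * tr w"
    by (simp add: tr_rep[OF D'] tr_rep[OF D(1)] tr_rep[OF D(2)])
  show "A0 (v + c *\<^sub>R w) = A0 v + c *\<^sub>R A0 w"
  proof (rule rH_eqI)
    show "AE s in M. rH (A0 (v + c *\<^sub>R w)) s = rH (A0 v + c *\<^sub>R A0 w) s"
      using A0_rep[OF D'] A0_rep[OF D(1)] A0_rep[OF D(2)] rH_combination[of "A0 v" c "A0 w"]
      by eventually_elim (simp only:, simp add: algebra_simps)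
  qed
qed

lemma linearI_combination:
  fixes f :: "'v \<Rightarrow> 'b::real_vector"
  assumes "\<And>v c w. f (v + c *\<^sub>R w) = f v + c *\<^sub>R f w"
  shows "linear f"
proof (rule linearI)
  have zero: "f 0 = 0" using assms[of 0 "-1" 0] by simp
  show "f (v + w) = f v + f w" for v w using assms[of v 1 w] by simp
  show "f (c *\<^sub>R v) = c *\<^sub>R f v" for c v using assms[of 0 c v] zero by simp
qed

lemma A0_linear: "linear A0" and tr_linear: "linear tr"
  using combination_rep by (auto intro!: linearI_combination)

text \<open>\<open>D_rep_energy\<close> together with the mortality term. Both terms on the right
  are nonpositive, which is the source of all resolvent bounds below.\<close>

lemma A0_energy: "A0 v \<bullet> j v = - (tr v)\<^sup>2 / 2 - \<mu> * (norm (j v))\<^sup>2"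
proof -
  obtain \<phi> \<psi> where D: "D_rep sbar rH (j v) \<phi> \<psi>" using ex_D_rep by blast
  have sq: "square_integrable sbar \<phi>" "square_integrable sbar \<psi>" using D by (auto simp: D_rep_def H1_rep_def)
  have j: "AE s in M. rH (j v) s = \<phi> s" using D by (simp add: D_rep_def)
  have meas: "rH f \<in> borel_measurable M" for f using rH_square_integrable by (simp add: square_integrable_def)
  have \<phi>_meas: "\<phi> \<in> borel_measurable M" "\<psi> \<in> borel_measurable M" using sq by (auto simp: square_integrable_def)
  have "(norm (j v))\<^sup>2 = (LINT s|M. rH (j v) s * rH (j v) s)" by (simp add: power2_norm_eq_inner inner_rH)
  also have "\<dots> = (LINT s|M. \<phi> s * \<phi> s)"
    by (rule integral_cong_AE) (use meas \<phi>_meas j in \<open>auto elim: eventually_mono\<close>)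
  finally have norm: "(norm (j v))\<^sup>2 = (LINT s|M. \<phi> s * \<phi> s)" .
  have "A0 v \<bullet> j v = (LINT s|M. \<psi> s * \<phi> s - \<mu> * (\<phi> s * \<phi> s))"
    unfolding inner_rH
  proof (rule integral_cong_AE)
    show "AE s in M. rH (A0 v) s * rH (j v) s = \<psi> s * \<phi> s - \<mu> * (\<phi> s * \<phi> s)"
      using A0_rep[OF D] j by eventually_elim (simp only:, simp add: algebra_simps)
  qed (use meas \<phi>_meas in auto)
  also have "\<dots> = (LINT s|M. \<psi> s * \<phi> s) - \<mu> * (LINT s|M. \<phi> s * \<phi> s)"
    by (simp add: square_integrable_mult sq)
  finally show ?thesis using tr_rep[OF D] norm D_rep_energy[OF D sbar_pos] by simp
qed

lemma norm_V: "(norm v)\<^sup>2 = (norm (j v))\<^sup>2 + (norm (A0 v))\<^sup>2"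
  by (simp add: power2_norm_eq_inner inner_V)

lemma norm_j_le: "norm (j v) \<le> norm v" and norm_A0_le: "norm (A0 v) \<le> norm v"
  by (rule power2_le_imp_le; simp add: norm_V[of v])+

text \<open>Read for the trace, the energy identity bounds its square by 2 |A_0^* v| |v|; the
  constant 2 is not optimal. This bound makes the Dirac functional at 0 an element of V'.\<close>

lemma abs_tr_le: "\<bar>tr v\<bar> \<le> 2 * norm v"
proof (rule power2_le_imp_le)
  have "(tr v)\<^sup>2 \<le> - 2 * (A0 v \<bullet> j v)"
    using A0_energy[of v] mult_nonneg_nonneg[of \<mu> "(norm (j v))\<^sup>2"] mu_pos by simp
  also have "\<dots> \<le> 2 * (norm (A0 v) * norm (j v))"
    using Cauchy_Schwarz_ineq2[of "A0 v" "j v"] by linarith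
  also have "\<dots> \<le> 2 * (norm v * norm v)"
    by (intro mult_left_mono mult_mono norm_j_le norm_A0_le) auto
  also have "\<dots> \<le> (2 * norm v)\<^sup>2" by (simp add: power2_eq_square)
  finally show "\<bar>tr v\<bar>\<^sup>2 \<le> (2 * norm v)\<^sup>2" by simp
qed simp

lemma j_bounded_linear: "bounded_linear j"
  and A0_bounded_linear: "bounded_linear A0"
  and tr_bounded_linear: "bounded_linear tr"
proof -
  show "bounded_linear j"
    using j_linear norm_j_le by (intro bounded_linear_intro[of _ 1]) (auto simp: linear_add linear_scale)
  show "bounded_linear A0"
    using A0_linear norm_A0_le by (intro bounded_linear_intro[of _ 1]) (auto simp: linear_add linear_scale)
  show "bounded_linear tr"
    using tr_linear abs_tr_le by (intro bounded_linear_intro[of _ 2]) (auto simp: linear_add linear_scale mult.commute)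
qed

text \<open>Density of \<open>V\<close> in \<open>H\<close>: a function \<open>f\<close> orthogonal to \<open>V\<close> is in particular orthogonal to
  \<open>\<phi>(s) = \<integral>\<^sub>s\<^sup>c f\<close>, and as \<open>f = -\<phi>'\<close> on \<open>(0, c)\<close> this inner product is \<open>\<phi>(0)\<^sup>2 / 2\<close>.\<close>

lemma orthogonal_range_j_imp_zero:
  assumes orth: "\<And>v. f \<bullet> j v = 0"
  shows "f = 0"
proof -
  let ?f = "rH f"
  have abs_int: "?f absolutely_integrable_on {a..b}" if "0 \<le> a" "ereal b < sbar" for a b
    using square_integrable_absolutely_integrable[OF rH_square_integrable that] .
  have int: "?f integrable_on {a..b}" if "0 \<le> a" "ereal b < sbar" for a b
    using abs_int[OF that] by (rule set_lebesgue_integral_eq_integral(1))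
  have meas: "?f \<in> borel_measurable M" using rH_square_integrable by (simp add: square_integrable_def)
  have zero: "integral {0..c} ?f = 0" if c: "c \<in> ages sbar" for c
  proof -
    have c0: "0 < c" "ereal c < sbar" using c by (auto simp: ages_def)
    define \<phi> where "\<phi> s = (if s \<in> {0..c} then integral {s..c} ?f else 0)" for s
    \<comment> \<open>Beyond c the function and its derivative are 0, so the boundary condition at
      sbar holds also when sbar is infinite.\<close>
    define \<psi> where "\<psi> s = (if s < c then - ?f s else 0)" for s
    have cont: "continuous_on {0..c} (\<lambda>s. integral {s..c} ?f)"
      using int[of 0 c] c0 by (intro indefinite_integral_continuous_1') auto
    have sq_\<phi>: "square_integrable sbar \<phi>"
    proof -
      have "bounded ((\<lambda>s. integral {s..c} ?f) ` {0..c})"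
        by (intro compact_imp_bounded compact_continuous_image cont compact_Icc)
      then obtain C where C: "\<And>s. s \<in> {0..c} \<Longrightarrow> \<bar>integral {s..c} ?f\<bar> \<le> C"
        unfolding bounded_iff by (metis imageI real_norm_def)
      have "0 \<le> C" using C[of 0] c0 by force
      show ?thesis
      proof (rule square_integrable_bounded_support[of _ C c])
        show "\<phi> \<in> borel_measurable lebesgue"
          unfolding \<phi>_def by (subst borel_measurable_if)
            (auto intro: continuous_imp_measurable_on_sets_lebesgue cont)
      qed (use C \<open>0 \<le> C\<close> in \<open>auto simp: \<phi>_def\<close>)
    qed
    have sq_\<psi>: "square_integrable sbar \<psi>"
      unfolding square_integrable_def
    proof
      have "Measurable.pred M (\<lambda>s. s < c)"
        by (intro measurable_restrict_space1 measurable_completion) auto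
      then show meas_\<psi>: "\<psi> \<in> borel_measurable M"
        unfolding \<psi>_def using meas by (intro measurable_If) (auto simp: pred_def)
      show "integrable M (\<lambda>s. (\<psi> s)\<^sup>2)"
      proof (rule Bochner_Integration.integrable_bound)
        show "integrable M (\<lambda>s. (?f s)\<^sup>2)" using rH_square_integrable[of f] by (simp add: square_integrable_def)
        show "(\<lambda>s. (\<psi> s)\<^sup>2) \<in> borel_measurable M" using meas_\<psi> by simp
      qed (auto simp: \<psi>_def)
    qed
    have FTC: "\<phi> b - \<phi> a = integral {a..b} \<psi>" if ab: "0 \<le> a" "a \<le> b" "ereal b < sbar" for a b
    proof -
      have *: "integral {x..y} \<psi> = - integral {x..y} ?f" if "y \<le> c" for x y
        unfolding Henstock_Kurzweil_Integration.integral_neg[symmetric]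
        by (rule integral_spike[of "{c}"]) (use that in \<open>auto simp: \<psi>_def\<close>)
      have **: "integral {x..y} \<psi> = 0" if "c \<le> x" for x y
        by (rule integral_unique[OF has_integral_is_0]) (use that in \<open>auto simp: \<psi>_def\<close>)
      have \<psi>_int: "\<psi> integrable_on {a..b}"
        using square_integrable_absolutely_integrable[OF sq_\<psi> ab(1,3)]
        by (rule set_lebesgue_integral_eq_integral(1))
      consider "b \<le> c" | "a \<le> c" "c \<le> b" | "c \<le> a" by linarith
      then show ?thesis
      proof cases
        case 1
        then have "integral {a..b} ?f + integral {b..c} ?f = integral {a..c} ?f"
          using ab c0 by (intro Henstock_Kurzweil_Integration.integral_combine int) auto
        moreover have "integral {a..b} \<psi> = - integral {a..b} ?f" using 1 by (rule *)
        moreover have "\<phi> a = integral {a..c} ?f" "\<phi> b = integral {b..c} ?f" using 1 ab by (simp_all add: \<phi>_def)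
        ultimately show ?thesis by simp
      next
        case 2
        then have "integral {a..c} \<psi> + integral {c..b} \<psi> = integral {a..b} \<psi>"
          by (intro Henstock_Kurzweil_Integration.integral_combine \<psi>_int) auto
        moreover have "integral {a..c} \<psi> = - integral {a..c} ?f" by (rule *) simp
        moreover have "integral {c..b} \<psi> = 0" by (rule **) simp
        moreover have "\<phi> a = integral {a..c} ?f" using 2 ab by (simp add: \<phi>_def)
        moreover have "\<phi> b = 0" using 2 by (simp add: \<phi>_def)
        ultimately show ?thesis by simp
      next
        case 3
        then have "integral {a..b} \<psi> = 0" by (rule **)
        moreover have "\<phi> s = 0" if "c \<le> s" for s using that by (cases "s = c") (simp_all add: \<phi>_def)
        then have "\<phi> a = 0" "\<phi> b = 0" using 3 ab by simp_all
        ultimately show ?thesis by simp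
      qed
    qed
    have H1: "H1_rep sbar \<phi> \<psi>"
      unfolding H1_rep_def
      using sq_\<phi> sq_\<psi> FTC square_integrable_absolutely_integrable[OF sq_\<psi>]
      by (simp add: integral_lebesgue_on_eq)
    obtain g where g: "AE s in M. rH g s = \<phi> s" using ex_rH[OF sq_\<phi>] by blast
    have "\<forall>\<^sub>F e in at_left sbar. \<phi> (real_of_ereal e) = 0"
      unfolding eventually_at_left[OF c0(2)]
    proof (intro exI[of _ "ereal c"] conjI allI impI c0(2))
      fix e assume "ereal c < e" "e < sbar"
      then show "\<phi> (real_of_ereal e) = 0" by (cases e) (auto simp: \<phi>_def)
    qed
    then have "((\<lambda>e. \<phi> (real_of_ereal e)) \<longlongrightarrow> 0) (at_left sbar)" by (rule tendsto_eventually)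
    with g H1 have D: "D_rep sbar rH g \<phi> \<psi>" by (simp add: D_rep_def)
    then obtain v where "j v = g" using range_j by (force simp: dom_A0star_def)
    have "0 = f \<bullet> g" using orth[of v] \<open>j v = g\<close> by simp
    also have "\<dots> = (LINT s|M. - (\<psi> s * \<phi> s))"
      unfolding inner_rH
    proof (rule integral_cong_AE)
      show "AE s in M. ?f s * rH g s = - (\<psi> s * \<phi> s)"
        using g by eventually_elim (auto simp: \<psi>_def \<phi>_def)
      show "(\<lambda>s. ?f s * rH g s) \<in> borel_measurable M" "(\<lambda>s. - (\<psi> s * \<phi> s)) \<in> borel_measurable M"
        using meas rH_square_integrable[of g] sq_\<phi> sq_\<psi> by (auto simp: square_integrable_def)
    qed
    also have "\<dots> = (\<phi> 0)\<^sup>2 / 2" using D_rep_energy[OF D sbar_pos] by simp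
    finally show ?thesis using c0 by (simp add: \<phi>_def)
  qed
  have "AE s in M. ?f s = 0"
  proof (rule ae_eq_0_if_interval_integrals_eq_0)
    fix a b assume ab: "a \<in> ages sbar" "b \<in> ages sbar" "a \<le> b"
    then have "integral {0..a} ?f + integral {a..b} ?f = integral {0..b} ?f"
      by (intro Henstock_Kurzweil_Integration.integral_combine int) (auto simp: ages_def)
    then show "?f integrable_on {a..b} \<and> integral {a..b} ?f = 0"
      using zero ab int[of a b] by (auto simp: ages_def)
  qed (rule ages_open ages_is_interval)+
  then have "f \<bullet> f = 0" unfolding inner_rH by (intro integral_eq_zero_AE) (auto elim: eventually_mono)
  then show ?thesis by simp
qed

section \<open>The embedding of H in V' and the operators A, B and B^*\<close>

lemma emb_H_apply: "blinfun_apply (emb_H j f) v = f \<bullet> j v"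
  unfolding emb_H_def
  by (subst bounded_linear_Blinfun_apply)
    (auto intro: bounded_linear_compose[OF bounded_linear_inner_right j_bounded_linear, unfolded o_def])

text \<open>Injectivity is the density of V in H; it gives \<open>inv (emb_H j)\<close> in
  \<open>op_A\<close> its intended meaning.\<close>

lemma emb_H_inj: "inj (emb_H j)"
proof (rule injI)
  fix f g assume "emb_H j f = emb_H j g"
  then have "(f - g) \<bullet> j v = 0" for v by (metis emb_H_apply inner_diff_left right_minus_eq)
  from orthogonal_range_j_imp_zero[OF this] show "f = g" by simp
qed

lemma op_A_apply: "blinfun_apply (op_A sbar \<mu> rH j (emb_H j f)) v = f \<bullet> A0 v"
  unfolding op_A_def A0_def[symmetric] inv_f_f[OF emb_H_inj]
  by (subst bounded_linear_Blinfun_apply)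
    (auto intro: bounded_linear_compose[OF bounded_linear_inner_right A0_bounded_linear, unfolded o_def])

text \<open>This is B^* in explicit form, as \<open>op_Bstar_eq\<close> confirms.\<close>

definition Bs :: "'v \<Rightarrow> real \<times> 'h" where "Bs v = (tr v, j v)"

lemma Bs_bounded_linear: "bounded_linear Bs"
  unfolding Bs_def by (intro bounded_linear_Pair tr_bounded_linear j_bounded_linear)

lemma op_B_apply: "blinfun_apply (op_B sbar rH j u) v = u \<bullet> Bs v"
proof -
  have "blinfun_apply (delta0 sbar rH j) v = tr v"
    unfolding delta0_def tr_def[symmetric] by (simp add: bounded_linear_Blinfun_apply tr_bounded_linear)
  then show ?thesis
    by (simp add: op_B_def emb_H_apply Bs_def blinfun.add_left blinfun.scaleR_left inner_prod_def)
qed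

lemma op_Bstar_eq: "op_Bstar sbar rH j v = Bs v"
  unfolding op_Bstar_def
proof (rule the_equality)
  show "\<forall>u. blinfun_apply (op_B sbar rH j u) v = u \<bullet> Bs v" by (simp add: op_B_apply)
  fix z assume "\<forall>u. blinfun_apply (op_B sbar rH j u) v = u \<bullet> z"
  then have "(z - Bs v) \<bullet> Bs v = (z - Bs v) \<bullet> z" by (simp only: op_B_apply)
  then have "(z - Bs v) \<bullet> (z - Bs v) = 0" unfolding inner_diff_right by simp
  then show "z = Bs v" by simp
qed

text \<open>The equation is tested with j w; by the energy identity, A0 contributes \<mu> |j w|^2
  and a trace term of favourable sign.\<close>

lemma resolvent_bound_H:
  assumes A0: "A0 w = \<kappa> *\<^sub>R j w - f" and \<kappa>: "0 < \<kappa> + \<mu>"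
  shows "(\<kappa> + \<mu>) * norm (j w) \<le> norm f"
proof -
  have "A0 w \<bullet> j w = \<kappa> * (norm (j w))\<^sup>2 - f \<bullet> j w"
    by (simp add: A0 inner_diff_left power2_norm_eq_inner)
  then have "(\<kappa> + \<mu>) * (norm (j w))\<^sup>2 + (tr w)\<^sup>2 / 2 = f \<bullet> j w"
    using A0_energy[of w] by (simp add: algebra_simps)
  also have "\<dots> \<le> norm f * norm (j w)" by (rule norm_cauchy_schwarz)
  finally have "(\<kappa> + \<mu>) * (norm (j w))\<^sup>2 \<le> norm f * norm (j w)"
    using zero_le_power2[of "tr w"] by linarith
  then have "(\<kappa> + \<mu>) * norm (j w) * norm (j w) \<le> norm f * norm (j w)"
    by (simp add: power2_eq_square mult.assoc)
  then show ?thesis by (cases "norm (j w) = 0") (auto dest: mult_right_le_imp_le)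
qed

text \<open>The norm of V is the graph norm, so the bound in H is used twice: for w, and for A0 w,
  which solves the same equation with right-hand side A0 v because A0 commutes with its
  resolvent.\<close>

lemma resolvent_bound:
  assumes A0: "A0 w = \<kappa> *\<^sub>R j w - j v" and \<kappa>: "0 < \<kappa> + \<mu>"
  shows "(\<kappa> + \<mu>) * norm w \<le> norm v"
proof (rule power2_le_imp_le)
  have 1: "(\<kappa> + \<mu>) * norm (j w) \<le> norm (j v)" by (rule resolvent_bound_H[OF A0 \<kappa>])
  \<comment> \<open>The equation shows that A0 w lies in the range of j: it is the image of \<kappa>
    w - v.\<close>
  define y where "y = \<kappa> *\<^sub>R w - v"
  have y: "j y = A0 w" by (simp add: y_def A0 linear_diff[OF j_linear] linear_scale[OF j_linear])
  have "A0 y = \<kappa> *\<^sub>R j y - A0 v"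
    unfolding y by (simp add: y_def linear_diff[OF A0_linear] linear_scale[OF A0_linear])
  from resolvent_bound_H[OF this \<kappa>] have 2: "(\<kappa> + \<mu>) * norm (A0 w) \<le> norm (A0 v)" by (simp add: y)
  have "((\<kappa> + \<mu>) * norm w)\<^sup>2 = ((\<kappa> + \<mu>) * norm (j w))\<^sup>2 + ((\<kappa> + \<mu>) * norm (A0 w))\<^sup>2"
    by (simp add: power_mult_distrib norm_V[of w] distrib_left)
  also have "\<dots> \<le> (norm (j v))\<^sup>2 + (norm (A0 v))\<^sup>2"
    using 1 2 \<kappa> by (intro add_mono power_mono) auto
  finally show "((\<kappa> + \<mu>) * norm w)\<^sup>2 \<le> (norm v)\<^sup>2" by (simp add: norm_V[of v])
qed simp

text \<open>For a representative the equation reads \<phi>' = (\<kappa> + \<mu>) \<phi> - v, so a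
  nonnegative v gives the differential inequality of \<open>D_rep_nonneg\<close>.\<close>

lemma resolvent_nonneg:
  assumes A0: "A0 w = \<kappa> *\<^sub>R j w - j v" and \<kappa>: "0 \<le> \<kappa> + \<mu>"
    and v: "AE s in M. 0 \<le> rH (j v) s"
  shows "AE s in M. 0 \<le> rH (j w) s" "0 \<le> tr w"
proof -
  obtain \<phi> \<psi> where D: "D_rep sbar rH (j w) \<phi> \<psi>" using ex_D_rep by blast
  have jw: "AE s in M. rH (j w) s = \<phi> s" using D by (simp add: D_rep_def)
  have "AE s in M. rH (\<kappa> *\<^sub>R j w + (-1) *\<^sub>R j v) s = \<kappa> * rH (j w) s - rH (j v) s"
    using rH_combination[of "\<kappa> *\<^sub>R j w" "-1" "j v"] rH_combination[of 0 \<kappa> "j w"] rH_combination[of 0 "-1" 0]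
    by eventually_elim simp
  then have "AE s in M. \<psi> s \<le> (\<kappa> + \<mu>) * \<phi> s"
    using A0_rep[OF D] jw v unfolding A0 by eventually_elim (simp add: distrib_right)
  from D_rep_nonneg[OF D sbar_pos this \<kappa>]
  have \<phi>: "0 \<le> s \<Longrightarrow> ereal s < sbar \<Longrightarrow> 0 \<le> \<phi> s" for s by blast
  have "AE s in M. s \<in> ages sbar" using AE_space[of M] by simp
  then show "AE s in M. 0 \<le> rH (j w) s"
    using jw by eventually_elim (auto simp: ages_def \<phi>)
  show "0 \<le> tr w" using \<phi>[of 0] sbar_pos by (simp add: tr_rep[OF D] zero_ereal_def)
qed

end

section \<open>The semigroup on the dual space\<close>

definition Riesz_dual :: "'v::real_inner \<Rightarrow> 'v \<Rightarrow>\<^sub>L real" where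
  "Riesz_dual a = Blinfun (\<lambda>v. v \<bullet> a)"

lemma Riesz_dual_apply: "blinfun_apply (Riesz_dual a) v = v \<bullet> a"
  unfolding Riesz_dual_def by (simp add: bounded_linear_Blinfun_apply bounded_linear_inner_left)

lemma norm_Riesz_dual_le: "norm (Riesz_dual a) \<le> norm a"
  by (rule norm_blinfun_bound) (use Cauchy_Schwarz_ineq2 in \<open>auto simp: Riesz_dual_apply mult.commute\<close>)

lemma bounded_linear_Riesz_dual: "bounded_linear Riesz_dual"
  by (rule bounded_linear_intro[of _ 1])
    (auto intro!: blinfun_eqI simp: Riesz_dual_apply blinfun.add_left blinfun.scaleR_left inner_add_right norm_Riesz_dual_le)

text \<open>The Riesz theorem is used twice, for the functional pulled back to V and for each
  element of V'.\<close>

lemma Hilbert_reflexive: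
  fixes F :: "('v::{real_inner,complete_space} \<Rightarrow>\<^sub>L real) \<Rightarrow> real"
  assumes "bounded_linear F"
  shows "\<exists>w. \<forall>x. F x = blinfun_apply x w"
proof -
  have bl: "bounded_linear (\<lambda>a. F (Riesz_dual a))"
    using bounded_linear_compose[OF assms bounded_linear_Riesz_dual] by (simp add: o_def)
  obtain w where w: "\<And>a. F (Riesz_dual a) = a \<bullet> w"
    using Riesz_representation[of "Blinfun (\<lambda>a. F (Riesz_dual a))"] by (auto simp: bounded_linear_Blinfun_apply[OF bl])
  have "F x = blinfun_apply x w" for x
  proof -
    obtain a where a: "\<And>v. blinfun_apply x v = v \<bullet> a" by (rule Riesz_representation) blast
    then have "x = Riesz_dual a" by (intro blinfun_eqI) (simp add: Riesz_dual_apply)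
    then show ?thesis using w[of a] by (simp add: Riesz_dual_apply inner_commute)
  qed
  then show ?thesis by blast
qed

text \<open>By reflexivity the adjoint of an operator on V' acts on V; testing with the Riesz dual
  of w bounds it. It serves to move semigroup operators onto the test vector in weakly defined
  integrals.\<close>

lemma Hilbert_adjoint:
  fixes F :: "('v::{real_inner,complete_space} \<Rightarrow>\<^sub>L real) \<Rightarrow>\<^sub>L ('v \<Rightarrow>\<^sub>L real)"
  shows "\<exists>w. (\<forall>x. blinfun_apply (blinfun_apply F x) v = blinfun_apply x w) \<and> norm w \<le> norm F * norm v"
proof -
  have "bounded_linear (\<lambda>x. blinfun_apply (blinfun_apply F x) v)"
    by (intro bounded_linear_intros)
  then obtain w where w: "\<And>x. blinfun_apply (blinfun_apply F x) v = blinfun_apply x w"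
    using Hilbert_reflexive by blast
  have "(norm w)\<^sup>2 = blinfun_apply (blinfun_apply F (Riesz_dual w)) v"
    by (simp add: w Riesz_dual_apply power2_norm_eq_inner)
  also have "\<dots> \<le> norm (blinfun_apply F (Riesz_dual w)) * norm v"
    using norm_blinfun[of "blinfun_apply F (Riesz_dual w)" v] by simp
  also have "\<dots> \<le> norm F * norm w * norm v"
  proof (rule mult_right_mono)
    show "norm (blinfun_apply F (Riesz_dual w)) \<le> norm F * norm w"
      using norm_blinfun[of F "Riesz_dual w"] mult_left_mono[OF norm_Riesz_dual_le[of w], of "norm F"] by simp
  qed simp
  finally have "norm w * norm w \<le> (norm F * norm v) * norm w" by (simp add: power2_eq_square mult_ac)
  then have "norm w \<le> norm F * norm v" by (cases "norm w = 0") (auto dest: mult_right_le_imp_le)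
  with w show ?thesis by blast
qed

lemma abs_dual_le: "\<bar>blinfun_apply x v\<bar> \<le> norm x * norm v" for x :: "'v::real_normed_vector \<Rightarrow>\<^sub>L real"
  using norm_blinfun[of x v] by simp

section \<open>Laplace transforms of a semigroup on V'\<close>

locale dual_semigroup = c0_semigroup T
  for T :: "real \<Rightarrow> ('v::{real_inner,complete_space} \<Rightarrow>\<^sub>L real) \<Rightarrow>\<^sub>L ('v \<Rightarrow>\<^sub>L real)"
begin

lemma pairing_continuous: "continuous_on {0..} (\<lambda>t. blinfun_apply (blinfun_apply (T t) x) v)"
  by (intro continuous_intros T_continuous)

lemma abs_Laplace_integrand_le:
  assumes growth: "\<And>t. 0 \<le> t \<Longrightarrow> norm (T t) \<le> C * exp (\<omega> * t)" and t: "0 \<le> t"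
  shows "\<bar>exp (- \<kappa> * t) * blinfun_apply (blinfun_apply (T t) x) v\<bar> \<le> C * norm x * norm v * exp (- (\<kappa> - \<omega>) * t)"
proof -
  have "\<bar>blinfun_apply (blinfun_apply (T t) x) v\<bar> \<le> norm (blinfun_apply (T t) x) * norm v" by (rule abs_dual_le)
  also have "\<dots> \<le> norm (T t) * norm x * norm v" by (intro mult_right_mono norm_blinfun norm_ge_zero)
  also have "\<dots> \<le> C * exp (\<omega> * t) * norm x * norm v" by (intro mult_right_mono growth[OF t] norm_ge_zero)
  finally have "exp (- \<kappa> * t) * \<bar>blinfun_apply (blinfun_apply (T t) x) v\<bar> \<le> exp (- \<kappa> * t) * (C * exp (\<omega> * t) * norm x * norm v)"
    by (rule mult_left_mono) simp
  also have "\<dots> = C * norm x * norm v * (exp (- \<kappa> * t) * exp (\<omega> * t))" by (simp add: mult_ac)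
  also have "exp (- \<kappa> * t) * exp (\<omega> * t) = exp (- (\<kappa> - \<omega>) * t)" by (simp add: mult_exp_exp algebra_simps)
  finally show ?thesis by (simp add: abs_mult)
qed

lemma Laplace_integrable:
  assumes growth: "\<And>t. 0 \<le> t \<Longrightarrow> norm (T t) \<le> C * exp (\<omega> * t)" and \<kappa>: "\<omega> < \<kappa>"
  shows "integrable (lebesgue_on {0<..}) (\<lambda>t. exp (- \<kappa> * t) * blinfun_apply (blinfun_apply (T t) x) v)"
    and "\<bar>LINT t|lebesgue_on {0<..}. exp (- \<kappa> * t) * blinfun_apply (blinfun_apply (T t) x) v\<bar> \<le> C * norm x * norm v / (\<kappa> - \<omega>)"
proof -
  note bound = abs_Laplace_integrand_le[OF growth]
  have cont: "continuous_on {0..} (\<lambda>t. exp (- \<kappa> * t) * blinfun_apply (blinfun_apply (T t) x) v)"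
    by (intro continuous_intros pairing_continuous)
  show "integrable (lebesgue_on {0<..}) (\<lambda>t. exp (- \<kappa> * t) * blinfun_apply (blinfun_apply (T t) x) v)"
    and "\<bar>LINT t|lebesgue_on {0<..}. exp (- \<kappa> * t) * blinfun_apply (blinfun_apply (T t) x) v\<bar> \<le> C * norm x * norm v / (\<kappa> - \<omega>)"
    using integrable_exp_bound[OF cont _ bound] \<kappa> by auto
qed

text \<open>The vector w is the integral of e^(-\<kappa> t) T(t)^* v, the resolvent of the adjoint
  semigroup at v, defined through its pairings; reflexivity places it in V.\<close>

lemma Laplace_representation:
  assumes growth: "\<And>t. 0 \<le> t \<Longrightarrow> norm (T t) \<le> C * exp (\<omega> * t)" and \<kappa>: "\<omega> < \<kappa>"
  shows "\<exists>w. \<forall>x. blinfun_apply x w = (LINT t|lebesgue_on {0<..}. exp (- \<kappa> * t) * blinfun_apply (blinfun_apply (T t) x) v)"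
proof -
  note int = Laplace_integrable(1)[OF growth \<kappa>]
  let ?F = "\<lambda>x. LINT t|lebesgue_on {0<..}. exp (- \<kappa> * t) * blinfun_apply (blinfun_apply (T t) x) v"
  have "bounded_linear ?F"
  proof (rule bounded_linear_intro)
    fix x y c
    show "?F (x + y) = ?F x + ?F y"
      using Bochner_Integration.integral_add[OF int[of x v] int[of y v]]
      by (simp add: blinfun.add_right blinfun.add_left distrib_left)
    show "?F (c *\<^sub>R x) = c *\<^sub>R ?F x"
      by (simp add: blinfun.scaleR_right blinfun.scaleR_left mult.left_commute)
    show "norm (?F x) \<le> norm x * (C * norm v / (\<kappa> - \<omega>))"
      using Laplace_integrable(2)[OF growth \<kappa>, of x v] by (simp add: mult_ac)
  qed
  from Hilbert_reflexive[OF this] show ?thesis by metis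
qed

text \<open>The integrand is the derivative of -e^(-\<kappa> t) <T(t) x, v>, and \<omega> < \<kappa>
  removes the boundary term at infinity.\<close>

lemma Laplace_generator:
  assumes gen: "is_generator T D G" and x: "x \<in> D"
    and growth: "\<And>t. 0 \<le> t \<Longrightarrow> norm (T t) \<le> C * exp (\<omega> * t)" and \<kappa>: "\<omega> < \<kappa>"
  shows "(LINT t|lebesgue_on {0<..}. exp (- \<kappa> * t) * blinfun_apply (blinfun_apply (T t) (\<kappa> *\<^sub>R x - G x)) v) = blinfun_apply x v"
proof -
  interpret c0_generator T D G by unfold_locales (rule gen)
  have "(LINT t|lebesgue_on {0<..}. exp (- \<kappa> * t) * blinfun_apply (blinfun_apply (T t) (\<kappa> *\<^sub>R x - G x)) v)
      = - (- exp (- \<kappa> * 0) * blinfun_apply (blinfun_apply (T 0) x) v)"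
  proof (rule FTC_Ioi)
    show "integrable (lebesgue_on {0<..}) (\<lambda>t. exp (- \<kappa> * t) * blinfun_apply (blinfun_apply (T t) (\<kappa> *\<^sub>R x - G x)) v)"
      by (rule Laplace_integrable(1)[OF growth \<kappa>])
    fix t :: real assume t: "0 \<le> t"
    have "((\<lambda>t. blinfun_apply (blinfun_apply (T t) x) v) has_vector_derivative blinfun_apply (blinfun_apply (T t) (G x)) v) (at t within {0..})"
      by (rule bounded_linear.has_vector_derivative[OF _ T_has_vector_derivative[OF x t]]) (intro bounded_linear_intros)
    then have "((\<lambda>t. blinfun_apply (blinfun_apply (T t) x) v) has_real_derivative blinfun_apply (blinfun_apply (T t) (G x)) v) (at t within {0..})"
      by (simp add: has_real_derivative_iff_has_vector_derivative)
    then show "((\<lambda>t. - exp (- \<kappa> * t) * blinfun_apply (blinfun_apply (T t) x) v) has_real_derivative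
        exp (- \<kappa> * t) * blinfun_apply (blinfun_apply (T t) (\<kappa> *\<^sub>R x - G x)) v) (at t within {0..})"
      by (auto intro!: derivative_eq_intros simp: blinfun.diff_right blinfun.diff_left blinfun.scaleR_right blinfun.scaleR_left algebra_simps)
  next
    have "((\<lambda>t. C * norm x * norm v * exp (- ((\<kappa> - \<omega>) * t))) \<longlongrightarrow> C * norm x * norm v * 0) at_top"
    proof (intro tendsto_intros)
      have "filterlim (\<lambda>t. - ((\<kappa> - \<omega>) * t)) at_bot at_top"
        using filterlim_tendsto_pos_mult_at_top[OF tendsto_const _ filterlim_ident, of "\<kappa> - \<omega>"] \<kappa>
        by (simp add: filterlim_uminus_at_bot)
      then show "((\<lambda>t. exp (- ((\<kappa> - \<omega>) * t))) \<longlongrightarrow> 0) at_top" by (rule filterlim_compose[OF exp_at_bot])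
    qed
    then have lim: "((\<lambda>t. C * norm x * norm v * exp (- ((\<kappa> - \<omega>) * t))) \<longlongrightarrow> 0) at_top" by simp
    show "((\<lambda>t. - exp (- \<kappa> * t) * blinfun_apply (blinfun_apply (T t) x) v) \<longlongrightarrow> 0) at_top"
    proof (rule Lim_null_comparison[OF _ lim])
      show "\<forall>\<^sub>F t in at_top. norm (- exp (- \<kappa> * t) * blinfun_apply (blinfun_apply (T t) x) v) \<le> C * norm x * norm v * exp (- ((\<kappa> - \<omega>) * t))"
        using eventually_ge_at_top[of 0]
      proof eventually_elim
        case (elim t)
        then show ?case using abs_Laplace_integrand_le[OF growth, of t \<kappa> x v]
          by (simp only: real_norm_def mult_minus_left abs_minus_cancel)
      qed
    qed
  qed
  then show ?thesis by simp
qed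

end

locale vintage_semigroup = age_spaces sbar \<mu> rH j + c0_generator T "dom_A j" "op_A sbar \<mu> rH j"
  for sbar :: ereal and \<mu> :: real
    and rH :: "'h::real_inner \<Rightarrow> real \<Rightarrow> real" and j :: "'v::{real_inner,complete_space} \<Rightarrow> 'h"
    and T :: "real \<Rightarrow> ('v \<Rightarrow>\<^sub>L real) \<Rightarrow>\<^sub>L ('v \<Rightarrow>\<^sub>L real)"
begin

sublocale dual_semigroup T by unfold_locales

text \<open>Pairing the Laplace transform with all elements of H turns the generator identity into
  an equation in H. Solvability of the resolvent equation thus follows from the existence of the
  semigroup, without solving a differential equation.\<close>

lemma resolvent_exists:
  assumes growth: "\<And>t. 0 \<le> t \<Longrightarrow> norm (T t) \<le> C * exp (\<omega> * t)" and \<kappa>: "\<omega> < \<kappa>"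
  obtains w where "\<And>x. blinfun_apply x w = (LINT t|lebesgue_on {0<..}. exp (- \<kappa> * t) * blinfun_apply (blinfun_apply (T t) x) v)"
    "A0 w = \<kappa> *\<^sub>R j w - j v"
proof -
  obtain w where w: "\<And>x. blinfun_apply x w = (LINT t|lebesgue_on {0<..}. exp (- \<kappa> * t) * blinfun_apply (blinfun_apply (T t) x) v)"
    using Laplace_representation[OF growth \<kappa>] by metis
  have "f \<bullet> (\<kappa> *\<^sub>R j w - A0 w) = f \<bullet> j v" for f
  proof -
    let ?x = "emb_H j f"
    have "?x \<in> dom_A j" by (simp add: dom_A_def)
    from Laplace_generator[OF gen this growth \<kappa>, of v]
    have "blinfun_apply (\<kappa> *\<^sub>R ?x - op_A sbar \<mu> rH j ?x) w = blinfun_apply ?x v" by (simp only: w)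
    then show ?thesis
      by (simp add: blinfun.diff_left blinfun.scaleR_left emb_H_apply op_A_apply inner_diff_right)
  qed
  then have "(\<kappa> *\<^sub>R j w - A0 w - j v) \<bullet> (\<kappa> *\<^sub>R j w - A0 w - j v) = 0"
    by (metis inner_diff_right right_minus_eq)
  then have "\<kappa> *\<^sub>R j w - A0 w - j v = 0" by simp
  then have "A0 w = \<kappa> *\<^sub>R j w - j v" by (simp add: algebra_simps)
  with w that show thesis by blast
qed

text \<open>Accretivity bounds the resolvent of \<open>A\<^sub>0\<^sup>*\<close> on \<open>V\<close>; dualised, this is the dissipativity of
  \<open>A + \<mu>\<close> on \<open>V'\<close>.\<close>

theorem T_decay:
  assumes "0 \<le> t"
  shows "norm (T t) \<le> exp (- \<mu> * t)"
proof -
  obtain C \<omega> where C: "1 \<le> C" "0 \<le> \<omega>" and growth: "\<And>t. 0 \<le> t \<Longrightarrow> norm (T t) \<le> C * exp (\<omega> * t)"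
    by (rule exponential_growth) blast
  show ?thesis
  proof (rule exponential_decay[of \<omega>, OF _ assms])
    fix \<kappa> x assume \<kappa>: "\<omega> < \<kappa>" and x: "x \<in> dom_A j"
    have pos: "0 < \<kappa> + \<mu>" using \<kappa> C mu_pos by simp
    let ?y = "\<kappa> *\<^sub>R x - op_A sbar \<mu> rH j x"
    have "norm x \<le> norm ?y / (\<kappa> + \<mu>)"
    proof (rule norm_blinfun_bound)
      show "0 \<le> norm ?y / (\<kappa> + \<mu>)" using pos by simp
      fix v
      obtain w where w: "\<And>x. blinfun_apply x w = (LINT t|lebesgue_on {0<..}. exp (- \<kappa> * t) * blinfun_apply (blinfun_apply (T t) x) v)"
        "A0 w = \<kappa> *\<^sub>R j w - j v"
        by (rule resolvent_exists[OF growth \<kappa>]) auto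
      have "blinfun_apply x v = blinfun_apply ?y w"
        using Laplace_generator[OF gen x growth \<kappa>, of v] by (simp only: w)
      then have "norm (blinfun_apply x v) \<le> norm ?y * norm w" by (simp add: norm_blinfun del: real_norm_def)
      also have "\<dots> \<le> norm ?y * (norm v / (\<kappa> + \<mu>))"
        using resolvent_bound[OF w(2) pos] pos by (intro mult_left_mono) (auto simp: field_simps)
      finally show "norm (blinfun_apply x v) \<le> norm ?y / (\<kappa> + \<mu>) * norm v" by simp
    qed
    then show "(\<kappa> + \<mu>) * norm x \<le> norm ?y" using pos by (simp add: field_simps)
  qed
qed

lemma T_contraction: "0 \<le> t \<Longrightarrow> norm (T t) \<le> 1"
  using T_decay[of t] mu_pos by (auto intro: order_trans)

lemma T_fixed_imp_zero:
  assumes "blinfun_apply (T 1) z = z"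
  shows "z = 0"
proof (rule ccontr)
  assume "z \<noteq> 0"
  have "norm z \<le> norm (T 1) * norm z" using norm_blinfun[of "T 1" z] assms by simp
  also have "\<dots> \<le> exp (- \<mu>) * norm z" using T_decay[of 1] by (intro mult_right_mono) auto
  also have "\<dots> < 1 * norm z" using \<open>z \<noteq> 0\<close> mu_pos by (intro mult_strict_right_mono) auto
  finally show False by simp
qed

text \<open>On the domain T(1) x - x is determined by A x, so the difference of two solutions is
  fixed by the strict contraction T(1).\<close>

lemma op_A_inj:
  assumes "x \<in> dom_A j" "y \<in> dom_A j" "op_A sbar \<mu> rH j x = op_A sbar \<mu> rH j y"
  shows "x = y"
proof -
  have "blinfun_apply (T 1) x - x = blinfun_apply (T 1) y - y"
    using orbit_integral_generator[of x 1] orbit_integral_generator[of y 1] assms by simp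
  then have "blinfun_apply (T 1) (x - y) = x - y" by (simp add: blinfun.diff_right algebra_simps)
  then show ?thesis using T_fixed_imp_zero by fastforce
qed

text \<open>The solution of \<open>A x = -y\<close> is \<open>x = \<integral>\<^sub>0\<^sup>\<infinity> T(s) y ds\<close>, characterised here as the
  fixed point of \<open>x = \<integral>\<^sub>0\<^sup>1 T(s) y ds + T(1) x\<close>.\<close>

lemma op_A_surj: "\<exists>x\<in>dom_A j. op_A sbar \<mu> rH j x = - y"
proof -
  have "\<exists>!x. orbit_integral 1 y + blinfun_apply (T 1) x = x"
  proof (rule banach_fix_type)
    show "exp (- \<mu>) < 1" using mu_pos by simp
    show "\<forall>x z. dist (orbit_integral 1 y + blinfun_apply (T 1) x)
        (orbit_integral 1 y + blinfun_apply (T 1) z) \<le> exp (- \<mu>) * dist x z"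
    proof (intro allI)
      fix x z
      have "norm (blinfun_apply (T 1) (x - z)) \<le> norm (T 1) * norm (x - z)" by (rule norm_blinfun)
      also have "\<dots> \<le> exp (- \<mu>) * norm (x - z)" using T_decay[of 1] by (intro mult_right_mono) auto
      finally show "dist (orbit_integral 1 y + blinfun_apply (T 1) x)
        (orbit_integral 1 y + blinfun_apply (T 1) z) \<le> exp (- \<mu>) * dist x z"
        by (simp add: dist_norm blinfun.diff_right)
    qed
  qed simp
  then obtain x where x: "orbit_integral 1 y + blinfun_apply (T 1) x = x" by blast
  \<comment> \<open>The identity is known at time 1 only. Its defect \<open>?z\<close> at time h is
    fixed by T(1), because T(1) commutes with the semigroup and with orbit integration, and so it
    vanishes.\<close>
  have shift: "blinfun_apply (T h) x - x = - orbit_integral h y" if h: "0 \<le> h" for h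
  proof -
    let ?z = "blinfun_apply (T h) x - x + orbit_integral h y"
    have T1x: "blinfun_apply (T 1) x = x - orbit_integral 1 y" using x by (simp add: algebra_simps)
    have comm: "blinfun_apply (T 1) (blinfun_apply (T h) x) = blinfun_apply (T h) (blinfun_apply (T 1) x)"
      using T_add[of 1 h x] T_add[of h 1 x] h by (simp add: add.commute)
    have "blinfun_apply (T 1) ?z = ?z"
      using T_orbit_integral(1)[of h 1 y] T_orbit_integral(1)[of 1 h y] h
      by (simp add: blinfun.diff_right blinfun.add_right comm T1x add.commute)
    from T_fixed_imp_zero[OF this] show ?thesis by (simp add: algebra_simps eq_neg_iff_add_eq_0)
  qed
  have "((\<lambda>h. - ((orbit_integral (0 + h) y - orbit_integral 0 y) /\<^sub>R h)) \<longlongrightarrow> - blinfun_apply (T 0) y) (at_right 0)"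
    by (intro tendsto_minus orbit_integral_right_quotient) simp
  moreover have "\<forall>\<^sub>F h in at_right 0. - ((orbit_integral (0 + h) y - orbit_integral 0 y) /\<^sub>R h) = (blinfun_apply (T h) x - x) /\<^sub>R h"
    using eventually_at_right_less[of "0::real"]
  proof eventually_elim
    case (elim h)
    then show ?case using shift[of h] by (simp add: orbit_integral_def)
  qed
  ultimately have "((\<lambda>h. (blinfun_apply (T h) x - x) /\<^sub>R h) \<longlongrightarrow> - blinfun_apply (T 0) y) (at_right 0)"
    by (rule Lim_transform_eventually)
  from generatorI[OF this] show ?thesis by auto
qed

text \<open>The integrated input cancels the drift T(t) x - x. In this mild form the equilibrium
  equation enters the control problem.\<close>

lemma stationary_orbit:
  assumes "x \<in> dom_A j" "op_A sbar \<mu> rH j x + y = 0" "0 \<le> t"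
  shows "blinfun_apply (T t) x + orbit_integral t y = x"
proof -
  have "op_A sbar \<mu> rH j x = - y" using assms(2) by (simp add: eq_neg_iff_add_eq_0)
  moreover have "orbit_integral t (- y) = - orbit_integral t y"
    by (simp add: orbit_integral_def blinfun.minus_right)
  ultimately have "- orbit_integral t y = blinfun_apply (T t) x - x"
    using orbit_integral_generator[OF assms(1,3)] by simp
  then show ?thesis by (simp add: algebra_simps minus_equation_iff)
qed

end

section \<open>Extended-real integrals and controls on the half line\<close>

abbreviation half_line :: "real measure" where "half_line \<equiv> lebesgue_on {0<..}"

text \<open>Required for Fubini's theorem in the double integral of the convolution.\<close>

lemma sigma_finite_half_line: "sigma_finite_measure half_line"
proof -
  have "sigma_finite_measure (lebesgue :: real measure)"
  proof
    let ?A = "range (\<lambda>n::nat. {- real n..real n})"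
    have "\<exists>n::nat. x \<in> {- real n..real n}" for x :: real
    proof -
      obtain n :: nat where "\<bar>x\<bar> \<le> real n" using real_arch_simple by blast
      then have "x \<in> {- real n..real n}" by auto
      then show ?thesis by blast
    qed
    then have "\<Union>?A = space lebesgue" by auto
    moreover have "emeasure lebesgue {- real n..real n} \<noteq> \<infinity>" for n
      using fmeasurableD2[OF lmeasurable_interval(1)] by simp
    ultimately show "\<exists>A. countable A \<and> A \<subseteq> sets lebesgue \<and> \<Union>A = space (lebesgue :: real measure) \<and> (\<forall>a\<in>A. emeasure lebesgue a \<noteq> \<infinity>)"
      by (intro exI[of _ ?A] conjI) auto
  qed
  then show ?thesis by (intro sigma_finite_measure_restrict_space) auto
qed

section \<open>Integrals with values in the extended reals\<close>

lemma ext_integral_real: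
  assumes "integrable M f"
  shows "ext_integral M (\<lambda>x. ereal (f x)) = ereal (\<integral>x. f x \<partial>M)"
proof -
  have 1: "(\<integral>\<^sup>+ x. ennreal (f x) \<partial>M) < \<infinity>" "(\<integral>\<^sup>+ x. ennreal (- f x) \<partial>M) < \<infinity>"
    using real_integrable_def[of M f] assms by (auto simp: top.not_eq_extremum)
  then have "enn2ereal (\<integral>\<^sup>+ x. ennreal (f x) \<partial>M) = ereal (enn2real (\<integral>\<^sup>+ x. ennreal (f x) \<partial>M))"
    "enn2ereal (\<integral>\<^sup>+ x. ennreal (- f x) \<partial>M) = ereal (enn2real (\<integral>\<^sup>+ x. ennreal (- f x) \<partial>M))"
    by (auto simp: enn2ereal_ennreal[symmetric] simp del: enn2ereal_ennreal)
  then show ?thesis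
    by (simp add: ext_integral_def real_lebesgue_integral_def[OF assms])
qed

lemma ext_integral_mono:
  assumes "AE x in M. f x \<le> g x"
  shows "ext_integral M f \<le> ext_integral M g"
proof -
  have "(\<integral>\<^sup>+ x. e2ennreal (f x) \<partial>M) \<le> (\<integral>\<^sup>+ x. e2ennreal (g x) \<partial>M)"
    using assms by (intro nn_integral_mono_AE) (auto elim!: eventually_mono intro: e2ennreal_mono)
  moreover have "(\<integral>\<^sup>+ x. e2ennreal (- g x) \<partial>M) \<le> (\<integral>\<^sup>+ x. e2ennreal (- f x) \<partial>M)"
    using assms by (intro nn_integral_mono_AE) (auto elim!: eventually_mono intro: e2ennreal_mono)
  ultimately show ?thesis
    unfolding ext_integral_def by (intro ereal_minus_mono) (auto simp: less_eq_ennreal.rep_eq)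
qed

lemma ext_integral_cong:
  assumes "AE x in M. f x = g x"
  shows "ext_integral M f = ext_integral M g"
  using assms by (intro antisym ext_integral_mono) (auto elim: eventually_mono)

text \<open>A finite value excludes an infinite positive part, since infinity minus anything is
  infinity here, and then an infinite negative part, which would give minus infinity.\<close>

lemma ext_integral_finite:
  assumes f: "f \<in> borel_measurable M" and fin: "\<bar>ext_integral M f\<bar> \<noteq> \<infinity>"
  obtains f' where "integrable M f'" "AE x in M. f x = ereal (f' x)" "ext_integral M f = ereal (\<integral>x. f' x \<partial>M)"
proof -
  let ?P = "\<integral>\<^sup>+ x. e2ennreal (f x) \<partial>M" and ?N = "\<integral>\<^sup>+ x. e2ennreal (- f x) \<partial>M"
  have P: "?P \<noteq> \<infinity>" using fin unfolding ext_integral_def by (intro notI) simp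
  have N: "?N \<noteq> \<infinity>"
  proof
    assume "?N = \<infinity>"
    moreover have "enn2ereal ?P \<noteq> \<infinity>" using P by (metis e2ennreal_enn2ereal e2ennreal_infty infinity_ennreal_def)
    ultimately have "ext_integral M f = - \<infinity>" unfolding ext_integral_def
      by (cases "enn2ereal ?P") auto
    then show False using fin by simp
  qed
  have meas: "(\<lambda>x. e2ennreal (f x)) \<in> borel_measurable M" "(\<lambda>x. e2ennreal (- f x)) \<in> borel_measurable M"
    using f by measurable
  have "AE x in M. e2ennreal (f x) \<noteq> \<infinity>" "AE x in M. e2ennreal (- f x) \<noteq> \<infinity>"
    using nn_integral_PInf_AE[OF meas(1)] nn_integral_PInf_AE[OF meas(2)] P N by auto
  then have AE: "AE x in M. f x = ereal (real_of_ereal (f x))"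
  proof eventually_elim
    case (elim x)
    then show ?case by (cases "f x") auto
  qed
  have "integrable M (\<lambda>x. real_of_ereal (f x))"
    unfolding real_integrable_def
  proof (intro conjI)
    show "(\<lambda>x. real_of_ereal (f x)) \<in> borel_measurable M" using f by measurable
    have "(\<integral>\<^sup>+ x. ennreal (real_of_ereal (f x)) \<partial>M) = ?P"
      by (rule nn_integral_cong_AE) (use AE in \<open>auto elim!: eventually_mono; metis e2ennreal_ereal\<close>)
    then show "(\<integral>\<^sup>+ x. ennreal (real_of_ereal (f x)) \<partial>M) \<noteq> \<infinity>" using P by simp
    have "(\<integral>\<^sup>+ x. ennreal (- real_of_ereal (f x)) \<partial>M) = ?N"
      by (rule nn_integral_cong_AE) (use AE in \<open>auto elim!: eventually_mono; metis e2ennreal_ereal uminus_ereal.simps(1)\<close>)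
    then show "(\<integral>\<^sup>+ x. ennreal (- real_of_ereal (f x)) \<partial>M) \<noteq> \<infinity>" using N by simp
  qed
  moreover have "ext_integral M f = ereal (\<integral>x. real_of_ereal (f x) \<partial>M)"
    using ext_integral_cong[OF AE] ext_integral_real[OF calculation] by simp
  ultimately show ?thesis using AE that by blast
qed

section \<open>Translating and splitting integrals over the half line\<close>

lemma lebesgue_translate_measurable: "(\<lambda>x. t + x) \<in> lebesgue \<rightarrow>\<^sub>M (lebesgue :: real measure)"
  using lebesgue_affine_measurable[of "\<lambda>_. 1" t] by simp

lemma lebesgue_distr_translate: "distr lebesgue lebesgue (\<lambda>x. t + x) = (lebesgue :: real measure)"
  using lebesgue_real_affine[of 1 t] by (simp add: density_1)

lemma half_line_translate_measurable:
  assumes "0 \<le> t"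
  shows "(\<lambda>x. t + x) \<in> half_line \<rightarrow>\<^sub>M half_line"
  by (intro measurable_restrict_space3 lebesgue_translate_measurable) (use assms in auto)

lemma half_line_AE_translate:
  assumes "AE x in half_line. P x" "0 \<le> t"
  shows "AE x in half_line. P (t + x)"
proof -
  have "AE x in lebesgue. x \<in> {0<..} \<longrightarrow> P x" using assms(1) by (simp add: AE_restrict_space_iff)
  then have "AE x in distr lebesgue lebesgue (\<lambda>x. t + x). x \<in> {0<..} \<longrightarrow> P x"
    by (simp only: lebesgue_distr_translate)
  then have "AE x in lebesgue. t + x \<in> {0<..} \<longrightarrow> P (t + x)"
    by (rule AE_distrD[OF lebesgue_translate_measurable])
  then have "AE x in lebesgue. x \<in> {0<..} \<longrightarrow> P (t + x)"
    by eventually_elim (use assms(2) in auto)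
  then show ?thesis by (simp add: AE_restrict_space_iff)
qed

lemma half_line_integral_translate:
  fixes f :: "real \<Rightarrow> real"
  assumes f: "f \<in> borel_measurable half_line" and "0 \<le> t"
  shows "integrable half_line (\<lambda>x. f (t + x)) \<longleftrightarrow> integrable half_line (\<lambda>x. indicator {t<..} x * f x)"
    and "(LINT x|half_line. f (t + x)) = (LINT x|half_line. indicator {t<..} x * f x)"
proof -
  define g where "g x = indicator {0<..} x * (indicator {t<..} x * f x)" for x
  have shift: "indicator {0<..} x * f (t + x) = g (t + x)" for x
    using \<open>0 \<le> t\<close> by (auto simp: g_def indicator_def)
  have "(\<lambda>x. if x \<in> {0<..} then f x else 0) \<in> borel_measurable lebesgue"
    using f by (subst borel_measurable_if) auto
  moreover have "g = (\<lambda>x. indicator {t<..} x * (if x \<in> {0<..} then f x else 0))"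
    by (auto simp: g_def indicator_def)
  moreover have "(indicator {t<..} :: real \<Rightarrow> real) \<in> borel_measurable lebesgue"
    by (intro borel_measurable_indicator) auto
  ultimately have g: "g \<in> borel_measurable lebesgue" by (simp only: borel_measurable_times)
  have "integrable lebesgue (\<lambda>x. g (t + x)) \<longleftrightarrow> integrable (distr lebesgue lebesgue (\<lambda>x. t + x)) g"
    by (rule integrable_distr_eq[OF lebesgue_translate_measurable g, symmetric])
  then show "integrable half_line (\<lambda>x. f (t + x)) \<longleftrightarrow> integrable half_line (\<lambda>x. indicator {t<..} x * f x)"
    by (simp add: integrable_restrict_space lebesgue_distr_translate shift g_def[symmetric])
  have "(LINT x|lebesgue. g (t + x)) = (LINT x|distr lebesgue lebesgue (\<lambda>x. t + x). g x)"
    by (rule integral_distr[OF lebesgue_translate_measurable g, symmetric])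
  then show "(LINT x|half_line. f (t + x)) = (LINT x|half_line. indicator {t<..} x * f x)"
    by (simp add: integral_restrict_space lebesgue_distr_translate shift g_def[symmetric])
qed

lemma half_line_integral_delay:
  fixes g :: "real \<Rightarrow> real"
  assumes g: "integrable half_line g" and "0 \<le> t"
  shows "integrable half_line (\<lambda>x. indicator {t<..} x * g (x - t))"
    and "(LINT x|half_line. indicator {t<..} x * g (x - t)) = (LINT x|half_line. g x)"
proof -
  define h where "h x = indicator {t<..} x * g (x - t)" for x
  have "(\<lambda>x. if x \<in> {0<..} then g x else 0) \<in> borel_measurable lebesgue"
    using g by (subst borel_measurable_if) auto
  then have "(\<lambda>x. if - t + x \<in> {0<..} then g (- t + x) else 0) \<in> borel_measurable lebesgue"
    by (rule measurable_compose[OF lebesgue_translate_measurable])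
  moreover have "h = (\<lambda>x. if - t + x \<in> {0<..} then g (- t + x) else 0)"
    by (auto simp: h_def indicator_def fun_eq_iff)
  ultimately have h: "h \<in> borel_measurable half_line" by (auto intro: measurable_restrict_space1)
  have 1: "indicator {t<..} x * h x = h x" for x by (simp add: h_def indicator_def)
  have 2: "integrable half_line (\<lambda>x. h (t + x)) \<longleftrightarrow> integrable half_line g"
    by (rule Bochner_Integration.integrable_cong) (auto simp: h_def)
  have 3: "(LINT x|half_line. h (t + x)) = (LINT x|half_line. g x)"
    by (rule Bochner_Integration.integral_cong) (auto simp: h_def)
  show "integrable half_line (\<lambda>x. indicator {t<..} x * g (x - t))"
    using half_line_integral_translate(1)[OF h \<open>0 \<le> t\<close>] 2 g unfolding 1 by (simp add: h_def[symmetric])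
  show "(LINT x|half_line. indicator {t<..} x * g (x - t)) = (LINT x|half_line. g x)"
    using half_line_integral_translate(2)[OF h \<open>0 \<le> t\<close>] 3 unfolding 1 by (simp add: h_def[symmetric])
qed

lemma half_line_id [measurable]: "(\<lambda>x. x) \<in> borel_measurable half_line"
  by (intro measurable_restrict_space1 measurable_completion) simp

lemma half_line_integral_split:
  fixes f :: "real \<Rightarrow> real"
  assumes f: "integrable half_line f" and "0 \<le> t"
  shows "integrable half_line (\<lambda>x. indicator {..<t} x * f x)" "integrable half_line (\<lambda>x. indicator {t<..} x * f x)"
    and "(LINT x|half_line. f x) = (LINT x|half_line. indicator {..<t} x * f x) + (LINT x|half_line. indicator {t<..} x * f x)"
proof -
  have [measurable]: "f \<in> borel_measurable half_line" using f by (rule borel_measurable_integrable)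
  show 1: "integrable half_line (\<lambda>x. indicator {..<t} x * f x)"
  proof (rule Bochner_Integration.integrable_bound[OF f])
    show "(\<lambda>x. indicator {..<t} x * f x) \<in> borel_measurable half_line" by measurable
  qed (auto simp: indicator_def)
  show 2: "integrable half_line (\<lambda>x. indicator {t<..} x * f x)"
  proof (rule Bochner_Integration.integrable_bound[OF f])
    show "(\<lambda>x. indicator {t<..} x * f x) \<in> borel_measurable half_line" by measurable
  qed (auto simp: indicator_def)
  have "AE x in lebesgue. x \<noteq> t" by (simp add: AE_completion AE_lborel_singleton)
  then have "AE x in half_line. x \<noteq> t" by (auto simp: AE_restrict_space_iff elim: eventually_mono)
  then have "AE x in half_line. f x = indicator {..<t} x * f x + indicator {t<..} x * f x"
    by eventually_elim (auto simp: indicator_def)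
  then have "(LINT x|half_line. f x) = (LINT x|half_line. indicator {..<t} x * f x + indicator {t<..} x * f x)"
    by (intro integral_cong_AE) (use 1 2 in auto)
  then show "(LINT x|half_line. f x) = (LINT x|half_line. indicator {..<t} x * f x) + (LINT x|half_line. indicator {t<..} x * f x)"
    using 1 2 by simp
qed

lemma lebesgue_on_Icc_eq_half_line:
  fixes f :: "real \<Rightarrow> real"
  assumes int: "integrable half_line (\<lambda>x. indicator {..<t} x * f x)"
  shows "(LINT x|lebesgue_on {0..t}. f x) = (LINT x|half_line. indicator {..<t} x * f x)"
proof -
  have eq: "indicator {0<..} x *\<^sub>R (indicator {..<t} x * f x) = indicator {0<..<t} x *\<^sub>R f x" for x
    by (auto simp: indicator_def)
  have 1: "f absolutely_integrable_on {0<..<t}"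
  proof -
    have "integrable lebesgue (\<lambda>x. indicator {0<..} x *\<^sub>R (indicator {..<t} x * f x))"
      using int by (subst (asm) integrable_restrict_space) auto
    then show ?thesis unfolding set_integrable_def eq .
  qed
  have spike: "negligible {x \<in> {0..t} - {0<..<t}. f x \<noteq> 0}" "negligible {x \<in> {0<..<t} - {0..t}. f x \<noteq> 0}"
    by (rule negligible_subset[of "{0, t}"]; auto)+
  have 2: "f absolutely_integrable_on {0..t}"
    using 1 absolutely_integrable_spike_set_eq[OF spike] by blast
  have "(LINT x|lebesgue_on {0..t}. f x) = integral {0..t} f" using 2 by (intro integral_lebesgue_on_eq) auto
  also have "\<dots> = integral {0<..<t} f"
    using spike by (intro integral_spike_set) auto
  also have "\<dots> = (LINT x|lebesgue_on {0<..<t}. f x)" using 1 by (intro integral_lebesgue_on_eq[symmetric]) auto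
  also have "\<dots> = (LINT x|half_line. indicator {..<t} x * f x)"
  proof -
    have "(LINT x|half_line. indicator {..<t} x * f x) = (LINT x|lebesgue. indicator {0<..} x *\<^sub>R (indicator {..<t} x * f x))"
      by (subst integral_restrict_space) auto
    also have "\<dots> = (LINT x|lebesgue_on {0<..<t}. f x)" unfolding eq by (subst integral_restrict_space) auto
    finally show ?thesis by (rule sym)
  qed
  finally show "(LINT x|lebesgue_on {0..t}. f x) = (LINT x|half_line. indicator {..<t} x * f x)" .
qed

section \<open>Controls in the weighted L^p space\<close>

lemma Lp_controls_weighted_L1:
  assumes u: "u \<in> Lp_controls p lam" and "0 < lam" "1 \<le> p"
  shows "u \<in> borel_measurable half_line" "integrable half_line (\<lambda>\<tau>. exp (- lam * \<tau>) * norm (u \<tau>))"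
proof -
  show meas: "u \<in> borel_measurable half_line" using u by (simp add: Lp_controls_def)
  show "integrable half_line (\<lambda>\<tau>. exp (- lam * \<tau>) * norm (u \<tau>))"
  proof (rule Bochner_Integration.integrable_bound)
    show "integrable half_line (\<lambda>\<tau>. exp (- lam * \<tau>) + norm (exp (- lam * \<tau> / p) *\<^sub>R u \<tau>) powr p)"
      using u integrable_exp_Ioi(1)[OF \<open>0 < lam\<close>] by (simp add: Lp_controls_def)
    have "(\<lambda>\<tau>. exp (- lam * \<tau>)) \<in> borel_measurable half_line"
      using integrable_exp_Ioi(1)[OF \<open>0 < lam\<close>] by auto
    then show "(\<lambda>\<tau>. exp (- lam * \<tau>) * norm (u \<tau>)) \<in> borel_measurable half_line" using meas by measurable
    \<comment> \<open>The weight is itself integrable, so integrability of the p-th power gives that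
      of the first power.\<close>
    have "x \<le> 1 + x powr p" if "0 \<le> x" for x :: real
    proof (cases "x \<le> 1")
      case False
      then have "x powr 1 \<le> x powr p" using \<open>1 \<le> p\<close> by (intro powr_mono) auto
      then show ?thesis using False by simp
    qed (use powr_ge_zero[of x p] in linarith)
    then have "exp (- lam * \<tau>) * norm (u \<tau>) \<le> exp (- lam * \<tau>) * (1 + norm (u \<tau>) powr p)" for \<tau>
      by (intro mult_left_mono) auto
    moreover have "norm (exp (- lam * \<tau> / p) *\<^sub>R u \<tau>) powr p = exp (- lam * \<tau>) * norm (u \<tau>) powr p" for \<tau>
      using \<open>1 \<le> p\<close> by (simp add: powr_mult exp_powr_real)
    ultimately show "AE \<tau> in half_line. norm (exp (- lam * \<tau>) * norm (u \<tau>)) \<le>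
        norm (exp (- lam * \<tau>) + norm (exp (- lam * \<tau> / p) *\<^sub>R u \<tau>) powr p)"
      by (intro AE_I2) (simp add: distrib_left)
  qed
qed

lemma Lp_controls_const:
  assumes "0 < lam" "1 \<le> p"
  shows "(\<lambda>_. c) \<in> Lp_controls p lam"
proof -
  have "norm (exp (- lam * \<tau> / p) *\<^sub>R c) powr p = norm c powr p * exp (- lam * \<tau>)" for \<tau>
    using \<open>1 \<le> p\<close> by (simp add: powr_mult exp_powr_real)
  then show ?thesis
    using integrable_exp_Ioi(1)[OF \<open>0 < lam\<close>] by (simp add: Lp_controls_def)
qed

lemma Lp_controls_translate:
  assumes u: "u \<in> Lp_controls p lam" and "0 \<le> t" "1 \<le> p"
  shows "(\<lambda>\<tau>. u (t + \<tau>)) \<in> Lp_controls p lam"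
proof -
  have meas: "u \<in> borel_measurable half_line"
    and int: "integrable half_line (\<lambda>\<tau>. norm (exp (- lam * \<tau> / p) *\<^sub>R u \<tau>) powr p)"
    using u by (auto simp: Lp_controls_def)
  have "integrable half_line (\<lambda>\<tau>. indicator {t<..} \<tau> *\<^sub>R norm (exp (- lam * \<tau> / p) *\<^sub>R u \<tau>) powr p)"
  proof (rule integrable_mult_indicator[OF _ int])
    show "{t<..} \<in> sets half_line" using \<open>0 \<le> t\<close> by (subst sets_restrict_space_iff) auto
  qed
  then have "integrable half_line (\<lambda>\<tau>. norm (exp (- lam * (t + \<tau>) / p) *\<^sub>R u (t + \<tau>)) powr p)"
    using half_line_integral_translate(1)[OF borel_measurable_integrable[OF int] \<open>0 \<le> t\<close>] by simp
  then have "integrable half_line (\<lambda>\<tau>. exp (lam * t) * norm (exp (- lam * (t + \<tau>) / p) *\<^sub>R u (t + \<tau>)) powr p)"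
    by (rule integrable_mult_right)
  moreover have eq: "exp (lam * t) * norm (exp (- lam * (t + \<tau>) / p) *\<^sub>R u (t + \<tau>)) powr p =
      norm (exp (- lam * \<tau> / p) *\<^sub>R u (t + \<tau>)) powr p" for \<tau>
  proof -
    have "exp (lam * t) * exp (- lam * (t + \<tau>)) = exp (- lam * \<tau>)" by (simp add: mult_exp_exp algebra_simps)
    moreover have "- (lam * (t + \<tau>)) / p * p = - lam * (t + \<tau>)" using \<open>1 \<le> p\<close> by simp
    ultimately show ?thesis using \<open>1 \<le> p\<close>
      by (simp add: powr_mult exp_powr_real mult.assoc[symmetric])
  qed
  ultimately have "integrable half_line (\<lambda>\<tau>. norm (exp (- lam * \<tau> / p) *\<^sub>R u (t + \<tau>)) powr p)"
    by (simp only: eq)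
  then show ?thesis
    using measurable_compose[OF half_line_translate_measurable[OF \<open>0 \<le> t\<close>] meas]
    unfolding Lp_controls_def by blast
qed

lemma Lp_controls_convex:
  assumes "u \<in> Lp_controls p lam" "v \<in> Lp_controls p lam" "0 \<le> s" "s \<le> 1" "1 \<le> p"
  shows "(\<lambda>\<tau>. (1 - s) *\<^sub>R u \<tau> + s *\<^sub>R (v \<tau> :: 'u::{real_normed_vector,second_countable_topology})) \<in> Lp_controls p lam"
proof -
  let ?e = "\<lambda>\<tau>. exp (- lam * \<tau> / p)"
  have meas: "u \<in> borel_measurable half_line" "v \<in> borel_measurable half_line"
    and int: "integrable half_line (\<lambda>\<tau>. norm (?e \<tau> *\<^sub>R u \<tau>) powr p)" "integrable half_line (\<lambda>\<tau>. norm (?e \<tau> *\<^sub>R v \<tau>) powr p)"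
    using assms by (auto simp: Lp_controls_def)
  let ?w = "\<lambda>\<tau>. (1 - s) *\<^sub>R u \<tau> + s *\<^sub>R v \<tau>"
  have w: "?w \<in> borel_measurable half_line" using meas by measurable
  have e: "?e \<in> borel_measurable half_line"
    by (rule continuous_imp_measurable_on_sets_lebesgue) (auto intro!: continuous_intros simp: divide_inverse)
  have "integrable half_line (\<lambda>\<tau>. norm (?e \<tau> *\<^sub>R ?w \<tau>) powr p)"
  proof (rule Bochner_Integration.integrable_bound)
    show "integrable half_line (\<lambda>\<tau>. norm (?e \<tau> *\<^sub>R u \<tau>) powr p + norm (?e \<tau> *\<^sub>R v \<tau>) powr p)"
      using int by simp
    show "(\<lambda>\<tau>. norm (?e \<tau> *\<^sub>R ?w \<tau>) powr p) \<in> borel_measurable half_line"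
      using w e by measurable
    have "norm (?e \<tau> *\<^sub>R ?w \<tau>) powr p \<le> norm (?e \<tau> *\<^sub>R u \<tau>) powr p + norm (?e \<tau> *\<^sub>R v \<tau>) powr p" for \<tau>
    proof -
      \<comment> \<open>A convex combination is no longer than the longer of the two vectors, so the
        power of its norm is at most the sum of the two powers.\<close>
      let ?m = "max (norm (u \<tau>)) (norm (v \<tau>))"
      have "norm (?w \<tau>) \<le> (1 - s) * norm (u \<tau>) + s * norm (v \<tau>)"
        using norm_triangle_ineq[of "(1 - s) *\<^sub>R u \<tau>" "s *\<^sub>R v \<tau>"] assms by simp
      also have "\<dots> \<le> (1 - s) * ?m + s * ?m"
        using assms by (intro add_mono mult_left_mono) auto
      also have "\<dots> = ?m" by (simp add: algebra_simps)
      finally have "norm (?e \<tau> *\<^sub>R ?w \<tau>) \<le> norm (?e \<tau> *\<^sub>R u \<tau>) \<or> norm (?e \<tau> *\<^sub>R ?w \<tau>) \<le> norm (?e \<tau> *\<^sub>R v \<tau>)"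
        unfolding norm_scaleR max_def by (cases "norm (u \<tau>) \<le> norm (v \<tau>)") (simp_all add: mult_left_mono)
      then have "norm (?e \<tau> *\<^sub>R ?w \<tau>) powr p \<le> norm (?e \<tau> *\<^sub>R u \<tau>) powr p \<or>
          norm (?e \<tau> *\<^sub>R ?w \<tau>) powr p \<le> norm (?e \<tau> *\<^sub>R v \<tau>) powr p"
        using \<open>1 \<le> p\<close> by (elim disjE) (auto intro: powr_mono2)
      then show ?thesis
        using powr_ge_zero[of "norm (?e \<tau> *\<^sub>R u \<tau>)" p] powr_ge_zero[of "norm (?e \<tau> *\<^sub>R v \<tau>)" p] by linarith
    qed
    then show "AE \<tau> in half_line. norm (norm (?e \<tau> *\<^sub>R ?w \<tau>) powr p) \<le>
        norm (norm (?e \<tau> *\<^sub>R u \<tau>) powr p + norm (?e \<tau> *\<^sub>R v \<tau>) powr p)"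
      by (intro AE_I2) simp
  qed
  with w show ?thesis by (simp add: Lp_controls_def)
qed

lemma lower_semicont_borel_measurable:
  assumes "lower_semicont h"
  shows "h \<in> borel_measurable borel"
proof (rule borel_measurableI_greater)
  fix r
  have "open {x. r < h x}"
    unfolding open_subopen[of "{x. r < h x}"]
  proof
    fix x assume "x \<in> {x. r < h x}"
    then have "eventually (\<lambda>y. r < h y) (nhds x)" using assms by (simp add: lower_semicont_def)
    then show "\<exists>S. open S \<and> x \<in> S \<and> S \<subseteq> {x. r < h x}" unfolding eventually_nhds by blast
  qed
  then show "{x \<in> space borel. r < h x} \<in> sets borel" by simp
qed

section \<open>The controlled trajectory\<close>

text \<open>The control argument is separated from the age structure by an abstract input space.
  \<open>hs\<close> and \<open>G\<close> stand for the conjugate of \<open>h0\<close> and its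
  gradient, so that \<open>h0_lower\<close> is strong convexity with constant \<open>c\<close> and
  \<open>h0_attained\<close> is Fenchel equality; \<open>K\<close> comes from a Lipschitz constant
  of R', and \<open>\<pi>\<close> is the discounted resolvent of the adjoint semigroup at
  \<open>\<alpha>\<close>.\<close>

locale control_problem = dual_semigroup T
  for T :: "real \<Rightarrow> ('v::{real_inner,complete_space} \<Rightarrow>\<^sub>L real) \<Rightarrow>\<^sub>L ('v \<Rightarrow>\<^sub>L real)" +
  fixes Bs :: "'v \<Rightarrow> 'u::{real_inner,complete_space,second_countable_topology}"
    and B :: "'u \<Rightarrow> 'v \<Rightarrow>\<^sub>L real"
    and \<alpha> \<pi> :: 'v and R R' :: "real \<Rightarrow> real"
    and h0 :: "'u \<Rightarrow> ereal" and hs :: "'u \<Rightarrow> real" and G :: "'u \<Rightarrow> 'u"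
    and p lam c K :: real
  assumes contraction: "0 \<le> t \<Longrightarrow> norm (T t) \<le> 1"
    and Bs: "bounded_linear Bs" and B_apply: "blinfun_apply (B u) v = u \<bullet> Bs v"
    and lam: "0 < lam" and p: "1 \<le> p"
    and R_le: "R s \<le> R r + R' r * (s - r)"
    and R_ge: "R r + R' r * (s - r) - K * (s - r)\<^sup>2 \<le> R s" and K: "0 \<le> K"
    and R_continuous: "continuous_on UNIV R"
    and h0_convex: "ereal_convex h0" and h0_lsc: "lower_semicont h0"
    and h0_lower: "ereal (z \<bullet> u - hs z + c * (norm (u - G z))\<^sup>2) \<le> h0 u" and c: "0 < c"
    and h0_attained: "h0 (G z) = ereal (z \<bullet> G z - hs z)"
    and \<pi>: "blinfun_apply x \<pi> = (LINT t|half_line. exp (- lam * t) * blinfun_apply (blinfun_apply (T t) x) \<alpha>)"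
begin

text \<open>The truncation \<open>max 0\<close> makes the kernel continuous, hence measurable, on all of
  \<open>\<real> \<times> U\<close>.\<close>

definition kernel :: "'v \<Rightarrow> real \<Rightarrow> 'u \<Rightarrow> real" where
  "kernel v t u = blinfun_apply (blinfun_apply (T (max 0 t)) (B u)) v"

text \<open>The pairing with v of the integral in \<open>trajectory\<close>. The upper limit \<tau>
  is an indicator on the fixed half line, the form to which Fubini's theorem and the translation
  lemmas apply.\<close>

definition conv :: "'v \<Rightarrow> (real \<Rightarrow> 'u) \<Rightarrow> real \<Rightarrow> real" where
  "conv v w \<tau> = (LINT \<sigma>|half_line. indicator {..<\<tau>} \<sigma> * kernel v (\<tau> - \<sigma>) (w \<sigma>))"

text \<open>A weighted L^1 class that contains the constants and is closed under differences, so
  that the deviations u - d of a control from a constant stay in it.\<close>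

definition admissible :: "(real \<Rightarrow> 'u) \<Rightarrow> bool" where
  "admissible w \<longleftrightarrow> w \<in> borel_measurable half_line \<and> integrable half_line (\<lambda>\<tau>. exp (- lam * \<tau>) * norm (w \<tau>))"

abbreviation "\<beta> \<equiv> onorm Bs"

section \<open>The input operator, the kernel and the convolution\<close>

lemma \<beta>_nonneg: "0 \<le> \<beta>" by (rule onorm_pos_le[OF Bs])

lemma B_linear: "linear B"
  by (rule linearI) (auto intro!: blinfun_eqI simp: B_apply blinfun.add_left blinfun.scaleR_left inner_add_left)

lemma norm_B_le: "norm (B u) \<le> \<beta> * norm u"
proof (rule norm_blinfun_bound)
  show "0 \<le> \<beta> * norm u" by (simp add: \<beta>_nonneg)
  fix v
  have "\<bar>u \<bullet> Bs v\<bar> \<le> norm u * norm (Bs v)" by (rule Cauchy_Schwarz_ineq2)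
  also have "\<dots> \<le> norm u * (\<beta> * norm v)" by (intro mult_left_mono onorm[OF Bs]) simp
  finally show "norm (blinfun_apply (B u) v) \<le> \<beta> * norm u * norm v" by (simp add: B_apply mult_ac)
qed

lemma B_bounded_linear: "bounded_linear B"
  using B_linear norm_B_le by (intro bounded_linear_intro[of _ \<beta>]) (auto simp: linear_add linear_scale mult.commute)

lemma T_norm_le: "0 \<le> t \<Longrightarrow> norm (blinfun_apply (T t) x) \<le> norm x"
  using norm_blinfun[of "T t" x] contraction[of t] mult_right_mono[of "norm (T t)" 1 "norm x"] by simp

lemma abs_pairing_le: "0 \<le> t \<Longrightarrow> \<bar>blinfun_apply (blinfun_apply (T t) x) v\<bar> \<le> norm x * norm v"
  using abs_dual_le[of "blinfun_apply (T t) x" v] T_norm_le[of t x] mult_right_mono[of _ _ "norm v"]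
  by (meson norm_ge_zero order_trans)

lemma abs_kernel_le: "\<bar>kernel v t u\<bar> \<le> \<beta> * norm v * norm u"
proof -
  have "\<bar>kernel v t u\<bar> \<le> norm (B u) * norm v"
    unfolding kernel_def by (rule abs_pairing_le) simp
  also have "\<dots> \<le> \<beta> * norm u * norm v" by (intro mult_right_mono norm_B_le) simp
  finally show ?thesis by (simp add: mult_ac)
qed

lemma kernel_diff: "kernel v t (u - w) = kernel v t u - kernel v t w"
  by (simp add: kernel_def linear_diff[OF B_linear] blinfun.diff_right blinfun.diff_left)

lemma kernel_combination: "kernel v t (a *\<^sub>R u + b *\<^sub>R w) = a * kernel v t u + b * kernel v t w"
  by (simp add: kernel_def linear_add[OF B_linear] linear_scale[OF B_linear] blinfun.add_right blinfun.add_left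
      blinfun.scaleR_right blinfun.scaleR_left)

lemma kernel_measurable: "(\<lambda>q. kernel v (fst q) (snd q)) \<in> borel_measurable (borel \<Otimes>\<^sub>M borel)"
proof -
  have "continuous_on UNIV (\<lambda>q. (max 0 (fst q), B (snd q)) :: real \<times> ('v \<Rightarrow>\<^sub>L real))"
    by (intro continuous_intros bounded_linear.continuous_on[OF B_bounded_linear])
  then have "continuous_on UNIV (\<lambda>q. blinfun_apply (T (max 0 (fst q))) (B (snd q)))"
    by (rule continuous_on_compose2[OF T_jointly_continuous, of _ "\<lambda>q. (max 0 (fst q), B (snd q))", simplified]) auto
  then have "continuous_on UNIV (\<lambda>q. kernel v (fst q) (snd q))"
    unfolding kernel_def by (rule bounded_linear.continuous_on[OF blinfun.bounded_linear_left])
  then show ?thesis unfolding borel_prod by (rule borel_measurable_continuous_onI)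
qed

lemma admissible_truncated:
  assumes "admissible w"
  shows "integrable half_line (\<lambda>\<sigma>. indicator {..<\<tau>} \<sigma> * norm (w \<sigma>))"
proof (rule Bochner_Integration.integrable_bound)
  show "integrable half_line (\<lambda>\<sigma>. exp (lam * \<tau>) * (exp (- lam * \<sigma>) * norm (w \<sigma>)))"
    using assms by (simp add: admissible_def)
  have "w \<in> borel_measurable half_line" using assms by (simp add: admissible_def)
  then show "(\<lambda>\<sigma>. indicator {..<\<tau>} \<sigma> * norm (w \<sigma>)) \<in> borel_measurable half_line" by measurable
  have "indicator {..<\<tau>} \<sigma> * norm (w \<sigma>) \<le> exp (lam * \<tau>) * (exp (- lam * \<sigma>) * norm (w \<sigma>))" for \<sigma>
  proof (cases "\<sigma> < \<tau>")
    case True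
    then have "1 \<le> exp (lam * \<tau>) * exp (- lam * \<sigma>)" using lam by (simp add: mult_exp_exp)
    from mult_right_mono[OF this norm_ge_zero[of "w \<sigma>"]] show ?thesis using True by (simp add: mult.assoc)
  qed simp
  then show "AE \<sigma> in half_line. norm (indicator {..<\<tau>} \<sigma> * norm (w \<sigma>)) \<le> norm (exp (lam * \<tau>) * (exp (- lam * \<sigma>) * norm (w \<sigma>)))"
    by (intro AE_I2) simp
qed

lemma conv_integrable:
  assumes w: "admissible w"
  shows "integrable half_line (\<lambda>\<sigma>. indicator {..<\<tau>} \<sigma> * kernel v (\<tau> - \<sigma>) (w \<sigma>))"
proof (rule Bochner_Integration.integrable_bound)
  show "integrable half_line (\<lambda>\<sigma>. \<beta> * norm v * (indicator {..<\<tau>} \<sigma> * norm (w \<sigma>)))"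
    by (intro integrable_mult_right admissible_truncated w)
  have [measurable]: "w \<in> borel_measurable half_line" using w by (simp add: admissible_def)
  have "(\<lambda>\<sigma>. (\<tau> - \<sigma>, w \<sigma>)) \<in> half_line \<rightarrow>\<^sub>M borel \<Otimes>\<^sub>M borel" by measurable
  from measurable_compose[OF this kernel_measurable]
  have "(\<lambda>\<sigma>. kernel v (\<tau> - \<sigma>) (w \<sigma>)) \<in> borel_measurable half_line" by simp
  then show "(\<lambda>\<sigma>. indicator {..<\<tau>} \<sigma> * kernel v (\<tau> - \<sigma>) (w \<sigma>)) \<in> borel_measurable half_line" by measurable
  show "AE \<sigma> in half_line. norm (indicator {..<\<tau>} \<sigma> * kernel v (\<tau> - \<sigma>) (w \<sigma>)) \<le> norm (\<beta> * norm v * (indicator {..<\<tau>} \<sigma> * norm (w \<sigma>)))"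
    using abs_kernel_le \<beta>_nonneg by (intro AE_I2) (auto simp: indicator_def abs_mult)
qed

lemma abs_conv_le:
  assumes w: "admissible w"
  shows "\<bar>conv v w \<tau>\<bar> \<le> \<beta> * norm v * (LINT \<sigma>|half_line. indicator {..<\<tau>} \<sigma> * norm (w \<sigma>))"
proof -
  have "\<bar>conv v w \<tau>\<bar> \<le> (LINT \<sigma>|half_line. \<bar>indicator {..<\<tau>} \<sigma> * kernel v (\<tau> - \<sigma>) (w \<sigma>)\<bar>)"
    unfolding conv_def by (rule integral_abs_bound)
  also have "\<dots> \<le> (LINT \<sigma>|half_line. \<beta> * norm v * (indicator {..<\<tau>} \<sigma> * norm (w \<sigma>)))"
  proof (rule integral_mono)
    show "\<bar>indicator {..<\<tau>} \<sigma> * kernel v (\<tau> - \<sigma>) (w \<sigma>)\<bar> \<le> \<beta> * norm v * (indicator {..<\<tau>} \<sigma> * norm (w \<sigma>))" for \<sigma>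
      using abs_kernel_le by (auto simp: indicator_def)
  qed (intro integrable_abs conv_integrable integrable_mult_right admissible_truncated w)+
  finally show ?thesis by simp
qed

lemma admissible_const: "admissible (\<lambda>_. d)"
  using integrable_exp_Ioi(1)[OF lam] by (simp add: admissible_def)

lemma admissible_diff:
  assumes "admissible u" "admissible w"
  shows "admissible (\<lambda>\<sigma>. u \<sigma> - w \<sigma>)"
proof -
  have [measurable]: "u \<in> borel_measurable half_line" "w \<in> borel_measurable half_line"
    using assms by (auto simp: admissible_def)
  have e: "(\<lambda>\<tau>. exp (- lam * \<tau>)) \<in> borel_measurable half_line" using integrable_exp_Ioi(1)[OF lam] by auto
  have "integrable half_line (\<lambda>\<tau>. exp (- lam * \<tau>) * norm (u \<tau> - w \<tau>))"
  proof (rule Bochner_Integration.integrable_bound)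
    show "integrable half_line (\<lambda>\<tau>. exp (- lam * \<tau>) * norm (u \<tau>) + exp (- lam * \<tau>) * norm (w \<tau>))"
      using assms by (simp add: admissible_def)
    show "(\<lambda>\<tau>. exp (- lam * \<tau>) * norm (u \<tau> - w \<tau>)) \<in> borel_measurable half_line" using e by measurable
    show "AE \<tau> in half_line. norm (exp (- lam * \<tau>) * norm (u \<tau> - w \<tau>)) \<le>
        norm (exp (- lam * \<tau>) * norm (u \<tau>) + exp (- lam * \<tau>) * norm (w \<tau>))"
      by (intro AE_I2) (simp add: distrib_left[symmetric] norm_triangle_ineq4)
  qed
  then show ?thesis by (simp add: admissible_def)
qed

lemma Lp_controls_admissible: "u \<in> Lp_controls p lam \<Longrightarrow> admissible u"
  using Lp_controls_weighted_L1[of u p lam] lam p by (simp add: admissible_def)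

lemma conv_diff:
  assumes "admissible u" "admissible w"
  shows "conv v (\<lambda>\<sigma>. u \<sigma> - w \<sigma>) \<tau> = conv v u \<tau> - conv v w \<tau>"
  unfolding conv_def kernel_diff right_diff_distrib
  by (intro Bochner_Integration.integral_diff conv_integrable assms)

lemma conv_convex:
  assumes "admissible u" "admissible w"
  shows "conv v (\<lambda>\<sigma>. (1 - s) *\<^sub>R u \<sigma> + s *\<^sub>R w \<sigma>) \<tau> = (1 - s) * conv v u \<tau> + s * conv v w \<tau>"
proof -
  have "conv v (\<lambda>\<sigma>. (1 - s) *\<^sub>R u \<sigma> + s *\<^sub>R w \<sigma>) \<tau> =
      (LINT \<sigma>|half_line. (1 - s) * (indicator {..<\<tau>} \<sigma> * kernel v (\<tau> - \<sigma>) (u \<sigma>)) + s * (indicator {..<\<tau>} \<sigma> * kernel v (\<tau> - \<sigma>) (w \<sigma>)))"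
    unfolding conv_def kernel_combination
    by (intro Bochner_Integration.integral_cong) (auto simp: algebra_simps)
  also have "\<dots> = (1 - s) * conv v u \<tau> + s * conv v w \<tau>"
    unfolding conv_def using conv_integrable[OF assms(1)] conv_integrable[OF assms(2)] by simp
  finally show ?thesis .
qed

lemma conv_lebesgue_on:
  assumes "admissible u" "0 \<le> \<tau>"
  shows "(LINT \<sigma>|lebesgue_on {0..\<tau>}. blinfun_apply (blinfun_apply (T (\<tau> - \<sigma>)) (B (u \<sigma>))) v) = conv v u \<tau>"
proof -
  have "(LINT \<sigma>|lebesgue_on {0..\<tau>}. blinfun_apply (blinfun_apply (T (\<tau> - \<sigma>)) (B (u \<sigma>))) v)
      = (LINT \<sigma>|lebesgue_on {0..\<tau>}. kernel v (\<tau> - \<sigma>) (u \<sigma>))"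
    by (rule Bochner_Integration.integral_cong) (auto simp: kernel_def)
  also have "\<dots> = conv v u \<tau>"
    unfolding conv_def by (rule lebesgue_on_Icc_eq_half_line[OF conv_integrable[OF assms(1)]])
  finally show ?thesis .
qed

lemma trajectory_pairing:
  assumes u: "admissible u" and \<tau>: "0 \<le> \<tau>"
  shows "blinfun_apply (trajectory T B x u \<tau>) v = blinfun_apply (blinfun_apply (T \<tau>) x) v + conv v u \<tau>"
proof -
  have "bounded_linear (\<lambda>v. conv v u \<tau>)"
  proof (rule bounded_linear_intro)
    fix v w and r :: real
    show "conv (v + w) u \<tau> = conv v u \<tau> + conv w u \<tau>"
      using Bochner_Integration.integral_add[OF conv_integrable[OF u, of \<tau> v] conv_integrable[OF u, of \<tau> w]]
      by (simp add: conv_def kernel_def blinfun.add_right distrib_left)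
    show "conv (r *\<^sub>R v) u \<tau> = r *\<^sub>R conv v u \<tau>"
      by (simp add: conv_def kernel_def blinfun.scaleR_right mult.left_commute)
    show "norm (conv v u \<tau>) \<le> norm v * (\<beta> * (LINT \<sigma>|half_line. indicator {..<\<tau>} \<sigma> * norm (u \<sigma>)))"
      using abs_conv_le[OF u, of v \<tau>] by (simp add: mult_ac)
  qed
  then show ?thesis
    by (simp add: trajectory_def conv_lebesgue_on[OF u \<tau>] blinfun.add_left bounded_linear_Blinfun_apply)
qed

lemma conv_const:
  assumes \<tau>: "0 \<le> \<tau>"
  shows "conv v (\<lambda>_. d) \<tau> = blinfun_apply (orbit_integral \<tau> (B d)) v"
proof -
  have cont: "continuous_on {0..\<tau>} (\<lambda>\<sigma>. kernel v (\<tau> - \<sigma>) d)"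
    unfolding kernel_def
    by (intro continuous_intros continuous_on_compose2[OF T_continuous]) auto
  have "conv v (\<lambda>_. d) \<tau> = (LINT \<sigma>|lebesgue_on {0..\<tau>}. kernel v (\<tau> - \<sigma>) d)"
    unfolding conv_def by (rule lebesgue_on_Icc_eq_half_line[OF conv_integrable[OF admissible_const], symmetric])
  also have "\<dots> = integral {0..\<tau>} (\<lambda>\<sigma>. kernel v (\<tau> - \<sigma>) d)"
    by (intro integral_lebesgue_on_eq absolutely_integrable_continuous_real cont) auto
  also have "\<dots> = integral {0..\<tau>} (\<lambda>s. kernel v s d)"
  proof (rule integral_unique)
    have "continuous_on {0..\<tau>} (\<lambda>s. kernel v s d)"
      unfolding kernel_def by (intro continuous_intros continuous_on_compose2[OF T_continuous]) auto
    then have "((\<lambda>s. kernel v s d) has_integral integral {0..\<tau>} (\<lambda>s. kernel v s d)) (cbox 0 \<tau>)"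
      by (simp add: integrable_continuous_real integrable_integral)
    from has_integral_affinity[OF this, of "-1" \<tau>]
    have "((\<lambda>x. kernel v (\<tau> - x) d) has_integral integral {0..\<tau>} (\<lambda>s. kernel v s d)) ((\<lambda>x. \<tau> - x) ` {0..\<tau>})"
      by (simp add: algebra_simps)
    moreover have "(\<lambda>x. \<tau> - x) ` {0..\<tau>} = {0..\<tau>}"
      by (auto simp: image_iff intro!: bexI[of _ "\<tau> - x" for x])
    ultimately show "((\<lambda>x. kernel v (\<tau> - x) d) has_integral integral {0..\<tau>} (\<lambda>s. kernel v s d)) {0..\<tau>}" by simp
  qed
  also have "\<dots> = integral {0..\<tau>} (\<lambda>s. blinfun_apply (blinfun_apply (T s) (B d)) v)"
    by (rule integral_cong) (auto simp: kernel_def)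
  also have "\<dots> = blinfun_apply (orbit_integral \<tau> (B d)) v"
    unfolding orbit_integral_def
    using integral_linear[OF orbit_integrable[of 0 "B d" \<tau>], of "\<lambda>x. blinfun_apply x v"]
    by (simp add: o_def blinfun.bounded_linear_left)
  finally show ?thesis .
qed

text \<open>By Fubini's theorem the Laplace transform of the convolution is a product, and the
  transform of the kernel is the pairing of B w with \<pi>. The response of the state to a control
  deviation thus becomes an inner product with B^* \<pi>.\<close>

lemma conv_Laplace:
  assumes w: "admissible w"
  shows "integrable half_line (\<lambda>\<tau>. exp (- lam * \<tau>) * conv \<alpha> w \<tau>)"
    and "(LINT \<tau>|half_line. exp (- lam * \<tau>) * conv \<alpha> w \<tau>) = (LINT \<sigma>|half_line. exp (- lam * \<sigma>) * (w \<sigma> \<bullet> Bs \<pi>))"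
proof -
  interpret N: sigma_finite_measure half_line by (rule sigma_finite_half_line)
  interpret NN: pair_sigma_finite half_line half_line ..
  have w_meas [measurable]: "w \<in> borel_measurable half_line" using w by (simp add: admissible_def)
  \<comment> \<open>The discount at \<tau> is factored into those at \<sigma> and at \<tau> -
    \<sigma>, so that the integral over \<tau> is a delayed copy of the transform of the
    kernel.\<close>
  define f where "f \<sigma> \<tau> = indicator {\<sigma><..} \<tau> * (exp (- lam * \<sigma>) * (exp (- lam * (\<tau> - \<sigma>)) * kernel \<alpha> (\<tau> - \<sigma>) (w \<sigma>)))" for \<sigma> \<tau>
  have growth: "norm (T t) \<le> 1 * exp (0 * t)" if "0 \<le> t" for t using contraction[OF that] by simp
  have g: "integrable half_line (\<lambda>t. exp (- lam * t) * kernel \<alpha> t u)" for u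
    using Laplace_integrable(1)[OF growth lam, of "B u" \<alpha>]
    by (rule Bochner_Integration.integrable_cong[THEN iffD1, rotated 2]) (auto simp: kernel_def)
  have g_int: "(LINT t|half_line. exp (- lam * t) * kernel \<alpha> t u) = u \<bullet> Bs \<pi>" for u
  proof -
    have "(LINT t|half_line. exp (- lam * t) * kernel \<alpha> t u) = blinfun_apply (B u) \<pi>"
      unfolding \<pi> by (rule Bochner_Integration.integral_cong) (auto simp: kernel_def)
    then show ?thesis by (simp add: B_apply)
  qed
  have f_int: "integrable half_line (f \<sigma>)" and f_val: "(LINT \<tau>|half_line. f \<sigma> \<tau>) = exp (- lam * \<sigma>) * (w \<sigma> \<bullet> Bs \<pi>)"
    and f_norm: "(LINT \<tau>|half_line. norm (f \<sigma> \<tau>)) \<le> \<beta> * norm \<alpha> / lam * (exp (- lam * \<sigma>) * norm (w \<sigma>))" if "0 < \<sigma>" for \<sigma>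
  proof -
    let ?g = "\<lambda>t. exp (- lam * \<sigma>) * (exp (- lam * t) * kernel \<alpha> t (w \<sigma>))"
    have int: "integrable half_line ?g" by (intro integrable_mult_right g)
    have \<sigma>: "0 \<le> \<sigma>" using that by simp
    show "integrable half_line (f \<sigma>)"
      unfolding f_def by (rule half_line_integral_delay(1)[OF int \<sigma>])
    show "(LINT \<tau>|half_line. f \<sigma> \<tau>) = exp (- lam * \<sigma>) * (w \<sigma> \<bullet> Bs \<pi>)"
      unfolding f_def half_line_integral_delay(2)[OF int \<sigma>] by (simp only: Bochner_Integration.integral_mult_right_zero g_int)
    have "(LINT \<tau>|half_line. norm (f \<sigma> \<tau>)) = (LINT \<tau>|half_line. indicator {\<sigma><..} \<tau> * \<bar>?g (\<tau> - \<sigma>)\<bar>)"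
      by (rule Bochner_Integration.integral_cong) (auto simp: f_def abs_mult indicator_def)
    also have "\<dots> = (LINT t|half_line. \<bar>?g t\<bar>)"
      by (rule half_line_integral_delay(2)[OF integrable_abs[OF int] \<sigma>])
    also have "\<dots> \<le> (LINT t|half_line. exp (- lam * \<sigma>) * (\<beta> * norm \<alpha> * norm (w \<sigma>)) * exp (- lam * t))"
    proof (rule integral_mono)
      show "integrable half_line (\<lambda>t. exp (- lam * \<sigma>) * (\<beta> * norm \<alpha> * norm (w \<sigma>)) * exp (- lam * t))"
        by (intro integrable_mult_right integrable_exp_Ioi(1) lam)
      fix t
      have "\<bar>kernel \<alpha> t (w \<sigma>)\<bar> * exp (- lam * t) \<le> \<beta> * norm \<alpha> * norm (w \<sigma>) * exp (- lam * t)"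
        by (intro mult_right_mono abs_kernel_le) simp
      then have "exp (- lam * \<sigma>) * (\<bar>kernel \<alpha> t (w \<sigma>)\<bar> * exp (- lam * t)) \<le> exp (- lam * \<sigma>) * (\<beta> * norm \<alpha> * norm (w \<sigma>) * exp (- lam * t))"
        by (rule mult_left_mono) simp
      then show "\<bar>?g t\<bar> \<le> exp (- lam * \<sigma>) * (\<beta> * norm \<alpha> * norm (w \<sigma>)) * exp (- lam * t)"
        by (simp add: abs_mult mult_ac)
    qed (intro integrable_abs int)
    also have "\<dots> = \<beta> * norm \<alpha> / lam * (exp (- lam * \<sigma>) * norm (w \<sigma>))"
      using integrable_exp_Ioi(2)[OF lam] by simp
    finally show "(LINT \<tau>|half_line. norm (f \<sigma> \<tau>)) \<le> \<beta> * norm \<alpha> / lam * (exp (- lam * \<sigma>) * norm (w \<sigma>))" .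
  qed
  have fst_m: "fst \<in> borel_measurable (half_line \<Otimes>\<^sub>M half_line)"
    using measurable_compose[OF measurable_fst half_line_id] .
  have snd_m: "snd \<in> borel_measurable (half_line \<Otimes>\<^sub>M half_line)"
    using measurable_compose[OF measurable_snd half_line_id] .
  have wm: "(\<lambda>q. w (fst q)) \<in> borel_measurable (half_line \<Otimes>\<^sub>M half_line)"
    using measurable_compose[OF measurable_fst w_meas] .
  have "(\<lambda>q. (snd q - fst q, w (fst q))) \<in> half_line \<Otimes>\<^sub>M half_line \<rightarrow>\<^sub>M borel \<Otimes>\<^sub>M borel"
    using fst_m snd_m wm by measurable
  from measurable_compose[OF this kernel_measurable]
  have ker: "(\<lambda>q. kernel \<alpha> (snd q - fst q) (w (fst q))) \<in> borel_measurable (half_line \<Otimes>\<^sub>M half_line)" by simp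
  have meas: "case_prod f \<in> borel_measurable (half_line \<Otimes>\<^sub>M half_line)"
  proof -
    have "(\<lambda>q. if fst q < snd q then exp (- lam * fst q) * (exp (- lam * (snd q - fst q)) * kernel \<alpha> (snd q - fst q) (w (fst q))) else 0)
        \<in> borel_measurable (half_line \<Otimes>\<^sub>M half_line)"
      using fst_m snd_m ker by measurable
    moreover have "(\<lambda>q. if fst q < snd q then exp (- lam * fst q) * (exp (- lam * (snd q - fst q)) * kernel \<alpha> (snd q - fst q) (w (fst q))) else 0) = case_prod f"
      by (auto simp: f_def fun_eq_iff)
    ultimately show ?thesis by simp
  qed
  have int: "integrable (half_line \<Otimes>\<^sub>M half_line) (case_prod f)"
  proof (rule NN.Fubini_integrable[OF meas])
    show "AE \<sigma> in half_line. integrable half_line (\<lambda>\<tau>. case_prod f (\<sigma>, \<tau>))"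
      using f_int by (intro AE_I2) simp
    show "integrable half_line (\<lambda>\<sigma>. LINT \<tau>|half_line. norm (case_prod f (\<sigma>, \<tau>)))"
    proof (rule Bochner_Integration.integrable_bound)
      show "integrable half_line (\<lambda>\<sigma>. \<beta> * norm \<alpha> / lam * (exp (- lam * \<sigma>) * norm (w \<sigma>)))"
        using w by (intro integrable_mult_right) (simp add: admissible_def)
      have "(\<lambda>(\<sigma>, \<tau>). norm (f \<sigma> \<tau>)) \<in> borel_measurable (half_line \<Otimes>\<^sub>M half_line)"
        using measurable_compose[OF meas borel_measurable_norm] by (simp add: case_prod_beta)
      from N.borel_measurable_lebesgue_integral[OF this]
      show "(\<lambda>\<sigma>. LINT \<tau>|half_line. norm (case_prod f (\<sigma>, \<tau>))) \<in> borel_measurable half_line" by simp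
      show "AE \<sigma> in half_line. norm (LINT \<tau>|half_line. norm (case_prod f (\<sigma>, \<tau>))) \<le>
          norm (\<beta> * norm \<alpha> / lam * (exp (- lam * \<sigma>) * norm (w \<sigma>)))"
      proof (intro AE_I2)
        fix \<sigma> assume "\<sigma> \<in> space half_line"
        then have "0 < \<sigma>" by simp
        have "0 \<le> (LINT \<tau>|half_line. norm (f \<sigma> \<tau>))" by (rule Bochner_Integration.integral_nonneg) simp
        then show "norm (LINT \<tau>|half_line. norm (case_prod f (\<sigma>, \<tau>))) \<le> norm (\<beta> * norm \<alpha> / lam * (exp (- lam * \<sigma>) * norm (w \<sigma>)))"
          using f_norm[OF \<open>0 < \<sigma>\<close>] by (simp only: real_norm_def prod.case)
      qed
    qed
  qed
  have inner: "(LINT \<sigma>|half_line. f \<sigma> \<tau>) = exp (- lam * \<tau>) * conv \<alpha> w \<tau>" for \<tau>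
  proof -
    have "f \<sigma> \<tau> = exp (- lam * \<tau>) * (indicator {..<\<tau>} \<sigma> * kernel \<alpha> (\<tau> - \<sigma>) (w \<sigma>))" for \<sigma>
    proof -
      have "exp (- lam * \<sigma>) * exp (- lam * (\<tau> - \<sigma>)) = exp (- lam * \<tau>)" by (simp add: mult_exp_exp algebra_simps)
      then show ?thesis by (simp add: f_def indicator_def mult.assoc[symmetric])
    qed
    then show ?thesis by (simp add: conv_def)
  qed
  show "integrable half_line (\<lambda>\<tau>. exp (- lam * \<tau>) * conv \<alpha> w \<tau>)"
    using NN.integrable_snd[OF int] by (simp only: inner)
  have "(LINT \<tau>|half_line. exp (- lam * \<tau>) * conv \<alpha> w \<tau>) = (LINT \<sigma>|half_line. LINT \<tau>|half_line. f \<sigma> \<tau>)"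
    using NN.Fubini_integral[OF int] by (simp only: inner)
  also have "\<dots> = (LINT \<sigma>|half_line. exp (- lam * \<sigma>) * (w \<sigma> \<bullet> Bs \<pi>))"
    by (rule Bochner_Integration.integral_cong) (simp_all add: f_val)
  finally show "(LINT \<tau>|half_line. exp (- lam * \<tau>) * conv \<alpha> w \<tau>) = (LINT \<sigma>|half_line. exp (- lam * \<sigma>) * (w \<sigma> \<bullet> Bs \<pi>))" .
qed

lemma conv_measurable:
  assumes "admissible w"
  shows "conv \<alpha> w \<in> borel_measurable half_line"
proof -
  have "(\<lambda>\<tau>. exp (lam * \<tau>)) \<in> borel_measurable half_line" by measurable
  from borel_measurable_times[OF this borel_measurable_integrable[OF conv_Laplace(1)[OF assms]]]
  have "(\<lambda>\<tau>. exp (lam * \<tau>) * (exp (- lam * \<tau>) * conv \<alpha> w \<tau>)) \<in> borel_measurable half_line" .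
  then show ?thesis by (simp add: mult.assoc[symmetric] mult_exp_exp)
qed

text \<open>The flow property. As the convolution integral is defined by pairings, T(\<tau>) is
  moved to the test vector by its adjoint; the integral up to t + \<tau> then splits at t.\<close>

lemma trajectory_translate:
  assumes u: "u \<in> Lp_controls p lam" and t: "0 \<le> t" "0 \<le> \<tau>"
  shows "trajectory T B (trajectory T B x u t) (\<lambda>\<sigma>. u (t + \<sigma>)) \<tau> = trajectory T B x u (t + \<tau>)"
proof (rule blinfun_eqI)
  fix v
  let ?u = "\<lambda>\<sigma>. u (t + \<sigma>)"
  have adm: "admissible u" "admissible ?u"
    using u Lp_controls_translate[OF u t(1) p] by (auto intro: Lp_controls_admissible)
  obtain w where w: "\<And>x. blinfun_apply (blinfun_apply (T \<tau>) x) v = blinfun_apply x w"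
    using Hilbert_adjoint[of "T \<tau>" v] by blast
  let ?F = "\<lambda>\<sigma>. indicator {..<t + \<tau>} \<sigma> * kernel v (t + \<tau> - \<sigma>) (u \<sigma>)"
  have int: "integrable half_line ?F" by (rule conv_integrable[OF adm(1)])
  have 1: "conv w u t = (LINT \<sigma>|half_line. indicator {..<t} \<sigma> * ?F \<sigma>)"
    unfolding conv_def
  proof (rule Bochner_Integration.integral_cong[OF refl])
    fix \<sigma> assume "\<sigma> \<in> space half_line"
    show "indicator {..<t} \<sigma> * kernel w (t - \<sigma>) (u \<sigma>) = indicator {..<t} \<sigma> * ?F \<sigma>"
    proof (cases "\<sigma> < t")
      case True
      have "kernel w (t - \<sigma>) (u \<sigma>) = blinfun_apply (blinfun_apply (T \<tau>) (blinfun_apply (T (t - \<sigma>)) (B (u \<sigma>)))) v"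
        using True by (simp add: kernel_def w)
      also have "\<dots> = kernel v (t + \<tau> - \<sigma>) (u \<sigma>)"
        using True t T_add[of \<tau> "t - \<sigma>" "B (u \<sigma>)"] by (simp add: kernel_def algebra_simps)
      finally show ?thesis using True t by (simp add: indicator_def)
    qed simp
  qed
  have 2: "conv v ?u \<tau> = (LINT \<sigma>|half_line. indicator {t<..} \<sigma> * ?F \<sigma>)"
  proof -
    have "conv v ?u \<tau> = (LINT \<sigma>|half_line. ?F (t + \<sigma>))"
      unfolding conv_def by (rule Bochner_Integration.integral_cong) (auto simp: indicator_def)
    also have "\<dots> = (LINT \<sigma>|half_line. indicator {t<..} \<sigma> * ?F \<sigma>)"
      by (rule half_line_integral_translate(2)[OF borel_measurable_integrable[OF int] t(1)])
    finally show ?thesis .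
  qed
  have "conv v u (t + \<tau>) = (LINT \<sigma>|half_line. indicator {..<t} \<sigma> * ?F \<sigma>) + (LINT \<sigma>|half_line. indicator {t<..} \<sigma> * ?F \<sigma>)"
    using half_line_integral_split(3)[OF int t(1)] by (simp add: conv_def)
  also have "\<dots> = conv w u t + conv v ?u \<tau>" by (simp only: 1 2)
  finally have "conv v u (t + \<tau>) = conv w u t + conv v ?u \<tau>" .
  moreover have "blinfun_apply (blinfun_apply (T (t + \<tau>)) x) v = blinfun_apply (blinfun_apply (T t) x) w"
    using T_add[OF t(2,1), of x] by (simp add: add.commute w)
  ultimately show "blinfun_apply (trajectory T B (trajectory T B x u t) ?u \<tau>) v = blinfun_apply (trajectory T B x u (t + \<tau>)) v"
    using t by (simp add: trajectory_pairing adm w)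
qed

end

section \<open>The value function at a stationary state\<close>

text \<open>An infinite \<open>h\<close> would make the sum, and its product with a positive number,
  infinite.\<close>

lemma ereal_affine_cancel:
  assumes "ereal e * (ereal g + h) = ereal f" "0 < e"
  shows "h = ereal (f / e - g)"
  using assms by (cases h) (auto simp: field_simps)

context control_problem
begin

section \<open>Cost, value and deviations from a stationary state\<close>

abbreviation "g0 \<equiv> profit_g0 R \<alpha>"

definition J :: "('v \<Rightarrow>\<^sub>L real) \<Rightarrow> (real \<Rightarrow> 'u) \<Rightarrow> ereal" where
  "J x u = total_cost T B g0 h0 lam x u"

definition val :: "('v \<Rightarrow>\<^sub>L real) \<Rightarrow> ereal" where
  "val x = (INF u\<in>Lp_controls p lam. J x u)"

definition \<Psi> :: "('v \<Rightarrow>\<^sub>L real) \<Rightarrow> real" where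
  "\<Psi> = value_fun T B g0 h0 p lam"

definition running :: "('v \<Rightarrow>\<^sub>L real) \<Rightarrow> (real \<Rightarrow> 'u) \<Rightarrow> real \<Rightarrow> ereal" where
  "running x u \<tau> = ereal (exp (- lam * \<tau>)) * (ereal (g0 (trajectory T B x u \<tau>)) + h0 (u \<tau>))"

text \<open>The mild form of A x + B d = 0, in which the generator does not occur.\<close>

definition stationary :: "('v \<Rightarrow>\<^sub>L real) \<Rightarrow> 'u \<Rightarrow> bool" where
  "stationary x d \<longleftrightarrow> (\<forall>t\<ge>0. blinfun_apply (T t) x + orbit_integral t (B d) = x)"

lemma J_running: "J x u = ext_integral half_line (running x u)"
  by (simp add: J_def total_cost_def running_def[abs_def])

lemma \<Psi>_val: "\<Psi> x = real_of_ereal (val x)"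
  by (simp add: \<Psi>_def value_fun_def val_def J_def)

lemma g0_trajectory:
  assumes "admissible u" "0 \<le> \<tau>"
  shows "g0 (trajectory T B x u \<tau>) = - R (blinfun_apply (blinfun_apply (T \<tau>) x) \<alpha> + conv \<alpha> u \<tau>)"
  by (simp add: profit_g0_def trajectory_pairing assms)

text \<open>Relative to a stationary pair (x, d), the trajectory deviates by a part linear in z - x
  and a part linear in u - d, so the first-order terms of the cost can be read off.\<close>

lemma stationary_pairing:
  assumes x: "stationary x d" and u: "admissible u" and \<tau>: "0 \<le> \<tau>"
  shows "blinfun_apply (trajectory T B z u \<tau>) v =
    blinfun_apply x v + blinfun_apply (blinfun_apply (T \<tau>) (z - x)) v + conv v (\<lambda>\<sigma>. u \<sigma> - d) \<tau>"
proof -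
  have "blinfun_apply (T \<tau>) x + orbit_integral \<tau> (B d) = x" using x \<tau> by (simp add: stationary_def)
  then have "blinfun_apply x v = blinfun_apply (blinfun_apply (T \<tau>) x) v + conv v (\<lambda>_. d) \<tau>"
    unfolding conv_const[OF \<tau>] by (metis blinfun.add_left)
  then show ?thesis
    by (simp add: trajectory_pairing u \<tau> conv_diff admissible_const blinfun.diff_right blinfun.diff_left)
qed

lemma stationary_running:
  assumes x: "stationary x d" and u: "admissible u" and \<tau>: "0 \<le> \<tau>"
  shows "running z u \<tau> = ereal (exp (- lam * \<tau>)) *
    (ereal (- R (blinfun_apply x \<alpha> + (blinfun_apply (blinfun_apply (T \<tau>) (z - x)) \<alpha> + conv \<alpha> (\<lambda>\<sigma>. u \<sigma> - d) \<tau>))) + h0 (u \<tau>))"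
  by (simp add: running_def profit_g0_def stationary_pairing[OF x u \<tau>] add.assoc)

lemma running_measurable:
  assumes u: "u \<in> Lp_controls p lam"
  shows "running x u \<in> borel_measurable half_line"
proof -
  have adm: "admissible u" by (rule Lp_controls_admissible[OF u])
  have "(\<lambda>\<tau>. blinfun_apply (blinfun_apply (T \<tau>) x) \<alpha>) \<in> borel_measurable half_line"
    by (rule continuous_imp_measurable_on_sets_lebesgue) (auto intro: continuous_on_subset[OF pairing_continuous])
  then have "(\<lambda>\<tau>. blinfun_apply (blinfun_apply (T \<tau>) x) \<alpha> + conv \<alpha> u \<tau>) \<in> borel_measurable half_line"
    by (intro borel_measurable_add conv_measurable adm)
  from measurable_compose[OF this borel_measurable_continuous_onI[OF R_continuous]]
  have [measurable]: "(\<lambda>\<tau>. R (blinfun_apply (blinfun_apply (T \<tau>) x) \<alpha> + conv \<alpha> u \<tau>)) \<in> borel_measurable half_line" .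
  have "u \<in> borel_measurable half_line" using adm by (simp add: admissible_def)
  from measurable_compose[OF this lower_semicont_borel_measurable[OF h0_lsc]]
  have [measurable]: "(\<lambda>\<tau>. h0 (u \<tau>)) \<in> borel_measurable half_line" .
  have "(\<lambda>\<tau>. ereal (exp (- lam * \<tau>)) * (ereal (- R (blinfun_apply (blinfun_apply (T \<tau>) x) \<alpha> + conv \<alpha> u \<tau>)) + h0 (u \<tau>)))
      \<in> borel_measurable half_line" by measurable
  then show ?thesis
    by (rule measurable_cong[THEN iffD1, rotated]) (simp add: running_def g0_trajectory[OF adm])
qed

section \<open>Two-sided bounds for the cost near a stationary state\<close>

lemma Laplace_\<alpha>: "integrable half_line (\<lambda>t. exp (- lam * t) * blinfun_apply (blinfun_apply (T t) y) \<alpha>)"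
proof (rule Laplace_integrable(1)[of 1 0])
  show "norm (T t) \<le> 1 * exp (0 * t)" if "0 \<le> t" for t using contraction[OF that] by simp
qed (rule lam)

text \<open>Under the constant control d only the deviation T(\<tau>)(z - x) remains. The discounted
  integral of the linear term of R is the pairing with \<pi>, and contraction bounds the quadratic
  remainder.\<close>

lemma cost_upper_bound:
  assumes x: "stationary x d" and \<eta>: "h0 d = ereal \<eta>"
  shows "J z (\<lambda>_. d) \<le> ereal ((\<eta> - R (blinfun_apply x \<alpha>)) / lam - R' (blinfun_apply x \<alpha>) * blinfun_apply (z - x) \<pi>
      + K * (norm \<alpha>)\<^sup>2 / lam * (norm (z - x))\<^sup>2)"
proof -
  let ?\<rho> = "blinfun_apply x \<alpha>"
  let ?a = "\<lambda>\<tau>. blinfun_apply (blinfun_apply (T \<tau>) (z - x)) \<alpha>"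
  let ?C = "\<eta> - R ?\<rho> + K * (norm \<alpha>)\<^sup>2 * (norm (z - x))\<^sup>2"
  define f where "f \<tau> = ?C * exp (- lam * \<tau>) - R' ?\<rho> * (exp (- lam * \<tau>) * ?a \<tau>)" for \<tau>
  have int: "integrable half_line f"
    unfolding f_def by (intro Bochner_Integration.integrable_diff integrable_mult_right integrable_exp_Ioi(1) lam Laplace_\<alpha>)
  have "J z (\<lambda>_. d) \<le> ext_integral half_line (\<lambda>\<tau>. ereal (f \<tau>))"
    unfolding J_running
  proof (rule ext_integral_mono, rule AE_I2)
    fix \<tau> assume "\<tau> \<in> space half_line"
    then have \<tau>: "0 \<le> \<tau>" by simp
    have zero: "conv \<alpha> (\<lambda>\<sigma>. d - d) \<tau> = 0"
      by (subst conv_diff) (simp_all add: admissible_const)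
    have "(?a \<tau>)\<^sup>2 \<le> (norm (z - x) * norm \<alpha>)\<^sup>2"
      using power_mono[OF abs_pairing_le[OF \<tau>, of "z - x" \<alpha>] abs_ge_zero, of 2] by simp
    then have "K * (?a \<tau>)\<^sup>2 \<le> K * ((norm (z - x))\<^sup>2 * (norm \<alpha>)\<^sup>2)"
      using K by (intro mult_left_mono) (auto simp: power_mult_distrib)
    then have "\<eta> - R (?\<rho> + ?a \<tau>) \<le> ?C - R' ?\<rho> * ?a \<tau>"
      using R_ge[of ?\<rho> "?\<rho> + ?a \<tau>"] by (simp add: mult_ac)
    then have "exp (- lam * \<tau>) * (\<eta> - R (?\<rho> + ?a \<tau>)) \<le> exp (- lam * \<tau>) * (?C - R' ?\<rho> * ?a \<tau>)"
      by (rule mult_left_mono) simp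
    also have "\<dots> = f \<tau>" by (simp add: f_def algebra_simps)
    finally show "running z (\<lambda>_. d) \<tau> \<le> ereal (f \<tau>)"
      unfolding stationary_running[OF x admissible_const \<tau>] zero \<eta> by simp
  qed
  also have "\<dots> = ereal (LINT \<tau>|half_line. f \<tau>)" by (rule ext_integral_real[OF int])
  also have "(LINT \<tau>|half_line. f \<tau>) = ?C / lam - R' ?\<rho> * blinfun_apply (z - x) \<pi>"
    unfolding f_def using integrable_exp_Ioi[OF lam] Laplace_\<alpha>[of "z - x"] by (simp add: \<pi>)
  also have "?C / lam = (\<eta> - R ?\<rho>) / lam + K * (norm \<alpha>)\<^sup>2 / lam * (norm (z - x))\<^sup>2"
    by (simp add: add_divide_distrib)
  finally show ?thesis by (simp add: algebra_simps)
qed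

text \<open>R lies below its tangent at <x, \<alpha>>, and h0 above its tangent at d, which has
  slope -B^* q. The terms linear in u - d cancel because q is the costate, and only the slope q in z
  - x is left.\<close>

lemma cost_lower_bound:
  assumes x: "stationary x d" and d: "d = G (- Bs q)" and q: "q = (- R' (blinfun_apply x \<alpha>)) *\<^sub>R \<pi>"
    and \<eta>: "h0 d = ereal \<eta>" and u: "u \<in> Lp_controls p lam"
  shows "ereal ((\<eta> - R (blinfun_apply x \<alpha>)) / lam + blinfun_apply (z - x) q) \<le> J z u"
proof -
  let ?\<rho> = "blinfun_apply x \<alpha>" and ?w = "\<lambda>\<sigma>. u \<sigma> - d"
  let ?a = "\<lambda>\<tau>. blinfun_apply (blinfun_apply (T \<tau>) (z - x)) \<alpha>"
  have adm: "admissible u" by (rule Lp_controls_admissible[OF u])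
  have w: "admissible ?w" by (intro admissible_diff adm admissible_const)
  define f where "f \<tau> = (\<eta> - R ?\<rho>) * exp (- lam * \<tau>) - R' ?\<rho> * (exp (- lam * \<tau>) * ?a \<tau>)
      - R' ?\<rho> * (exp (- lam * \<tau>) * conv \<alpha> ?w \<tau>) - exp (- lam * \<tau>) * (?w \<tau> \<bullet> Bs q)" for \<tau>
  have wq: "integrable half_line (\<lambda>\<tau>. exp (- lam * \<tau>) * (?w \<tau> \<bullet> Bs q))"
  proof (rule Bochner_Integration.integrable_bound)
    show "integrable half_line (\<lambda>\<tau>. exp (- lam * \<tau>) * norm (?w \<tau>) * norm (Bs q))"
      using w by (simp add: admissible_def)
    have [measurable]: "?w \<in> borel_measurable half_line" using w by (simp add: admissible_def)
    show "(\<lambda>\<tau>. exp (- lam * \<tau>) * (?w \<tau> \<bullet> Bs q)) \<in> borel_measurable half_line" by measurable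
    show "AE \<tau> in half_line. norm (exp (- lam * \<tau>) * (?w \<tau> \<bullet> Bs q)) \<le> norm (exp (- lam * \<tau>) * norm (?w \<tau>) * norm (Bs q))"
      using Cauchy_Schwarz_ineq2 by (intro AE_I2) (simp add: abs_mult)
  qed
  have int: "integrable half_line f"
    unfolding f_def
    by (intro Bochner_Integration.integrable_diff integrable_mult_right integrable_exp_Ioi(1) lam Laplace_\<alpha> conv_Laplace(1) w wq)
  have val: "(LINT \<tau>|half_line. f \<tau>) = (\<eta> - R ?\<rho>) / lam + blinfun_apply (z - x) q"
  proof -
    have "(LINT \<tau>|half_line. f \<tau>) = (\<eta> - R ?\<rho>) / lam - R' ?\<rho> * blinfun_apply (z - x) \<pi>
        - R' ?\<rho> * (LINT \<sigma>|half_line. exp (- lam * \<sigma>) * (?w \<sigma> \<bullet> Bs \<pi>)) - (LINT \<tau>|half_line. exp (- lam * \<tau>) * (?w \<tau> \<bullet> Bs q))"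
      unfolding f_def
      using integrable_exp_Ioi[OF lam] Laplace_\<alpha>[of "z - x"] conv_Laplace[OF w] wq by (simp add: \<pi>)
    \<comment> \<open>As q is a multiple of \<pi>, this is the term that \<open>conv_Laplace\<close>
      produces from R; the two cancel.\<close>
    moreover have "(LINT \<tau>|half_line. exp (- lam * \<tau>) * (?w \<tau> \<bullet> Bs q)) = - R' ?\<rho> * (LINT \<sigma>|half_line. exp (- lam * \<sigma>) * (?w \<sigma> \<bullet> Bs \<pi>))"
      unfolding Bochner_Integration.integral_mult_right_zero[symmetric]
      by (rule Bochner_Integration.integral_cong)
        (simp_all add: q linear_scale[OF bounded_linear.linear[OF Bs]] linear_neg[OF bounded_linear.linear[OF Bs]] algebra_simps)
    ultimately show ?thesis by (simp add: q blinfun.scaleR_right blinfun.minus_right)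
  qed
  have "ereal (LINT \<tau>|half_line. f \<tau>) = ext_integral half_line (\<lambda>\<tau>. ereal (f \<tau>))"
    by (rule ext_integral_real[OF int, symmetric])
  also have "\<dots> \<le> J z u"
    unfolding J_running
  proof (rule ext_integral_mono, rule AE_I2)
    fix \<tau> assume "\<tau> \<in> space half_line"
    then have \<tau>: "0 \<le> \<tau>" by simp
    let ?b = "?a \<tau> + conv \<alpha> ?w \<tau>"
    have "\<eta> = (- Bs q) \<bullet> d - hs (- Bs q)" using h0_attained[of "- Bs q"] \<eta> d by simp
    then have "ereal (\<eta> - ?w \<tau> \<bullet> Bs q) = ereal ((- Bs q) \<bullet> u \<tau> - hs (- Bs q))"
      by (simp add: inner_diff_left inner_diff_right inner_commute)
    also have "\<dots> \<le> ereal ((- Bs q) \<bullet> u \<tau> - hs (- Bs q) + c * (norm (u \<tau> - G (- Bs q)))\<^sup>2)"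
      using c by simp
    also have "\<dots> \<le> h0 (u \<tau>)" by (rule h0_lower)
    finally have h: "ereal (\<eta> - ?w \<tau> \<bullet> Bs q) \<le> h0 (u \<tau>)" .
    have "f \<tau> = exp (- lam * \<tau>) * ((- R ?\<rho> - R' ?\<rho> * ?b) + (\<eta> - ?w \<tau> \<bullet> Bs q))"
      by (simp add: f_def algebra_simps)
    also have "\<dots> \<le> exp (- lam * \<tau>) * (- R (?\<rho> + ?b) + (\<eta> - ?w \<tau> \<bullet> Bs q))"
      using R_le[of "?\<rho> + ?b" ?\<rho>] by (intro mult_left_mono) auto
    finally have "ereal (f \<tau>) \<le> ereal (exp (- lam * \<tau>)) * (ereal (- R (?\<rho> + ?b)) + ereal (\<eta> - ?w \<tau> \<bullet> Bs q))"
      by simp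
    also have "\<dots> \<le> ereal (exp (- lam * \<tau>)) * (ereal (- R (?\<rho> + ?b)) + h0 (u \<tau>))"
      using h by (intro ereal_mult_left_mono add_left_mono) auto
    also have "\<dots> = running z u \<tau>" by (simp only: stationary_running[OF x adm \<tau>])
    finally show "ereal (f \<tau>) \<le> running z u \<tau>" .
  qed
  finally show ?thesis by (simp only: val)
qed

text \<open>The lower bound holds for all controls, the upper one for the constant control, and they
  agree to first order at x. Both are finite at every z, which gives the second claim; the
  uniqueness proof relies on it.\<close>

theorem value_at_costate_equilibrium:
  assumes x: "stationary x d" and d: "d = G (- Bs q)" and q: "q = (- R' (blinfun_apply x \<alpha>)) *\<^sub>R \<pi>"
  shows "has_V_derivative \<Psi> q x" and "\<And>z. \<bar>val z\<bar> \<noteq> \<infinity>"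
proof -
  obtain \<eta> where \<eta>: "h0 d = ereal \<eta>" using h0_attained d by auto
  let ?\<rho> = "blinfun_apply x \<alpha>"
  define l where "l = (\<eta> - R ?\<rho>) / lam"
  define C where "C = K * (norm \<alpha>)\<^sup>2 / lam"
  have lower: "ereal (l + blinfun_apply (z - x) q) \<le> val z" for z
    unfolding val_def l_def using cost_lower_bound[OF x d q \<eta>] by (intro INF_greatest)
  have upper: "val z \<le> ereal (l + blinfun_apply (z - x) q + C * (norm (z - x))\<^sup>2)" for z
  proof -
    have "val z \<le> J z (\<lambda>_. d)" unfolding val_def by (intro INF_lower Lp_controls_const lam p)
    also have "\<dots> \<le> ereal (l + blinfun_apply (z - x) q + C * (norm (z - x))\<^sup>2)"
      using cost_upper_bound[OF x \<eta>, of z] by (simp add: l_def C_def q blinfun.scaleR_right blinfun.minus_right)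
    finally show ?thesis .
  qed
  show fin: "\<bar>val z\<bar> \<noteq> \<infinity>" for z using lower[of z] upper[of z] by auto
  have bounds: "l + blinfun_apply (z - x) q \<le> \<Psi> z" "\<Psi> z \<le> l + blinfun_apply (z - x) q + C * (norm (z - x))\<^sup>2" for z
    using lower[of z] upper[of z] fin[of z] unfolding \<Psi>_val by (cases "val z"; simp)+
  have "\<Psi> x = l" using bounds[of x] by simp
  have C: "0 \<le> C" using K lam by (simp add: C_def)
  show "has_V_derivative \<Psi> q x"
    unfolding has_V_derivative_def
  proof (rule has_derivativeI_sandwich[of 1])
    show "bounded_linear (\<lambda>z. blinfun_apply z q)" by (rule blinfun.bounded_linear_left)
    fix y assume "y \<noteq> x"
    have "\<bar>\<Psi> y - \<Psi> x - blinfun_apply (y - x) q\<bar> \<le> C * (norm (y - x))\<^sup>2"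
      using bounds[of y] \<open>\<Psi> x = l\<close> by simp
    then show "norm (\<Psi> y - \<Psi> x - blinfun_apply (y - x) q) / norm (y - x) \<le> C * norm (y - x)"
      using \<open>y \<noteq> x\<close> by (simp add: divide_le_eq power2_eq_square mult.assoc)
  next
    have "((\<lambda>y. C * norm (y - x)) \<longlongrightarrow> C * norm (x - x)) (at x)" by (intro tendsto_intros)
    then show "((\<lambda>y. C * norm (y - x)) \<longlongrightarrow> 0) (at x)" by simp
  qed simp
qed

section \<open>Convexity of the cost and the tangent bound at a point of differentiability\<close>

lemma R_concave:
  assumes "0 \<le> s" "s \<le> 1"
  shows "(1 - s) * R a + s * R b \<le> R ((1 - s) * a + s * b)"
proof -
  let ?m = "(1 - s) * a + s * b"
  have "(1 - s) * R a + s * R b \<le> (1 - s) * (R ?m + R' ?m * (a - ?m)) + s * (R ?m + R' ?m * (b - ?m))"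
    using assms by (intro add_mono mult_left_mono R_le) auto
  also have "\<dots> = R ?m" by (simp add: algebra_simps)
  finally show ?thesis .
qed

text \<open>The trajectory is affine in the pair of initial state and control, while -R and h0 are
  convex.\<close>

lemma cost_convex:
  assumes u: "u \<in> Lp_controls p lam" and v: "v \<in> Lp_controls p lam" and s: "0 < s" "s < 1"
    and Jx: "J x u = ereal a" and Jz: "J z v = ereal b"
  shows "J ((1 - s) *\<^sub>R x + s *\<^sub>R z) (\<lambda>\<tau>. (1 - s) *\<^sub>R u \<tau> + s *\<^sub>R v \<tau>) \<le> ereal ((1 - s) * a + s * b)"
proof -
  let ?w = "\<lambda>\<tau>. (1 - s) *\<^sub>R u \<tau> + s *\<^sub>R v \<tau>" and ?y = "(1 - s) *\<^sub>R x + s *\<^sub>R z"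
  have adm: "admissible u" "admissible v" using u v by (auto intro: Lp_controls_admissible)
  have w: "admissible ?w"
    using Lp_controls_convex[OF u v _ _ p, of s] s by (intro Lp_controls_admissible) auto
  obtain f where f: "integrable half_line f" "AE \<tau> in half_line. running x u \<tau> = ereal (f \<tau>)" "ereal a = ereal (LINT \<tau>|half_line. f \<tau>)"
    using ext_integral_finite[OF running_measurable[OF u], of x] Jx unfolding J_running by (metis PInfty_neq_ereal(1) abs_ereal.simps(1))
  obtain g where g: "integrable half_line g" "AE \<tau> in half_line. running z v \<tau> = ereal (g \<tau>)" "ereal b = ereal (LINT \<tau>|half_line. g \<tau>)"
    using ext_integral_finite[OF running_measurable[OF v], of z] Jz unfolding J_running by (metis PInfty_neq_ereal(1) abs_ereal.simps(1))
  have "J ?y ?w \<le> ext_integral half_line (\<lambda>\<tau>. ereal ((1 - s) * f \<tau> + s * g \<tau>))"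
    unfolding J_running
  proof (rule ext_integral_mono)
    have "AE \<tau> in half_line. 0 < \<tau>" using AE_space[of half_line] by simp
    then show "AE \<tau> in half_line. running ?y ?w \<tau> \<le> ereal ((1 - s) * f \<tau> + s * g \<tau>)"
      using f(2) g(2)
    proof eventually_elim
      case (elim \<tau>)
      let ?e = "exp (- lam * \<tau>)"
      let ?A = "blinfun_apply (blinfun_apply (T \<tau>) x) \<alpha> + conv \<alpha> u \<tau>"
      let ?B = "blinfun_apply (blinfun_apply (T \<tau>) z) \<alpha> + conv \<alpha> v \<tau>"
      let ?r = "f \<tau> / ?e - - R ?A" and ?q = "g \<tau> / ?e - - R ?B"
      \<comment> \<open>A finite running cost determines h0 of the control as a real number, so that
        convexity can be used in the reals.\<close>
      have hu: "h0 (u \<tau>) = ereal ?r"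
        using elim by (intro ereal_affine_cancel[of ?e]) (simp_all add: running_def g0_trajectory[OF adm(1)])
      have hv: "h0 (v \<tau>) = ereal ?q"
        using elim by (intro ereal_affine_cancel[of ?e]) (simp_all add: running_def g0_trajectory[OF adm(2)])
      have h: "h0 (?w \<tau>) \<le> ereal ((1 - s) * ?r + s * ?q)"
        using h0_convex s unfolding ereal_convex_def
        by (metis (no_types, lifting) hu hv plus_ereal.simps(1) times_ereal.simps(1))
      have pair: "blinfun_apply (blinfun_apply (T \<tau>) ?y) \<alpha> + conv \<alpha> ?w \<tau> = (1 - s) * ?A + s * ?B"
        by (simp add: conv_convex adm blinfun.add_right blinfun.add_left blinfun.scaleR_right blinfun.scaleR_left distrib_left)
      have g0: "g0 (trajectory T B ?y ?w \<tau>) \<le> (1 - s) * - R ?A + s * - R ?B"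
        using R_concave[of s ?A ?B] s elim unfolding g0_trajectory[OF w less_imp_le[OF elim(1)]] pair by simp
      have "running ?y ?w \<tau> \<le> ereal ?e * (ereal ((1 - s) * - R ?A + s * - R ?B) + ereal ((1 - s) * ?r + s * ?q))"
        unfolding running_def using g0 h by (intro ereal_mult_left_mono add_mono) auto
      also have "\<dots> = ereal (?e * ((1 - s) * (f \<tau> / ?e) + s * (g \<tau> / ?e)))"
        by (simp add: algebra_simps)
      also have "?e * ((1 - s) * (f \<tau> / ?e) + s * (g \<tau> / ?e)) = (1 - s) * f \<tau> + s * g \<tau>"
        by (simp add: distrib_left)
      finally show ?case .
    qed
  qed
  also have "\<dots> = ereal (LINT \<tau>|half_line. (1 - s) * f \<tau> + s * g \<tau>)"
    using f(1) g(1) by (intro ext_integral_real) auto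
  also have "(LINT \<tau>|half_line. (1 - s) * f \<tau> + s * g \<tau>) = (1 - s) * a + s * b"
    using f g by simp
  finally show ?thesis .
qed

lemma V_derivative_right_quotient:
  assumes "has_V_derivative \<Phi> q x"
  shows "((\<lambda>s. (\<Phi> (x + s *\<^sub>R y) - \<Phi> x) / s) \<longlongrightarrow> blinfun_apply y q) (at_right 0)"
proof -
  have "((\<lambda>s. x + s *\<^sub>R y) has_derivative (\<lambda>s. s *\<^sub>R y)) (at 0)"
    by (auto intro!: derivative_eq_intros)
  moreover have "(\<Phi> has_derivative (\<lambda>z. blinfun_apply z q)) (at (x + 0 *\<^sub>R y))"
    using assms by (simp add: has_V_derivative_def)
  ultimately have "((\<lambda>s. \<Phi> (x + s *\<^sub>R y)) has_derivative (\<lambda>s. blinfun_apply (s *\<^sub>R y) q)) (at 0)"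
    by (rule has_derivative_compose)
  moreover have "(\<lambda>s. blinfun_apply (s *\<^sub>R y) q) = (*) (blinfun_apply y q)"
    by (auto simp: blinfun.scaleR_left)
  ultimately have "((\<lambda>s. \<Phi> (x + s *\<^sub>R y)) has_field_derivative blinfun_apply y q) (at 0)"
    by (simp only: has_field_derivative_def)
  then have "((\<lambda>s. (\<Phi> (x + s *\<^sub>R y) - \<Phi> (x + 0 *\<^sub>R y)) / (s - 0)) \<longlongrightarrow> blinfun_apply y q) (at 0)"
    by (simp only: has_field_derivative_iff)
  then show ?thesis by (auto intro: tendsto_mono[OF at_le])
qed

text \<open>Mixing v with a nearly optimal control at x bounds \<Psi> along the segment from x to z
  by the chord that ends at the cost of v, not at \<Psi> z; comparing slopes at x gives the
  claim.\<close>

lemma cost_above_tangent: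
  assumes fin: "\<And>z. \<bar>val z\<bar> \<noteq> \<infinity>" and q: "has_V_derivative \<Psi> q x" and v: "v \<in> Lp_controls p lam"
  shows "ereal (\<Psi> x + blinfun_apply (z - x) q) \<le> J z v"
proof (cases "J z v = \<infinity>")
  case False
  have val: "val y = ereal (\<Psi> y)" for y using fin[of y] by (simp add: \<Psi>_val ereal_real')
  have "val z \<le> J z v" unfolding val_def by (rule INF_lower[OF v])
  then obtain b where b: "J z v = ereal b" using False val[of z] by (cases "J z v") auto
  have convex: "\<Psi> (x + s *\<^sub>R (z - x)) \<le> (1 - s) * \<Psi> x + s * b" if s: "0 < s" "s < 1" for s
  proof (rule field_le_epsilon)
    fix e :: real assume "0 < e"
    have "val x < ereal (\<Psi> x + e)" using \<open>0 < e\<close> by (simp add: val)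
    then obtain u where u: "u \<in> Lp_controls p lam" "J x u < ereal (\<Psi> x + e)"
      unfolding val_def INF_less_iff by blast
    have "val x \<le> J x u" unfolding val_def by (rule INF_lower[OF u(1)])
    then obtain a where a: "J x u = ereal a" using u(2) val[of x] by (cases "J x u") auto
    have "x + s *\<^sub>R (z - x) = (1 - s) *\<^sub>R x + s *\<^sub>R z" by (simp add: algebra_simps)
    then have "val (x + s *\<^sub>R (z - x)) \<le> J ((1 - s) *\<^sub>R x + s *\<^sub>R z) (\<lambda>\<tau>. (1 - s) *\<^sub>R u \<tau> + s *\<^sub>R v \<tau>)"
      unfolding val_def using Lp_controls_convex[OF u(1) v _ _ p, of s] s by (auto intro: INF_lower)
    also have "\<dots> \<le> ereal ((1 - s) * a + s * b)" by (rule cost_convex[OF u(1) v s a b])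
    finally have "\<Psi> (x + s *\<^sub>R (z - x)) \<le> (1 - s) * a + s * b" by (simp add: val)
    also have "(1 - s) * a \<le> (1 - s) * (\<Psi> x + e)" using u(2) a s by (intro mult_left_mono) auto
    also have "(1 - s) * (\<Psi> x + e) \<le> (1 - s) * \<Psi> x + e"
      using s \<open>0 < e\<close> by (simp add: algebra_simps)
    finally show "\<Psi> (x + s *\<^sub>R (z - x)) \<le> (1 - s) * \<Psi> x + s * b + e" by simp
  qed
  have "blinfun_apply (z - x) q \<le> b - \<Psi> x"
  proof (rule tendsto_upperbound[OF V_derivative_right_quotient[OF q]])
    have "\<forall>\<^sub>F s in at_right (0::real). s < 1" by (rule eventually_at_right_real[of 0 1, simplified, THEN eventually_mono]) auto
    then show "\<forall>\<^sub>F s in at_right 0. (\<Psi> (x + s *\<^sub>R (z - x)) - \<Psi> x) / s \<le> b - \<Psi> x"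
      using eventually_at_right_less[of "0::real"]
    proof eventually_elim
      case (elim s)
      then have "\<Psi> (x + s *\<^sub>R (z - x)) - \<Psi> x \<le> (b - \<Psi> x) * s"
        using convex[of s] by (simp add: left_diff_distrib right_diff_distrib mult.commute)
      then show ?case using elim by (simp only: pos_divide_le_eq)
    qed
  qed simp
  then show ?thesis by (simp add: b)
qed simp

text \<open>For a contraction semigroup on a Hilbert space, strong continuity passes to the adjoint:
  \<open>|S q - q|\<^sup>2 \<le> 2|q|\<^sup>2 - 2(q|S q)\<close>.\<close>

lemma adjoint_strongly_continuous:
  assumes "0 < e"
  obtains \<delta> where "0 < \<delta>" "\<And>r y. 0 \<le> r \<Longrightarrow> r \<le> \<delta> \<Longrightarrow> \<bar>blinfun_apply (blinfun_apply (T r) y) q - blinfun_apply y q\<bar> \<le> e * norm y"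
proof -
  have "continuous (at 0 within {0..}) (\<lambda>t. blinfun_apply (blinfun_apply (T t) (Riesz_dual q)) q)"
    using pairing_continuous by (auto simp: continuous_on_eq_continuous_within)
  then obtain d where d: "0 < d" "\<And>r. 0 \<le> r \<Longrightarrow> r < d \<Longrightarrow>
      \<bar>blinfun_apply (blinfun_apply (T r) (Riesz_dual q)) q - q \<bullet> q\<bar> < e\<^sup>2 / 2"
    unfolding continuous_within_eps_delta using assms
    by (auto simp: dist_real_def Riesz_dual_apply dest!: spec[of _ "e\<^sup>2 / 2"])
  show ?thesis
  proof (rule that[of "d / 2"])
    fix r y assume r: "0 \<le> r" "r \<le> d / 2"
    obtain w where w: "\<And>x. blinfun_apply (blinfun_apply (T r) x) q = blinfun_apply x w" and nw: "norm w \<le> norm (T r) * norm q"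
      using Hilbert_adjoint[of "T r" q] by blast
    have "norm w \<le> norm q" using nw contraction[OF r(1)] mult_right_mono[of "norm (T r)" 1 "norm q"] by simp
    then have "w \<bullet> w \<le> q \<bullet> q" by (simp add: norm_le)
    moreover have "\<bar>w \<bullet> q - q \<bullet> q\<bar> < e\<^sup>2 / 2"
      using d(2)[of r] r d(1) by (simp add: w Riesz_dual_apply)
    then have "q \<bullet> q - w \<bullet> q < e\<^sup>2 / 2" by linarith
    moreover have "(norm (w - q))\<^sup>2 = w \<bullet> w + q \<bullet> q - 2 * (w \<bullet> q)"
      unfolding power2_norm_eq_inner by (simp add: inner_diff inner_commute[of q w])
    ultimately have "(norm (w - q))\<^sup>2 \<le> e\<^sup>2" by linarith
    then have "norm (w - q) \<le> e" using assms power2_le_imp_le by fastforce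
    then show "\<bar>blinfun_apply (blinfun_apply (T r) y) q - blinfun_apply y q\<bar> \<le> e * norm y"
      using abs_dual_le[of y "w - q"] mult_left_mono[of "norm (w - q)" e "norm y"]
      by (simp add: w blinfun.diff_right mult.commute)
  qed (use d in simp)
qed

text \<open>The cost of a control that is optimal at x up to t^2 is split at time t: afterwards the
  tangent bound at the state reached applies, before it the strong convexity of h0 around d. The
  pairing of q with the state reached cancels the linear term of h0; the remaining errors, including
  the response of R, amount after integration to E |u - d|, and completing the square leaves a
  multiple of E^2 / c.\<close>

lemma dynamic_programming_step:
  assumes x: "stationary x d" and d: "d = G (- Bs q)" and \<eta>: "h0 d = ereal \<eta>"
    and tangent: "\<And>z v. v \<in> Lp_controls p lam \<Longrightarrow> ereal (\<Psi> x + blinfun_apply (z - x) q) \<le> J z v"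
    and val_x: "val x = ereal (\<Psi> x)"
    and t: "0 < t" "t \<le> 1" and e: "0 \<le> e"
    and cont: "\<And>r y. 0 \<le> r \<Longrightarrow> r \<le> t \<Longrightarrow> \<bar>blinfun_apply (blinfun_apply (T r) y) q - blinfun_apply y q\<bar> \<le> e * norm y"
    and E: "E = (\<bar>R' (blinfun_apply x \<alpha>)\<bar> * \<beta> * norm \<alpha> + \<beta> * lam * norm q) * t + \<beta> * e"
  shows "(1 - exp (- lam * t)) * ((\<eta> - R (blinfun_apply x \<alpha>)) / lam - \<Psi> x) \<le> t\<^sup>2 + t * (E\<^sup>2 * exp lam / (4 * c))"
proof -
  let ?\<rho> = "blinfun_apply x \<alpha>"
  define l where "l = \<eta> - R ?\<rho>"
  define \<kappa> where "\<kappa> = \<bar>R' ?\<rho>\<bar> * \<beta> * norm \<alpha>"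
  define m where "m = \<beta> * (e + lam * t * norm q)"
  define Q where "Q = E\<^sup>2 * exp lam / (4 * c)"
  have E_eq: "E = \<kappa> * t + m" by (simp add: E \<kappa>_def m_def algebra_simps)
  have \<kappa>: "0 \<le> \<kappa>" by (simp add: \<kappa>_def \<beta>_nonneg)
  have "val x < ereal (\<Psi> x + t\<^sup>2)" using t by (simp add: val_x)
  then obtain u where u: "u \<in> Lp_controls p lam" "J x u < ereal (\<Psi> x + t\<^sup>2)"
    unfolding val_def INF_less_iff by blast
  have "val x \<le> J x u" unfolding val_def by (rule INF_lower[OF u(1)])
  then have fin: "\<bar>ext_integral half_line (running x u)\<bar> \<noteq> \<infinity>"
    using u(2) val_x unfolding J_running[symmetric] by (cases "J x u") auto
  obtain f where f: "integrable half_line f" "AE \<tau> in half_line. running x u \<tau> = ereal (f \<tau>)" "J x u = ereal (LINT \<tau>|half_line. f \<tau>)"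
    unfolding J_running by (rule ext_integral_finite[OF running_measurable[OF u(1)] fin]) blast
  have adm: "admissible u" by (rule Lp_controls_admissible[OF u(1)])
  let ?w = "\<lambda>\<sigma>. u \<sigma> - d"
  have w: "admissible ?w" by (intro admissible_diff adm admissible_const)
  let ?i = "\<lambda>\<tau>. indicator {..<t} \<tau> :: real"
  define I where "I = (LINT \<sigma>|half_line. ?i \<sigma> * norm (?w \<sigma>))"
  have I_int: "integrable half_line (\<lambda>\<sigma>. ?i \<sigma> * norm (?w \<sigma>))" by (rule admissible_truncated[OF w])
  have t0: "0 \<le> t" using t by simp
  note split = half_line_integral_split[OF f(1) t0]
  let ?k = "\<lambda>\<tau>. ?i \<tau> * kernel q (t - \<tau>) (?w \<tau>)"
  have k_int: "integrable half_line ?k" by (rule conv_integrable[OF w])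

  have tail: "exp (- lam * t) * (\<Psi> x + conv q ?w t) \<le> (LINT \<tau>|half_line. indicator {t<..} \<tau> * f \<tau>)"
  proof -
    let ?u = "\<lambda>\<sigma>. u (t + \<sigma>)" and ?y = "trajectory T B x u t"
    have u': "?u \<in> Lp_controls p lam" by (rule Lp_controls_translate[OF u(1) t0 p])
    have int: "integrable half_line (\<lambda>\<tau>. f (t + \<tau>))"
      using half_line_integral_translate(1)[OF borel_measurable_integrable[OF f(1)] t0] split(2) by simp
    have "AE \<tau> in half_line. 0 < \<tau>" using AE_space[of half_line] by simp
    then have "AE \<tau> in half_line. running ?y ?u \<tau> = ereal (exp (lam * t) * f (t + \<tau>))"
      using half_line_AE_translate[OF f(2) t0]
    proof eventually_elim
      case (elim \<tau>)
      have exp: "exp (- lam * \<tau>) = exp (lam * t) * exp (- lam * (t + \<tau>))" by (simp add: mult_exp_exp algebra_simps)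
      have "running ?y ?u \<tau> = ereal (exp (lam * t)) * running x u (t + \<tau>)"
        unfolding running_def exp times_ereal.simps(1)[symmetric] trajectory_translate[OF u(1) t0 less_imp_le[OF elim(1)]]
        by (simp only: mult.assoc)
      then show ?case by (simp add: elim)
    qed
    then have "J ?y ?u = ext_integral half_line (\<lambda>\<tau>. ereal (exp (lam * t) * f (t + \<tau>)))"
      unfolding J_running by (rule ext_integral_cong)
    also have "\<dots> = ereal (exp (lam * t) * (LINT \<tau>|half_line. f (t + \<tau>)))"
      using ext_integral_real[OF integrable_mult_right[OF int, of "exp (lam * t)"]] by simp
    finally have "\<Psi> x + blinfun_apply (?y - x) q \<le> exp (lam * t) * (LINT \<tau>|half_line. f (t + \<tau>))"
      using tangent[OF u', of ?y] by simp
    moreover have "blinfun_apply (?y - x) q = conv q ?w t"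
      using stationary_pairing[OF x adm t0, of x q] by (simp add: blinfun.diff_left)
    ultimately have "exp (- lam * t) * (\<Psi> x + conv q ?w t) \<le>
        exp (- lam * t) * (exp (lam * t) * (LINT \<tau>|half_line. f (t + \<tau>)))"
      by (intro mult_left_mono) auto
    also have "\<dots> = (LINT \<tau>|half_line. f (t + \<tau>))" by (simp add: mult.assoc[symmetric] mult_exp_exp)
    also have "\<dots> = (LINT \<tau>|half_line. indicator {t<..} \<tau> * f \<tau>)"
      by (rule half_line_integral_translate(2)[OF borel_measurable_integrable[OF f(1)] t0])
    finally show ?thesis .
  qed

  \<comment> \<open>At each time before t the response of R is at most \<kappa> \<open>I\<close>,
    where \<open>I\<close> is the total deviation up to t. The added term \<kappa> t |u - d| has the
    same integral \<kappa> t \<open>I\<close>, so the two cancel: a nonlocal error is exchanged for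
    a pointwise one that strong convexity can absorb.\<close>
  define b where "b \<tau> = l * (?i \<tau> * exp (- lam * \<tau>)) + \<kappa> * t * (?i \<tau> * norm (?w \<tau>)) - (\<kappa> * I + Q) * ?i \<tau>" for \<tau>
  have pointwise: "AE \<tau> in half_line. b \<tau> \<le> ?i \<tau> * f \<tau> + exp (- lam * t) * ?k \<tau>"
  proof -
    have "AE \<tau> in half_line. 0 < \<tau>" using AE_space[of half_line] by simp
    then show ?thesis using f(2)
    proof eventually_elim
      case (elim \<tau>)
      show ?case
      proof (cases "\<tau> < t")
        case True
        let ?e = "exp (- lam * \<tau>)" and ?n = "norm (?w \<tau>)" and ?C = "conv \<alpha> ?w \<tau>"
        have \<tau>: "0 \<le> \<tau>" using elim by simp
        \<comment> \<open>The lower bound uses t \<le> 1 and is the origin of exp lam in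
          \<open>Q\<close>.\<close>
        have e1: "?e \<le> 1" "exp (- lam) \<le> ?e" "0 < ?e" using lam \<tau> True t by auto
        have h: "ereal (\<eta> - ?w \<tau> \<bullet> Bs q + c * ?n\<^sup>2) \<le> h0 (u \<tau>)"
        proof -
          have "\<eta> = (- Bs q) \<bullet> d - hs (- Bs q)" using h0_attained[of "- Bs q"] \<eta> d by simp
          then have "\<eta> - ?w \<tau> \<bullet> Bs q + c * ?n\<^sup>2 = (- Bs q) \<bullet> u \<tau> - hs (- Bs q) + c * (norm (u \<tau> - G (- Bs q)))\<^sup>2"
            by (simp add: inner_diff_left inner_diff_right inner_commute d)
          then show ?thesis using h0_lower[of "- Bs q" "u \<tau>"] by simp
        qed
        have run: "running x u \<tau> = ereal ?e * (ereal (- R (?\<rho> + ?C)) + h0 (u \<tau>))"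
          unfolding stationary_running[OF x adm \<tau>] by simp
        have "h0 (u \<tau>) = ereal (f \<tau> / ?e - - R (?\<rho> + ?C))"
          using elim(2) by (intro ereal_affine_cancel[of ?e]) (simp_all add: run)
        then have "\<eta> - ?w \<tau> \<bullet> Bs q + c * ?n\<^sup>2 \<le> f \<tau> / ?e - - R (?\<rho> + ?C)" using h by simp
        then have "?e * (- R (?\<rho> + ?C) + (\<eta> - ?w \<tau> \<bullet> Bs q + c * ?n\<^sup>2)) \<le> f \<tau>"
          by (simp add: field_simps)
        moreover have "?e * (l - R' ?\<rho> * ?C - ?w \<tau> \<bullet> Bs q + c * ?n\<^sup>2) \<le> ?e * (- R (?\<rho> + ?C) + (\<eta> - ?w \<tau> \<bullet> Bs q + c * ?n\<^sup>2))"
          using R_le[of "?\<rho> + ?C" ?\<rho>] by (intro mult_left_mono) (auto simp: l_def)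
        ultimately have f1: "?e * l - ?e * (R' ?\<rho> * ?C) - ?e * (?w \<tau> \<bullet> Bs q) + ?e * (c * ?n\<^sup>2) \<le> f \<tau>"
          by (simp add: algebra_simps)
        have C_bound: "?e * (R' ?\<rho> * ?C) \<le> \<kappa> * I"
        proof -
          have "(LINT \<sigma>|half_line. indicator {..<\<tau>} \<sigma> * norm (?w \<sigma>)) \<le> I"
            unfolding I_def by (intro integral_mono admissible_truncated w) (use True in \<open>auto simp: indicator_def\<close>)
          then have "\<bar>?C\<bar> \<le> \<beta> * norm \<alpha> * I"
            using abs_conv_le[OF w, of \<alpha> \<tau>] mult_left_mono[of _ I "\<beta> * norm \<alpha>"] \<beta>_nonneg
            by (meson mult_nonneg_nonneg norm_ge_zero order_trans)
          then have "\<bar>R' ?\<rho>\<bar> * \<bar>?C\<bar> \<le> \<bar>R' ?\<rho>\<bar> * (\<beta> * norm \<alpha> * I)" by (intro mult_left_mono) auto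
          then have *: "\<bar>R' ?\<rho> * ?C\<bar> \<le> \<kappa> * I" by (simp add: \<kappa>_def abs_mult mult.assoc)
          have "?e * (R' ?\<rho> * ?C) \<le> ?e * \<bar>R' ?\<rho> * ?C\<bar>" by (intro mult_left_mono) auto
          also have "\<dots> \<le> 1 * \<bar>R' ?\<rho> * ?C\<bar>" using e1 by (intro mult_right_mono) auto
          finally show ?thesis using * by simp
        qed
        \<comment> \<open>In the tail the linear term carries the discount at t and the semigroup at
          t - \<tau>. Replacing these costs lam t |q| and e respectively, per unit of |B w|;
          together they form \<open>m\<close>.\<close>
        have k_bound: "?e * (?w \<tau> \<bullet> Bs q) - exp (- lam * t) * kernel q (t - \<tau>) (?w \<tau>) \<le> m * ?n"
        proof -
          let ?et = "exp (- lam * t)" and ?y = "B (?w \<tau>)"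
          have y: "norm ?y \<le> \<beta> * ?n" by (rule norm_B_le)
          have eq: "?w \<tau> \<bullet> Bs q = blinfun_apply ?y q" by (simp add: B_apply)
          have ker: "\<bar>kernel q (t - \<tau>) (?w \<tau>) - blinfun_apply ?y q\<bar> \<le> e * norm ?y"
            using cont[of "t - \<tau>" ?y] True \<tau> by (simp add: kernel_def)
          have et: "?et \<le> 1" "0 < ?et" "0 \<le> ?e - ?et" "?e - ?et \<le> lam * t"
          proof -
            show "?et \<le> 1" "0 < ?et" "0 \<le> ?e - ?et" using lam t True by auto
            show "?e - ?et \<le> lam * t" using e1(1) exp_ge_add_one_self[of "- lam * t"] by linarith
          qed
          have "?e * blinfun_apply ?y q - ?et * kernel q (t - \<tau>) (?w \<tau>)
              = (?e - ?et) * blinfun_apply ?y q - ?et * (kernel q (t - \<tau>) (?w \<tau>) - blinfun_apply ?y q)"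
            by (simp add: algebra_simps)
          also have "\<dots> \<le> \<bar>(?e - ?et) * blinfun_apply ?y q\<bar> + \<bar>?et * (kernel q (t - \<tau>) (?w \<tau>) - blinfun_apply ?y q)\<bar>"
            by linarith
          also have "\<dots> = (?e - ?et) * \<bar>blinfun_apply ?y q\<bar> + ?et * \<bar>kernel q (t - \<tau>) (?w \<tau>) - blinfun_apply ?y q\<bar>"
            using et by (simp add: abs_mult)
          also have "\<dots> \<le> lam * t * (norm ?y * norm q) + 1 * (e * norm ?y)"
            using et ker lam t by (intro add_mono mult_mono abs_dual_le) auto
          also have "\<dots> = norm ?y * (e + lam * t * norm q)" by (simp add: algebra_simps)
          also have "\<dots> \<le> \<beta> * ?n * (e + lam * t * norm q)"
            using e lam t by (intro mult_right_mono y) auto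
          finally show ?thesis by (simp add: eq m_def mult_ac)
        qed
        \<comment> \<open>The error terms are linear in \<open>|u - d|\<close> and are absorbed by strong convexity.\<close>
        have young: "E * ?n - Q \<le> ?e * (c * ?n\<^sup>2)"
        proof -
          define a where "a = exp (- lam) * c"
          have a: "0 < a" using c by (simp add: a_def)
          have "exp lam = 1 / exp (- lam)" by (simp add: exp_minus field_simps)
          then have "Q = E\<^sup>2 / (4 * a)" by (simp add: Q_def a_def)
          moreover have "0 \<le> (2 * a * ?n - E)\<^sup>2 / (4 * a)" using a by simp
          moreover have "(2 * a * ?n - E)\<^sup>2 / (4 * a) = a * ?n\<^sup>2 - E * ?n + E\<^sup>2 / (4 * a)"
            using a by (simp add: power2_eq_square field_simps)
          ultimately have "E * ?n - Q \<le> a * ?n\<^sup>2" by simp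
          also have "\<dots> \<le> ?e * (c * ?n\<^sup>2)"
            unfolding a_def mult.assoc using c e1 by (intro mult_right_mono) auto
          finally show ?thesis .
        qed
        have "b \<tau> = ?e * l + (\<kappa> * t * ?n - \<kappa> * I - Q)" using True by (simp add: b_def algebra_simps)
        also have "\<kappa> * t * ?n = E * ?n - m * ?n" by (simp add: E_eq algebra_simps)
        also have "?e * l + (E * ?n - m * ?n - \<kappa> * I - Q) \<le> f \<tau> + exp (- lam * t) * kernel q (t - \<tau>) (?w \<tau>)"
          using f1 C_bound k_bound young by linarith
        finally show ?thesis using True by simp
      qed (simp add: b_def)
    qed
  qed
  have exp_split: "(LINT \<tau>|half_line. ?i \<tau> * exp (- lam * \<tau>)) = (1 - exp (- lam * t)) / lam"
    "integrable half_line (\<lambda>\<tau>. ?i \<tau> * exp (- lam * \<tau>))"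
  proof -
    note exp_int = integrable_exp_Ioi[OF lam]
    show "integrable half_line (\<lambda>\<tau>. ?i \<tau> * exp (- lam * \<tau>))" by (rule half_line_integral_split(1)[OF exp_int(1) t0])
    have "(LINT \<tau>|half_line. indicator {t<..} \<tau> * exp (- lam * \<tau>)) = (LINT \<tau>|half_line. exp (- lam * (t + \<tau>)))"
      by (rule half_line_integral_translate(2)[OF borel_measurable_integrable[OF exp_int(1)] t0, symmetric])
    also have "\<dots> = (LINT \<tau>|half_line. exp (- lam * t) * exp (- lam * \<tau>))"
      by (simp add: mult_exp_exp algebra_simps)
    also have "\<dots> = exp (- lam * t) / lam" using exp_int by simp
    finally show "(LINT \<tau>|half_line. ?i \<tau> * exp (- lam * \<tau>)) = (1 - exp (- lam * t)) / lam"
      using half_line_integral_split(3)[OF exp_int(1) t0] exp_int(2) by (simp add: diff_divide_distrib)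
  qed
  have ind: "integrable half_line ?i" "(LINT \<tau>|half_line. ?i \<tau>) = t"
  proof -
    have "integrable half_line (\<lambda>\<tau>. exp (lam * t) * exp (- lam * \<tau>))"
      using integrable_exp_Ioi(1)[OF lam] by (rule integrable_mult_right)
    then show 1: "integrable half_line ?i"
    proof (rule Bochner_Integration.integrable_bound)
      show "?i \<in> borel_measurable half_line" by measurable
      have "?i \<tau> \<le> exp (lam * t) * exp (- lam * \<tau>)" for \<tau>
        using lam by (auto simp: indicator_def mult_exp_exp)
      then show "AE \<tau> in half_line. norm (?i \<tau>) \<le> norm (exp (lam * t) * exp (- lam * \<tau>))" by simp
    qed
    have "(LINT \<tau>|half_line. ?i \<tau>) = (LINT \<tau>|lebesgue_on {0..t}. 1)"
      using lebesgue_on_Icc_eq_half_line[of t "\<lambda>_. 1"] 1 by simp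
    also have "\<dots> = t" using t by (simp add: measure_restrict_space)
    finally show "(LINT \<tau>|half_line. ?i \<tau>) = t" .
  qed
  have "(LINT \<tau>|half_line. b \<tau>) \<le> (LINT \<tau>|half_line. ?i \<tau> * f \<tau> + exp (- lam * t) * ?k \<tau>)"
    unfolding b_def
    by (rule integral_mono_AE) (use pointwise exp_split(2) ind(1) I_int split(1) k_int in \<open>auto simp: b_def\<close>)
  also have "\<dots> = (LINT \<tau>|half_line. ?i \<tau> * f \<tau>) + exp (- lam * t) * conv q ?w t"
    using split(1) k_int by (simp add: conv_def)
  finally have head: "(LINT \<tau>|half_line. b \<tau>) - exp (- lam * t) * conv q ?w t \<le> (LINT \<tau>|half_line. ?i \<tau> * f \<tau>)" by simp
  have "(LINT \<tau>|half_line. b \<tau>) = l * ((1 - exp (- lam * t)) / lam) + \<kappa> * t * I - (\<kappa> * I + Q) * t"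
    unfolding b_def using exp_split ind I_int by (simp add: I_def)
  also have "\<dots> = (1 - exp (- lam * t)) * (l / lam) - t * Q" using lam by (simp add: field_simps)
  finally have b_val: "(LINT \<tau>|half_line. b \<tau>) = (1 - exp (- lam * t)) * (l / lam) - t * Q" .
  have "(LINT \<tau>|half_line. f \<tau>) < \<Psi> x + t\<^sup>2" using u(2) f(3) by simp
  then have "(1 - exp (- lam * t)) * (l / lam) - t * Q + exp (- lam * t) * \<Psi> x \<le> \<Psi> x + t\<^sup>2"
    using head tail b_val split(3) by (simp add: distrib_left)
  then show ?thesis unfolding l_def[symmetric] Q_def[symmetric] by (simp add: left_diff_distrib right_diff_distrib)
qed

text \<open>Letting t and e tend to 0 in \<open>dynamic_programming_step\<close> shows that the
  constant control is optimal at x. The upper bound for its cost from other states then touches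
  \<Psi> at x, and its slope there is the costate.\<close>

theorem equilibrium_costate:
  assumes x: "stationary x d" and d: "d = G (- Bs q)" and q: "has_V_derivative \<Psi> q x"
    and fin: "\<And>z. \<bar>val z\<bar> \<noteq> \<infinity>"
  shows "q = (- R' (blinfun_apply x \<alpha>)) *\<^sub>R \<pi>"
proof -
  obtain \<eta> where \<eta>: "h0 d = ereal \<eta>" using h0_attained d by auto
  let ?\<rho> = "blinfun_apply x \<alpha>"
  define l where "l = (\<eta> - R ?\<rho>) / lam"
  have val: "val y = ereal (\<Psi> y)" for y using fin[of y] by (simp add: \<Psi>_val ereal_real')
  have tangent: "ereal (\<Psi> x + blinfun_apply (z - x) q) \<le> J z v" if "v \<in> Lp_controls p lam" for z v
    by (rule cost_above_tangent[OF fin q that])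
  have l_le: "l \<le> \<Psi> x"
  proof -
    define A where "A = \<bar>R' ?\<rho>\<bar> * \<beta> * norm \<alpha> + \<beta> * lam * norm q"
    define Q where "Q = 1 + (A + \<beta>)\<^sup>2 * exp lam / (4 * c)"
    have A: "0 \<le> A" using lam by (simp add: A_def \<beta>_nonneg)
    have Q: "0 < Q" using c unfolding Q_def by (intro add_pos_nonneg) auto
    \<comment> \<open>With t \<le> e both parts of \<open>?E\<close> are of order e, so division by
      t leaves an excess of order e with the fixed constant \<open>Q\<close>.\<close>
    have small: "lam * exp (- lam) * (l - \<Psi> x) \<le> e * Q" if e: "0 < e" "e \<le> 1" and pos: "0 \<le> l - \<Psi> x" for e
    proof -
      obtain \<delta> where \<delta>: "0 < \<delta>" "\<And>r y. 0 \<le> r \<Longrightarrow> r \<le> \<delta> \<Longrightarrow> \<bar>blinfun_apply (blinfun_apply (T r) y) q - blinfun_apply y q\<bar> \<le> e * norm y"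
        using adjoint_strongly_continuous[OF e(1), of q] by blast
      define t where "t = min \<delta> e"
      have t: "0 < t" "t \<le> 1" "t \<le> e" "t \<le> \<delta>" using \<delta>(1) e by (auto simp: t_def)
      let ?E = "A * t + \<beta> * e"
      have step: "(1 - exp (- lam * t)) * (l - \<Psi> x) \<le> t\<^sup>2 + t * (?E\<^sup>2 * exp lam / (4 * c))"
        unfolding l_def
        by (rule dynamic_programming_step[OF x d \<eta> tangent val t(1,2), where e=e])
          (use \<delta>(2) t e in \<open>auto simp: A_def\<close>)
      have "lam * t * exp (- lam) \<le> 1 - exp (- lam * t)"
      proof -
        have "lam * t \<le> exp (lam * t) - 1" using exp_ge_add_one_self[of "lam * t"] by linarith
        then have "lam * t * exp (- lam * t) \<le> (exp (lam * t) - 1) * exp (- lam * t)" by (rule mult_right_mono) simp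
        also have "\<dots> = 1 - exp (- lam * t)" by (simp add: left_diff_distrib mult_exp_exp)
        finally have *: "lam * t * exp (- lam * t) \<le> 1 - exp (- lam * t)" .
        have "lam * t * exp (- lam) \<le> lam * t * exp (- lam * t)" using lam t by (intro mult_left_mono) auto
        with * show ?thesis by simp
      qed
      from mult_right_mono[OF this pos]
      have "t * (lam * exp (- lam) * (l - \<Psi> x)) \<le> t\<^sup>2 + t * (?E\<^sup>2 * exp lam / (4 * c))"
        using step by (simp add: mult_ac)
      also have "\<dots> = t * (t + ?E\<^sup>2 * exp lam / (4 * c))" by (simp add: power2_eq_square distrib_left)
      finally have "lam * exp (- lam) * (l - \<Psi> x) \<le> t + ?E\<^sup>2 * exp lam / (4 * c)"
        using t(1) by (simp only: mult_le_cancel_left_pos)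
      also have "\<dots> \<le> e + e * ((A + \<beta>)\<^sup>2 * exp lam / (4 * c))"
      proof (intro add_mono t(3))
        have "?E \<le> (A + \<beta>) * e" using A t e by (simp add: distrib_right mult_left_mono)
        moreover have "0 \<le> ?E" using A t e \<beta>_nonneg by simp
        ultimately have "?E\<^sup>2 \<le> ((A + \<beta>) * e)\<^sup>2" by (intro power_mono)
        also have "\<dots> = (A + \<beta>)\<^sup>2 * (e * e)" by (simp add: power2_eq_square)
        also have "\<dots> \<le> (A + \<beta>)\<^sup>2 * (e * 1)" using e by (intro mult_left_mono) auto
        finally have "?E\<^sup>2 * (exp lam / (4 * c)) \<le> (A + \<beta>)\<^sup>2 * e * (exp lam / (4 * c))"
          using c by (intro mult_right_mono) auto
        then show "?E\<^sup>2 * exp lam / (4 * c) \<le> e * ((A + \<beta>)\<^sup>2 * exp lam / (4 * c))" by (simp add: mult_ac)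
      qed
      also have "\<dots> = e * Q" by (simp add: Q_def distrib_left)
      finally show ?thesis .
    qed
    show ?thesis
    proof (rule ccontr)
      assume "\<not> l \<le> \<Psi> x"
      then have D: "0 < l - \<Psi> x" by simp
      define a where "a = lam * exp (- lam) * (l - \<Psi> x)"
      have a: "0 < a" using D lam by (simp add: a_def)
      \<comment> \<open>Chosen so that e \<open>Q\<close> is at most a / 2, whereas
        \<open>small\<close> makes it at least a.\<close>
      define e where "e = min 1 (a / (2 * Q))"
      have "a \<le> e * Q" unfolding a_def by (rule small) (use a Q D in \<open>auto simp: e_def\<close>)
      also have "\<dots> \<le> a / (2 * Q) * Q" using Q by (intro mult_right_mono) (auto simp: e_def)
      also have "\<dots> = a / 2" using Q by simp
      finally show False using a by simp
    qed
  qed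
  let ?q = "(- R' ?\<rho>) *\<^sub>R \<pi>"
  have upper: "\<Psi> z \<le> l + blinfun_apply (z - x) ?q + K * (norm \<alpha>)\<^sup>2 / lam * (norm (z - x))\<^sup>2" for z
  proof -
    have "val z \<le> J z (\<lambda>_. d)" unfolding val_def by (intro INF_lower Lp_controls_const lam p)
    also note cost_upper_bound[OF x \<eta>, of z]
    finally show ?thesis by (simp add: val l_def blinfun.scaleR_right blinfun.minus_right)
  qed
  have le: "blinfun_apply y q \<le> blinfun_apply y ?q" for y :: "'v \<Rightarrow>\<^sub>L real"
  proof -
    let ?C = "K * (norm \<alpha>)\<^sup>2 / lam * (norm y)\<^sup>2"
    have "((\<lambda>s. blinfun_apply y ?q + s * ?C) \<longlongrightarrow> blinfun_apply y ?q + 0 * ?C) (at_right 0)"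
      by (intro tendsto_intros)
    moreover have "\<forall>\<^sub>F s in at_right 0. (\<Psi> (x + s *\<^sub>R y) - \<Psi> x) / s \<le> blinfun_apply y ?q + s * ?C"
      using eventually_at_right_less[of "0::real"]
    proof eventually_elim
      case (elim s)
      have "\<Psi> (x + s *\<^sub>R y) - \<Psi> x \<le> blinfun_apply (s *\<^sub>R y) ?q + K * (norm \<alpha>)\<^sup>2 / lam * (norm (s *\<^sub>R y))\<^sup>2"
        using upper[of "x + s *\<^sub>R y"] l_le by simp
      also have "\<dots> = (blinfun_apply y ?q + s * ?C) * s"
        using elim by (simp add: blinfun.scaleR_left power2_eq_square algebra_simps)
      finally show ?case using elim by (simp only: pos_divide_le_eq)
    qed
    ultimately have "blinfun_apply y q \<le> blinfun_apply y ?q + 0 * ?C"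
      using tendsto_le[OF trivial_limit_at_right_real _ V_derivative_right_quotient[OF q]] by blast
    then show ?thesis by simp
  qed
  \<comment> \<open>The inequality of slopes holds in every direction; the direction dual to the
    difference forces equality.\<close>
  have "blinfun_apply (Riesz_dual (q - ?q)) (q - ?q) \<le> 0"
    using le[of "Riesz_dual (q - ?q)"] unfolding blinfun.diff_right by simp
  then have "(q - ?q) \<bullet> (q - ?q) \<le> 0" by (simp only: Riesz_dual_apply)
  then have "(q - ?q) \<bullet> (q - ?q) = 0" using inner_ge_zero antisym by blast
  then show ?thesis by (simp only: inner_eq_zero_iff right_minus_eq)
qed

end

section \<open>Conjugate cost and existence of the equilibrium\<close>

text \<open>The Fenchel-Young inequality is used at the w that maximises (w - z | u - g) - L |w -
  z|^2. The maximum, |u - g|^2 / (4 L), is the gain over the tangent bound.\<close>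

lemma conjugate_strong_convexity:
  fixes h :: "'u::real_inner \<Rightarrow> ereal"
  assumes fin: "\<And>z. \<bar>conjugate h z\<bar> \<noteq> \<infinity>" and hs: "hs = (\<lambda>z. real_of_ereal (conjugate h z))"
    and quad: "\<And>w. hs w - hs z - (w - z) \<bullet> g \<le> L * (norm (w - z))\<^sup>2" and L: "0 < L"
  shows "ereal (z \<bullet> u - hs z + 1 / (4 * L) * (norm (u - g))\<^sup>2) \<le> h u"
proof -
  define w where "w = z + (1 / (2 * L)) *\<^sub>R (u - g)"
  have "ereal (w \<bullet> u) - h u \<le> conjugate h w" unfolding conjugate_def by (rule SUP_upper) simp
  also have "\<dots> = ereal (hs w)" using fin[of w] by (simp add: hs ereal_real')
  finally have young: "ereal (w \<bullet> u - hs w) \<le> h u" by (cases "h u") auto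
  have "(norm (w - z))\<^sup>2 = (norm (u - g))\<^sup>2 / (4 * L\<^sup>2)"
    by (simp add: w_def power_divide power_mult_distrib)
  then have "L * (norm (w - z))\<^sup>2 = (norm (u - g))\<^sup>2 / (4 * L)" using L by (simp add: power2_eq_square)
  moreover have "(w - z) \<bullet> u - (w - z) \<bullet> g = (norm (u - g))\<^sup>2 / (2 * L)"
    by (simp add: w_def power2_norm_eq_inner inner_diff_right diff_divide_distrib)
  moreover have "w \<bullet> u = z \<bullet> u + (w - z) \<bullet> u" by (simp add: inner_diff_left)
  moreover have "(norm (u - g))\<^sup>2 / (2 * L) = (norm (u - g))\<^sup>2 / (4 * L) + (norm (u - g))\<^sup>2 / (4 * L)" by simp
  moreover have "1 / (4 * L) * (norm (u - g))\<^sup>2 = (norm (u - g))\<^sup>2 / (4 * L)" by simp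
  ultimately have "z \<bullet> u - hs z + 1 / (4 * L) * (norm (u - g))\<^sup>2 \<le> w \<bullet> u - hs w"
    using quad[of w] by linarith
  then show ?thesis using young order_trans by (metis ereal_less_eq(3))
qed

text \<open>A maximising sequence of the conjugate converges to its gradient by strong convexity, hence the
  supremum is attained there by lower semicontinuity; Fenchel--Moreau biduality is not needed.\<close>

lemma conjugate_attained:
  fixes h :: "'u::real_inner \<Rightarrow> ereal"
  assumes fin: "\<And>z. \<bar>conjugate h z\<bar> \<noteq> \<infinity>" and hs: "hs = (\<lambda>z. real_of_ereal (conjugate h z))"
    and quad: "\<And>w. hs w - hs z - (w - z) \<bullet> g \<le> L * (norm (w - z))\<^sup>2" and L: "0 < L"
    and lsc: "lower_semicont h"
  shows "h g = ereal (z \<bullet> g - hs z)"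
proof (rule antisym)
  note strong = conjugate_strong_convexity[OF fin hs quad L]
  show "ereal (z \<bullet> g - hs z) \<le> h g" using strong[of g] by simp
  have conj: "conjugate h z = ereal (hs z)" using fin[of z] by (simp add: hs ereal_real')
  have "\<exists>u. ereal (hs z - 1 / real (Suc n)) < ereal (z \<bullet> u) - h u" for n
  proof -
    have "ereal (hs z - 1 / real (Suc n)) < conjugate h z" by (simp add: conj)
    then show ?thesis unfolding conjugate_def less_SUP_iff by blast
  qed
  then obtain u where u: "\<And>n. ereal (hs z - 1 / real (Suc n)) < ereal (z \<bullet> u n) - h (u n)" by metis
  have h_less: "h (u n) < ereal (z \<bullet> u n - hs z + 1 / real (Suc n))" for n
    using u[of n] by (cases "h (u n)") auto
  have sq: "(norm (u n - g))\<^sup>2 \<le> 4 * L * (1 / real (Suc n))" for n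
  proof -
    have "z \<bullet> u n - hs z + 1 / (4 * L) * (norm (u n - g))\<^sup>2 < z \<bullet> u n - hs z + 1 / real (Suc n)"
      using le_less_trans[OF strong[of "u n"] h_less[of n]] by simp
    then have "1 / (4 * L) * (norm (u n - g))\<^sup>2 < 1 / real (Suc n)" by simp
    then show ?thesis using L by (simp add: field_simps)
  qed
  have inv: "(\<lambda>n. 1 / real (Suc n)) \<longlonglongrightarrow> 0" by (rule LIMSEQ_Suc[OF lim_1_over_n])
  have "(\<lambda>n. (norm (u n - g))\<^sup>2) \<longlonglongrightarrow> 0"
  proof (rule tendsto_sandwich[OF _ _ tendsto_const])
    show "(\<lambda>n. 4 * L * (1 / real (Suc n))) \<longlonglongrightarrow> 0" using tendsto_mult_right_zero[OF inv] .
  qed (use sq in auto)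
  then have "(\<lambda>n. sqrt ((norm (u n - g))\<^sup>2)) \<longlonglongrightarrow> sqrt 0" by (rule tendsto_real_sqrt)
  then have lim: "u \<longlonglongrightarrow> g" by (simp add: tendsto_norm_zero_iff Lim_null[symmetric] LIM_zero_cancel)
  show "h g \<le> ereal (z \<bullet> g - hs z)"
  proof (rule ccontr)
    assume "\<not> h g \<le> ereal (z \<bullet> g - hs z)"
    then obtain r where r: "ereal (z \<bullet> g - hs z) < r" "r < h g" using dense not_le by metis
    obtain r' where r': "r = ereal r'" using r by (cases r) auto
    have "\<forall>\<^sub>F n in sequentially. r < h (u n)"
      using lsc r(2) lim unfolding lower_semicont_def filterlim_iff by blast
    then have "\<forall>\<^sub>F n in sequentially. r' \<le> z \<bullet> u n - hs z + 1 / real (Suc n)"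
    proof eventually_elim
      case (elim n)
      then have "ereal r' < ereal (z \<bullet> u n - hs z + 1 / real (Suc n))"
        using h_less[of n] unfolding r' by (rule less_trans)
      then show ?case by simp
    qed
    moreover have "(\<lambda>n. z \<bullet> u n - hs z + 1 / real (Suc n)) \<longlonglongrightarrow> z \<bullet> g - hs z + 0"
      by (intro tendsto_intros lim inv)
    ultimately have "r' \<le> z \<bullet> g - hs z + 0" by (intro tendsto_lowerbound) auto
    then show False using r(1) r' by simp
  qed
qed

text \<open>The Riesz theorem turns the derivative with values in the dual into \<open>grad\<close>.
  The Lipschitz constant is enlarged by 1 to be positive, as it will stand in a denominator.\<close>

lemma Sigma0_gradient:
  fixes f :: "'u::{real_inner,complete_space} \<Rightarrow> real"
  assumes "f \<in> Sigma0"
  obtains L where "0 < L" "\<And>z w. \<bar>f w - f z - (w - z) \<bullet> grad f z\<bar> \<le> L * (norm (w - z))\<^sup>2"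
    "\<And>z w. norm (grad f w - grad f z) \<le> L * norm (w - z)"
proof -
  obtain f' :: "'u \<Rightarrow> 'u \<Rightarrow>\<^sub>L real" and L where f': "\<And>x. (f has_derivative blinfun_apply (f' x)) (at x)"
    and L: "L-lipschitz_on UNIV f'"
    using assms unfolding Sigma0_def by blast
  have grad: "blinfun_apply (f' z) v = v \<bullet> grad f z" for z v
  proof -
    obtain w where w: "\<And>v. blinfun_apply (f' z) v = v \<bullet> w" by (rule Riesz_representation) blast
    have "GDERIV f z :> w" unfolding gderiv_def using f'[of z] by (simp add: w[abs_def])
    from grad_eq[OF this] w show ?thesis by simp
  qed
  have L0: "0 \<le> L" using L lipschitz_on_nonneg by blast
  show thesis
  proof (rule that[of "L + 1"])
    show "0 < L + 1" using L0 by simp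
    fix z w
    have "\<bar>f w - f z - (w - z) \<bullet> grad f z\<bar> \<le> L * (norm (w - z))\<^sup>2"
      using Taylor_lipschitz_derivative[OF f' L] by (simp add: grad)
    also have "\<dots> \<le> (L + 1) * (norm (w - z))\<^sup>2" by (intro mult_right_mono) auto
    finally show "\<bar>f w - f z - (w - z) \<bullet> grad f z\<bar> \<le> (L + 1) * (norm (w - z))\<^sup>2" .
    let ?d = "grad f w - grad f z"
    have "(norm ?d)\<^sup>2 = blinfun_apply (f' w - f' z) ?d"
      by (simp add: blinfun.diff_left grad power2_norm_eq_inner inner_diff_right)
    also have "\<dots> \<le> norm (f' w - f' z) * norm ?d" using norm_blinfun[of "f' w - f' z" ?d] by simp
    also have "\<dots> \<le> (L * norm (w - z)) * norm ?d"
      using L by (intro mult_right_mono) (auto simp: lipschitz_on_def dist_norm)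
    finally have "norm ?d * norm ?d \<le> (L * norm (w - z)) * norm ?d" by (simp add: power2_eq_square)
    then have "norm ?d \<le> L * norm (w - z)"
      using L0 by (cases "norm ?d = 0") (auto dest: mult_right_le_imp_le)
    also have "\<dots> \<le> (L + 1) * norm (w - z)" by (intro mult_right_mono) auto
    finally show "norm ?d \<le> (L + 1) * norm (w - z)" .
  qed
qed

text \<open>With k = |\<Phi> 0|, antitonicity gives \<Phi> (-k) \<ge> \<Phi> 0 \<ge> -k and \<Phi> k
  \<le> \<Phi> 0 \<le> k, so r - \<Phi> r changes sign on [-k, k].\<close>

lemma antitone_fixed_point:
  fixes \<Phi> :: "real \<Rightarrow> real"
  assumes cont: "continuous_on UNIV \<Phi>" and anti: "\<And>r s. r \<le> s \<Longrightarrow> \<Phi> s \<le> \<Phi> r"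
  shows "\<exists>r. \<Phi> r = r"
proof -
  let ?k = "\<bar>\<Phi> 0\<bar>"
  have "\<exists>r. - ?k \<le> r \<and> r \<le> ?k \<and> r - \<Phi> r = 0"
  proof (rule IVT')
    show "- ?k - \<Phi> (- ?k) \<le> 0" using anti[of "- ?k" 0] by simp
    show "0 \<le> ?k - \<Phi> ?k" using anti[of 0 ?k] by simp
    show "continuous_on {- ?k..?k} (\<lambda>r. r - \<Phi> r)"
      by (intro continuous_intros continuous_on_subset[OF cont]) auto
  qed simp
  then obtain r where "r - \<Phi> r = 0" by blast
  then have "\<Phi> r = r" by simp
  then show ?thesis by blast
qed

lemma concave_lipschitz_derivative:
  assumes R: "concave_on UNIV R" "\<forall>r. R field_differentiable (at r)" and L: "L-lipschitz_on UNIV (deriv R)"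
  shows "R s \<le> R r + deriv R r * (s - r)" "R r + deriv R r * (s - r) - L * (s - r)\<^sup>2 \<le> R s"
    and "r \<le> s \<Longrightarrow> deriv R s \<le> deriv R r" "continuous_on UNIV R" "continuous_on UNIV (deriv R)"
proof -
  have deriv: "(R has_real_derivative deriv R r) (at r)" for r
    using R(2) DERIV_deriv_iff_field_differentiable by blast
  have above: "R y \<le> R x + deriv R x * (y - x)" for x y
  proof -
    have "((\<lambda>x. - R x) has_real_derivative - deriv R x) (at x within UNIV)" by (intro derivative_intros deriv)
    then have "(- deriv R x) * (y - x) \<le> - R y - - R x"
      using R(1) by (intro convex_on_imp_above_tangent[of UNIV]) (auto simp: concave_on_def)
    then show ?thesis by simp
  qed
  then show "R s \<le> R r + deriv R r * (s - r)" .
  have lip: "\<bar>deriv R x - deriv R y\<bar> \<le> L * \<bar>x - y\<bar>" for x y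
    using L by (auto simp: lipschitz_on_def dist_real_def)
  \<comment> \<open>The tangent at s bounds R s from below with the slope at s; exchanging it for
    the slope at r costs L (s - r)^2.\<close>
  have "deriv R s * (r - s) \<ge> R r - R s" using above[of r s] by simp
  moreover have "(deriv R r - deriv R s) * (s - r) \<le> L * (s - r)\<^sup>2"
  proof -
    have "(deriv R r - deriv R s) * (s - r) \<le> \<bar>deriv R r - deriv R s\<bar> * \<bar>s - r\<bar>" by (metis abs_ge_self abs_mult)
    also have "\<dots> \<le> L * \<bar>r - s\<bar> * \<bar>s - r\<bar>" by (intro mult_right_mono lip) simp
    also have "\<dots> = L * (s - r)\<^sup>2" by (simp add: abs_minus_commute[of r s] power2_eq_square mult.assoc)
    finally show ?thesis .
  qed
  ultimately show "R r + deriv R r * (s - r) - L * (s - r)\<^sup>2 \<le> R s" by (simp add: algebra_simps)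
  show "deriv R s \<le> deriv R r" if "r \<le> s"
  proof (cases "r = s")
    case False
    have "0 \<le> (deriv R r - deriv R s) * (s - r)" using above[of r s] above[of s r] by (simp add: algebra_simps)
    then show ?thesis using that False by (simp add: zero_le_mult_iff)
  qed simp
  show "continuous_on UNIV R" using deriv DERIV_isCont by (auto simp: continuous_on_eq_continuous_at)
  show "continuous_on UNIV (deriv R)" using L by (rule lipschitz_on_continuous_on)
qed

section \<open>The pointwise order of H and the monotonicity of the maximisers\<close>

context age_spaces
begin

lemma inner_nonneg:
  assumes "AE s in M. 0 \<le> rH f s" "AE s in M. 0 \<le> rH g s"
  shows "0 \<le> f \<bullet> g"
  unfolding inner_rH using assms by (intro integral_nonneg_AE) (auto elim: eventually_elim2)

text \<open>\<open>m\<close> is taken as f + g - s, so that the sum is an identity in H and the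
  pointwise minimum follows from it.\<close>

lemma ex_rH_max_min:
  obtains s m where "AE x in M. rH s x = max (rH f x) (rH g x)" "AE x in M. rH m x = min (rH f x) (rH g x)" "s + m = f + g"
proof -
  have f: "square_integrable sbar (rH f)" and g: "square_integrable sbar (rH g)" by (rule rH_square_integrable)+
  have "square_integrable sbar (\<lambda>x. max (rH f x) (rH g x))"
    unfolding square_integrable_def
  proof
    show meas: "(\<lambda>x. max (rH f x) (rH g x)) \<in> borel_measurable M"
      using f g by (intro borel_measurable_max) (auto simp: square_integrable_def)
    show "integrable M (\<lambda>x. (max (rH f x) (rH g x))\<^sup>2)"
    proof (rule Bochner_Integration.integrable_bound)
      show "integrable M (\<lambda>x. (rH f x)\<^sup>2 + (rH g x)\<^sup>2)" using f g by (simp add: square_integrable_def)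
      show "(\<lambda>x. (max (rH f x) (rH g x))\<^sup>2) \<in> borel_measurable M" using meas by simp
      show "AE x in M. norm ((max (rH f x) (rH g x))\<^sup>2) \<le> norm ((rH f x)\<^sup>2 + (rH g x)\<^sup>2)"
        by (intro AE_I2) (auto simp: max_def)
    qed
  qed
  then obtain s where s: "AE x in M. rH s x = max (rH f x) (rH g x)" using ex_rH by blast
  let ?m = "f + 1 *\<^sub>R (g + (-1) *\<^sub>R s)"
  have "AE x in M. rH ?m x = min (rH f x) (rH g x)"
    using s rH_combination[of f 1 "g + (-1) *\<^sub>R s"] rH_combination[of g "-1" s]
    by eventually_elim (simp add: max_def min_def)
  then show thesis using s that[of s ?m] by simp
qed

lemma cost_h0_finite:
  assumes "\<bar>cost_h0 sbar rH c0 c1 u\<bar> \<noteq> \<infinity>" "c0 (fst u) \<noteq> - \<infinity>"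
  shows "\<bar>c0 (fst u)\<bar> \<noteq> \<infinity>" "\<bar>ext_integral M (\<lambda>s. c1 s (rH (snd u) s))\<bar> \<noteq> \<infinity>"
proof -
  show 1: "\<bar>c0 (fst u)\<bar> \<noteq> \<infinity>" using assms unfolding cost_h0_def by (cases "c0 (fst u)") auto
  show "\<bar>ext_integral M (\<lambda>s. c1 s (rH (snd u) s))\<bar> \<noteq> \<infinity>"
    using assms(1) 1 unfolding cost_h0_def
    by (cases "c0 (fst u)"; cases "ext_integral M (\<lambda>s. c1 s (rH (snd u) s))") auto
qed

text \<open>The cost is separable in age, hence modular for the pointwise lattice operations.\<close>

lemma cost_h0_modular:
  assumes fin: "\<bar>cost_h0 sbar rH c0 c1 u\<bar> \<noteq> \<infinity>" "\<bar>cost_h0 sbar rH c0 c1 w\<bar> \<noteq> \<infinity>"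
    and c0: "\<And>r. c0 r \<noteq> - \<infinity>"
    and c1: "\<And>f. (\<lambda>s. c1 s (rH f s)) \<in> borel_measurable M"
    and s: "AE x in M. rH s x = max (rH (snd u) x) (rH (snd w) x)"
    and m: "AE x in M. rH m x = min (rH (snd u) x) (rH (snd w) x)"
  shows "cost_h0 sbar rH c0 c1 (max (fst u) (fst w), s) + cost_h0 sbar rH c0 c1 (min (fst u) (fst w), m)
    = cost_h0 sbar rH c0 c1 u + cost_h0 sbar rH c0 c1 w"
proof -
  note fu = cost_h0_finite[OF fin(1) c0] and fw = cost_h0_finite[OF fin(2) c0]
  obtain f where f: "integrable M f" "AE x in M. c1 x (rH (snd u) x) = ereal (f x)"
    "ext_integral M (\<lambda>x. c1 x (rH (snd u) x)) = ereal (\<integral>x. f x \<partial>M)"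
    by (rule ext_integral_finite[OF c1 fu(2)]) blast
  obtain g where g: "integrable M g" "AE x in M. c1 x (rH (snd w) x) = ereal (g x)"
    "ext_integral M (\<lambda>x. c1 x (rH (snd w) x)) = ereal (\<integral>x. g x \<partial>M)"
    by (rule ext_integral_finite[OF c1 fw(2)]) blast
  let ?P = "\<lambda>x. rH (snd w) x \<le> rH (snd u) x"
  have [measurable]: "rH h \<in> borel_measurable M" for h using rH_square_integrable by (simp add: square_integrable_def)
  have [measurable]: "f \<in> borel_measurable M" "g \<in> borel_measurable M" using f(1) g(1) by auto
  have int: "integrable M (\<lambda>x. if ?P x then f x else g x)" "integrable M (\<lambda>x. if ?P x then g x else f x)"
  proof -
    have bound: "integrable M (\<lambda>x. \<bar>f x\<bar> + \<bar>g x\<bar>)" using f(1) g(1) by auto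
    have meas: "(\<lambda>x. if ?P x then f x else g x) \<in> borel_measurable M" "(\<lambda>x. if ?P x then g x else f x) \<in> borel_measurable M"
      by measurable
    show "integrable M (\<lambda>x. if ?P x then f x else g x)"
      by (rule Bochner_Integration.integrable_bound[OF bound meas(1)]) (intro AE_I2, simp)
    show "integrable M (\<lambda>x. if ?P x then g x else f x)"
      by (rule Bochner_Integration.integrable_bound[OF bound meas(2)]) (intro AE_I2, simp)
  qed
  have "ext_integral M (\<lambda>x. c1 x (rH s x)) = ext_integral M (\<lambda>x. ereal (if ?P x then f x else g x))"
    by (rule ext_integral_cong) (use s f(2) g(2) in \<open>eventually_elim, simp add: max_def\<close>)
  then have es: "ext_integral M (\<lambda>x. c1 x (rH s x)) = ereal (\<integral>x. (if ?P x then f x else g x) \<partial>M)"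
    by (simp only: ext_integral_real[OF int(1)])
  have "ext_integral M (\<lambda>x. c1 x (rH m x)) = ext_integral M (\<lambda>x. ereal (if ?P x then g x else f x))"
    by (rule ext_integral_cong) (use m f(2) g(2) in \<open>eventually_elim, auto simp: min_def\<close>)
  then have em: "ext_integral M (\<lambda>x. c1 x (rH m x)) = ereal (\<integral>x. (if ?P x then g x else f x) \<partial>M)"
    by (simp only: ext_integral_real[OF int(2)])
  have "(\<integral>x. (if ?P x then f x else g x) \<partial>M) + (\<integral>x. (if ?P x then g x else f x) \<partial>M)
      = (\<integral>x. (if ?P x then f x else g x) + (if ?P x then g x else f x) \<partial>M)"
    by (rule Bochner_Integration.integral_add[OF int, symmetric])
  also have "\<dots> = (\<integral>x. f x + g x \<partial>M)" by (rule Bochner_Integration.integral_cong) auto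
  also have "\<dots> = (\<integral>x. f x \<partial>M) + (\<integral>x. g x \<partial>M)" using f(1) g(1) by simp
  finally have sum: "(\<integral>x. (if ?P x then f x else g x) \<partial>M) + (\<integral>x. (if ?P x then g x else f x) \<partial>M)
      = (\<integral>x. f x \<partial>M) + (\<integral>x. g x \<partial>M)" .
  obtain a b where ab: "c0 (fst u) = ereal a" "c0 (fst w) = ereal b" using fu(1) fw(1) by auto
  show ?thesis
    unfolding cost_h0_def fst_conv snd_conv es em f(3) g(3)
    using ab sum by (auto simp: max_def min_def)
qed

text \<open>Comparing the maximisers \<open>u\<close> for \<open>r a\<close> and \<open>w\<close> for \<open>r' a\<close> with the competitors
  \<open>max u w\<close> and \<open>min u w\<close>: modularity and strong convexity force \<open>max u w = u\<close>.\<close>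

lemma maximiser_monotone:
  fixes c :: real and G :: "real \<times> 'h \<Rightarrow> real \<times> 'h" and c0 :: "real \<Rightarrow> ereal" and c1 :: "real \<Rightarrow> real \<Rightarrow> ereal"
  defines "h0 \<equiv> cost_h0 sbar rH c0 c1"
  assumes c0: "\<And>r. c0 r \<noteq> - \<infinity>" and c1: "\<And>f. (\<lambda>s. c1 s (rH f s)) \<in> borel_measurable M"
    and lower: "\<And>z u. ereal (z \<bullet> u - hs z + c * (norm (u - G z))\<^sup>2) \<le> h0 u" and c: "0 < c"
    and attained: "\<And>z. h0 (G z) = ereal (z \<bullet> G z - hs z)"
    and a: "0 \<le> fst a" "AE x in M. 0 \<le> rH (snd a) x"
    and b: "0 \<le> fst b" "AE x in M. 0 \<le> rH (snd b) x"
    and r: "r' \<le> r"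
  shows "G (r' *\<^sub>R a) \<bullet> b \<le> G (r *\<^sub>R a) \<bullet> b"
proof -
  define u where "u = G (r *\<^sub>R a)"
  define w where "w = G (r' *\<^sub>R a)"
  obtain s m where s: "AE x in M. rH s x = max (rH (snd u) x) (rH (snd w) x)"
    and m: "AE x in M. rH m x = min (rH (snd u) x) (rH (snd w) x)" and sm: "s + m = snd u + snd w"
    by (rule ex_rH_max_min)
  define S where "S = (max (fst u) (fst w), s)"
  define N where "N = (min (fst u) (fst w), m)"
  have SN: "S + N = u + w" by (auto simp: S_def N_def prod_eq_iff sm max_def min_def)
  have "h0 S + h0 N = h0 u + h0 w"
    unfolding h0_def S_def N_def
    by (rule cost_h0_modular[where ?c0.0=c0 and ?c1.0=c1 and u=u and w=w and s=s and m=m, OF _ _ c0 c1 s m]) (simp_all add: attained[unfolded h0_def] u_def w_def)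
  also have "\<dots> = ereal (r *\<^sub>R a \<bullet> u - hs (r *\<^sub>R a) + (r' *\<^sub>R a \<bullet> w - hs (r' *\<^sub>R a)))"
    by (simp add: attained u_def w_def)
  finally have eq: "h0 S + h0 N = ereal (r *\<^sub>R a \<bullet> u - hs (r *\<^sub>R a) + (r' *\<^sub>R a \<bullet> w - hs (r' *\<^sub>R a)))" .
  \<comment> \<open>The maximum is tested with the larger slope, that of u, and the minimum with the
    smaller one, that of w; modularity evaluates the sum of their costs.\<close>
  have "ereal (r *\<^sub>R a \<bullet> S - hs (r *\<^sub>R a) + c * (norm (S - u))\<^sup>2) + ereal (r' *\<^sub>R a \<bullet> N - hs (r' *\<^sub>R a) + c * (norm (N - w))\<^sup>2) \<le> h0 S + h0 N"
    unfolding u_def w_def by (intro add_mono lower)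
  then have "r * (a \<bullet> S) + c * (norm (S - u))\<^sup>2 + r' * (a \<bullet> N) + c * (norm (N - w))\<^sup>2 \<le> r * (a \<bullet> u) + r' * (a \<bullet> w)"
    unfolding eq by simp
  moreover have "N = u + w - S" using SN by (simp add: algebra_simps)
  then have "a \<bullet> N = a \<bullet> u + a \<bullet> w - a \<bullet> S" by (simp add: inner_add_right inner_diff_right)
  moreover have "0 \<le> c * (norm (N - w))\<^sup>2" using c by simp
  \<comment> \<open>As S \<ge> u and a \<ge> 0, the right-hand side is nonpositive for r' \<le> r,
    so the maximum is u itself.\<close>
  ultimately have "c * (norm (S - u))\<^sup>2 \<le> (r - r') * (a \<bullet> u - a \<bullet> S)" by (simp add: algebra_simps)
  also have "\<dots> \<le> 0"
  proof (rule mult_nonneg_nonpos)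
    have "AE x in M. 0 \<le> rH (s + (-1) *\<^sub>R snd u) x"
      using s rH_combination[of s "-1" "snd u"] by eventually_elim simp
    then have "0 \<le> snd a \<bullet> (s - snd u)" using inner_nonneg[OF a(2)] by simp
    moreover have "0 \<le> fst a * (max (fst u) (fst w) - fst u)" using a(1) by simp
    ultimately show "a \<bullet> u - a \<bullet> S \<le> 0"
      by (simp add: S_def inner_prod_def inner_diff_right algebra_simps)
  qed (use r in simp)
  finally have "c * (norm (S - u))\<^sup>2 \<le> 0" .
  then have "(norm (S - u))\<^sup>2 \<le> 0" using c by (simp add: mult_le_0_iff)
  then have "S = u" by simp
  then have Su: "max (fst u) (fst w) = fst u" "s = snd u" by (auto simp: S_def prod_eq_iff)
  have "AE x in M. 0 \<le> rH (snd u + (-1) *\<^sub>R snd w) x"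
    using s rH_combination[of "snd u" "-1" "snd w"] unfolding Su(2) by eventually_elim simp
  then have "0 \<le> (snd u - snd w) \<bullet> snd b" using inner_nonneg[OF _ b(2)] by simp
  moreover have "0 \<le> (fst u - fst w) * fst b" using Su(1) b(1) by (intro mult_nonneg_nonneg) (auto simp: max_def split: if_splits)
  ultimately have "0 \<le> (u - w) \<bullet> b" by (simp add: inner_prod_def)
  then show ?thesis by (simp add: inner_diff_left u_def w_def)
qed

end

section \<open>Existence and uniqueness of the equilibrium point\<close>

theorem corollary4p4:
  fixes sbar :: ereal and \<mu> lam a b p :: real
    and rH :: "'h::{real_inner, complete_space, second_countable_topology} \<Rightarrow> real \<Rightarrow> real"
    and j :: "'v::{real_inner, complete_space, second_countable_topology} \<Rightarrow> 'h"
    and T :: "real \<Rightarrow> ('v \<Rightarrow>\<^sub>L real) \<Rightarrow>\<^sub>L ('v \<Rightarrow>\<^sub>L real)"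
    and \<alpha> :: 'v and R :: "real \<Rightarrow> real"
    and c0 :: "real \<Rightarrow> ereal" and c1 :: "real \<Rightarrow> real \<Rightarrow> ereal"
  defines "g0 \<equiv> profit_g0 R \<alpha>"
    and "h0 \<equiv> cost_h0 sbar rH c0 c1"
    and "h0s \<equiv> (\<lambda>z. real_of_ereal (conjugate (cost_h0 sbar rH c0 c1) z))"
    and "\<Psi> \<equiv> value_fun T (op_B sbar rH j) (profit_g0 R \<alpha>) (cost_h0 sbar rH c0 c1) p lam"
  assumes "0 < sbar" and "0 < \<mu>" and "0 < lam"
    and H: "is_L2 sbar rH"
    and V: "is_V sbar \<mu> rH j"
    and semigroup: "C0_semigroup T" "is_generator T (dom_A j) (op_A sbar \<mu> rH j)"
    and alpha_positive: "AE s in lebesgue_on (ages sbar). 0 \<le> rH (j \<alpha>) s"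
    and R: "concave_on UNIV R" "\<forall>r. R field_differentiable (at r)"
      "\<exists>L. L-lipschitz_on UNIV (deriv R)"
    and c0: "\<forall>r. c0 r \<noteq> - \<infinity>" "ereal_convex c0"
    and c1: "\<forall>s\<in>ages sbar. (\<forall>r. c1 s r \<noteq> - \<infinity>) \<and> ereal_convex (c1 s)"
      "\<forall>f. (\<lambda>s. c1 s (rH f s)) \<in> borel_measurable (lebesgue_on (ages sbar))"
    and g0: "g0 \<in> Sigma0"
    and h0: "ereal_convex h0" "lower_semicont h0" "subdiff_injective h0"
    and h0_conjugate: "conjugate h0 0 = 0" "\<forall>z. \<bar>conjugate h0 z\<bar> \<noteq> \<infinity>" "h0s \<in> Sigma0"
    and coercive: "0 < a" "2 \<le> p" "\<forall>u. ereal (a * norm u powr p + b) \<le> h0 u"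
    and growth: "p > 2 \<or> g0 \<in> growth_class 1"
    and smallness:
      "lam + \<mu> > 1 / \<mu> * lip_const (grad h0s) * lip_const (deriv R) * (norm \<alpha>)\<^sup>2 \<or>
       sbar < \<infinity> \<and>
       lam + \<mu> > real_of_ereal sbar / sqrt 2 *
         lip_const (grad h0s) * lip_const (deriv R) * (norm \<alpha>)\<^sup>2"
  shows "\<exists>!x. is_equilibrium sbar \<mu> rH j h0 \<Psi> x"
proof -
  interpret vs: vintage_semigroup sbar \<mu> rH j T
    by unfold_locales (rule \<open>0 < sbar\<close> \<open>0 < \<mu>\<close> H V semigroup)+
  have decay: "norm (T t) \<le> 1 * exp (- \<mu> * t)" if "0 \<le> t" for t using vs.T_decay[OF that] by simp
  obtain \<pi> where \<pi>: "\<And>x. blinfun_apply x \<pi> = (LINT t|half_line. exp (- lam * t) * blinfun_apply (blinfun_apply (T t) x) \<alpha>)"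
    and A_\<pi>: "vs.A0 \<pi> = lam *\<^sub>R j \<pi> - j \<alpha>"
    by (rule vs.resolvent_exists[OF decay, of lam \<alpha>]) (use \<open>0 < \<mu>\<close> \<open>0 < lam\<close> in auto)
  \<comment> \<open>The rate 0 is allowed because the growth exponent is -\<mu>.\<close>
  obtain \<eta> where A_\<eta>: "vs.A0 \<eta> = 0 *\<^sub>R j \<eta> - j \<alpha>"
    by (rule vs.resolvent_exists[OF decay, of 0 \<alpha>]) (use \<open>0 < \<mu>\<close> in auto)
  have \<pi>_pos: "AE s in vs.M. 0 \<le> rH (j \<pi>) s" "0 \<le> vs.tr \<pi>"
    using vs.resolvent_nonneg[OF A_\<pi> _ alpha_positive] \<open>0 < \<mu>\<close> \<open>0 < lam\<close> by auto
  have \<eta>_pos: "AE s in vs.M. 0 \<le> rH (j \<eta>) s" "0 \<le> vs.tr \<eta>"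
    using vs.resolvent_nonneg[OF A_\<eta> _ alpha_positive] \<open>0 < \<mu>\<close> by auto
  let ?G = "grad h0s" and ?Bs = "vs.Bs"
  obtain L where L: "0 < L" "\<And>z w. \<bar>h0s w - h0s z - (w - z) \<bullet> ?G z\<bar> \<le> L * (norm (w - z))\<^sup>2"
    and G_lip: "\<And>z w. norm (?G w - ?G z) \<le> L * norm (w - z)"
    by (rule Sigma0_gradient[OF h0_conjugate(3)]) blast
  have fin: "\<bar>conjugate h0 z\<bar> \<noteq> \<infinity>" for z using h0_conjugate(2) by (rule spec)
  have h0s_eq: "h0s = (\<lambda>z. real_of_ereal (conjugate h0 z))" by (simp add: h0s_def h0_def)
  have quad: "h0s w - h0s z - (w - z) \<bullet> ?G z \<le> L * (norm (w - z))\<^sup>2" for w z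
    using L(2)[of w z] by linarith
  have lower: "ereal (z \<bullet> u - h0s z + 1 / (4 * L) * (norm (u - ?G z))\<^sup>2) \<le> h0 u" for z u
    by (rule conjugate_strong_convexity[OF fin h0s_eq quad L(1)])
  have attained: "h0 (?G z) = ereal (z \<bullet> ?G z - h0s z)" for z
    by (rule conjugate_attained[OF fin h0s_eq quad L(1) h0(2)])
  obtain K where K: "K-lipschitz_on UNIV (deriv R)" using R(3) by blast
  note R_facts = concave_lipschitz_derivative[OF R(1,2) K]
  interpret cp: control_problem T ?Bs "op_B sbar rH j" \<alpha> \<pi> R "deriv R" h0 h0s ?G p lam "1 / (4 * L)" K
  proof (rule control_problem.intro[OF vs.dual_semigroup_axioms control_problem_axioms.intro])
    show "norm (T t) \<le> 1" if "0 \<le> t" for t by (rule vs.T_contraction[OF that])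
    show "bounded_linear ?Bs" by (rule vs.Bs_bounded_linear)
    show "blinfun_apply (op_B sbar rH j u) v = u \<bullet> ?Bs v" for u v by (rule vs.op_B_apply)
    show "1 \<le> p" using coercive(2) by simp
    show "0 \<le> K" using K lipschitz_on_nonneg by blast
    show "0 < 1 / (4 * L)" using L by simp
  qed (rule \<open>0 < lam\<close> R_facts(1) R_facts(2) R_facts(4) h0(1) h0(2) lower attained \<pi>)+
  have \<Psi>_eq: "\<Psi> = cp.\<Psi>" unfolding cp.\<Psi>_def by (simp only: \<Psi>_def h0_def)
  have costate: "- ?Bs ((- r) *\<^sub>R \<pi>) = r *\<^sub>R ?Bs \<pi>" for r
    using bounded_linear.linear[OF vs.Bs_bounded_linear] by (simp add: linear_scale linear_neg)
  have equilibrium_iff: "is_equilibrium sbar \<mu> rH j h0 \<Psi> x \<longleftrightarrow> x \<in> dom_A j \<and>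
      (\<exists>q. has_V_derivative cp.\<Psi> q x \<and> op_A sbar \<mu> rH j x + op_B sbar rH j (?G (- ?Bs q)) = 0)" for x
    by (simp add: is_equilibrium_def vs.op_Bstar_eq \<Psi>_eq h0s_eq)
  have stationary: "cp.stationary x d" if "x \<in> dom_A j" "op_A sbar \<mu> rH j x + op_B sbar rH j d = 0" for x d
    unfolding cp.stationary_def using vs.stationary_orbit[OF that] by blast
  \<comment> \<open>Testing the stationary equation with \<eta>, which A_0^* maps to -\<alpha>,
    isolates <x, \<alpha>>; this is the origin of the right-hand side of the scalar
    equation.\<close>
  have pairing: "blinfun_apply x \<alpha> = d \<bullet> ?Bs \<eta>"
    if x: "x \<in> dom_A j" and eq: "op_A sbar \<mu> rH j x + op_B sbar rH j d = 0" for x d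
  proof -
    obtain f where f: "x = emb_H j f" using x by (auto simp: dom_A_def)
    have "blinfun_apply (op_A sbar \<mu> rH j x + op_B sbar rH j d) \<eta> = 0" by (simp add: eq)
    then show ?thesis by (simp add: blinfun.add_left f vs.op_A_apply A_\<eta> vs.op_B_apply vs.emb_H_apply)
  qed
  define \<Phi> where "\<Phi> \<rho> = ?G (deriv R \<rho> *\<^sub>R ?Bs \<pi>) \<bullet> ?Bs \<eta>" for \<rho>
  have anti: "\<Phi> s \<le> \<Phi> r" if "r \<le> s" for r s
    unfolding \<Phi>_def
  proof (rule vs.maximiser_monotone[where hs=h0s and c="1 / (4 * L)" and ?c0.0=c0 and ?c1.0=c1])
    show "ereal (z \<bullet> u - h0s z + 1 / (4 * L) * (norm (u - ?G z))\<^sup>2) \<le> cost_h0 sbar rH c0 c1 u" for z u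
      using lower by (simp add: h0_def)
    show "cost_h0 sbar rH c0 c1 (?G z) = ereal (z \<bullet> ?G z - h0s z)" for z using attained by (simp add: h0_def)
    show "deriv R s \<le> deriv R r" by (rule R_facts(3)[OF that])
  qed (use c0 c1 L \<pi>_pos \<eta>_pos in \<open>auto simp: vs.Bs_def\<close>)
  have G_cont: "continuous_on UNIV ?G"
  proof -
    have "L-lipschitz_on UNIV ?G" using G_lip L(1) by (intro lipschitz_onI) (auto simp: dist_norm)
    then show ?thesis by (rule lipschitz_on_continuous_on)
  qed
  have "continuous_on UNIV \<Phi>"
    unfolding \<Phi>_def
    by (intro continuous_intros continuous_on_compose2[OF G_cont] R_facts(5)) auto
  from antitone_fixed_point[OF this anti] obtain \<rho> where \<rho>: "\<Phi> \<rho> = \<rho>" by blast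
  define d where "d = ?G (deriv R \<rho> *\<^sub>R ?Bs \<pi>)"
  \<comment> \<open>The fixed point determines the control; the state is obtained by inverting A,
    and \<open>pairing\<close> then recovers \<rho> from it.\<close>
  obtain x where x: "x \<in> dom_A j" "op_A sbar \<mu> rH j x = - op_B sbar rH j d"
    using vs.op_A_surj by blast
  have Ax: "op_A sbar \<mu> rH j x + op_B sbar rH j d = 0" by (simp add: x)
  have x\<alpha>: "blinfun_apply x \<alpha> = \<rho>" using pairing[OF x(1) Ax] \<rho> by (simp add: \<Phi>_def d_def)
  define q where "q = (- deriv R \<rho>) *\<^sub>R \<pi>"
  have d: "d = ?G (- ?Bs q)" by (simp only: d_def q_def costate)
  have q: "q = (- deriv R (blinfun_apply x \<alpha>)) *\<^sub>R \<pi>" by (simp only: q_def x\<alpha>)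
  note value_facts = cp.value_at_costate_equilibrium[OF stationary[OF x(1) Ax] d q]
  show ?thesis
  proof (rule ex1I[of _ x])
    show "is_equilibrium sbar \<mu> rH j h0 \<Psi> x"
      unfolding equilibrium_iff using x(1) value_facts(1) Ax d by blast
    fix y assume "is_equilibrium sbar \<mu> rH j h0 \<Psi> y"
    then obtain k where y: "y \<in> dom_A j" and k: "has_V_derivative cp.\<Psi> k y"
      and Ay: "op_A sbar \<mu> rH j y + op_B sbar rH j (?G (- ?Bs k)) = 0"
      unfolding equilibrium_iff by blast
    let ?\<rho> = "blinfun_apply y \<alpha>"
    \<comment> \<open>The finiteness of the value at all states is taken from the equilibrium
      constructed above.\<close>
    have "k = (- deriv R ?\<rho>) *\<^sub>R \<pi>"
      by (rule cp.equilibrium_costate[OF stationary[OF y Ay] refl k value_facts(2)])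
    then have G: "?G (- ?Bs k) = ?G (deriv R ?\<rho> *\<^sub>R ?Bs \<pi>)" by (simp only: costate)
    have "\<Phi> ?\<rho> = ?\<rho>" using pairing[OF y Ay] by (simp add: \<Phi>_def G)
    \<comment> \<open>Two fixed points of a nonincreasing function coincide, since the function
      reverses their order. Equal \<rho> give equal controls and hence equal images under A.\<close>
    then have "?\<rho> = \<rho>" using \<rho> anti[of ?\<rho> \<rho>] anti[of \<rho> ?\<rho>] by linarith
    then have "op_A sbar \<mu> rH j y = op_A sbar \<mu> rH j x"
      using Ay by (simp add: G x(2) d_def eq_neg_iff_add_eq_0)
    then show "y = x" by (rule vs.op_A_inj[OF y x(1)])
  qed
qed

end
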